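(* Let $\lambda>0$, let $c_k\in(0,1)$ for $k\ge1$, let $l_k=e^{-\lambda k}$, let $I_k$ be the open interval of length $l_k$ centered at $c_k$, and let $S=\bigcap_{m\ge1}\bigcup_{k\ge m}I_k$. Assume that assumptions (A1), (A2), (A3) below hold. Then $\mathrm{Cap}(S)=\mathrm{Cap}([0,1])>0$.
   Context: Interaction: $I(\nu,\mu)=\iint(-\log|z-w|)\,d\nu(z)\,d\mu(w)$, energy $I(\mu)=I(\mu,\mu)$; capacity $\mathrm{Cap}(E)=\exp(-\inf I(\mu))$, the infimum over Borel probability measures with compact support contained in $E$ ($e^{-\infty}=0$). Notation: $\mathcal{A}_n=\{n,\dots,2n-1\}$ and, for $q\in\mathbb{N}$, $\mathcal{A}_{n,q}=\mathcal{A}_n\cup\mathcal{A}_{2n}\cup\cdots\cup\mathcal{A}_{2^q n}$. (A1) There is $\phi\in L^1([0,1],dx)$ with $\phi>0$ a.e. such that for every $f\in C([0,1])$, $\frac{1}{\#\mathcal{A}_n}\sum_{k\in\mathcal{A}_n}f(c_k)\to\int_0^1 f(x)\phi(x)\,dx$ as $n\to\infty$. Moreover there is a sequence of integers $q(n)\to\infty$ such that: (A2) for every $\varepsilon>0$ there is $\delta>0$ such that for all sufficiently large $n$ and all $n',n''\in\{n,2n,\dots,2^{q(n)}n\}$, $\frac{1}{\#(\mathcal{A}_{n'}\times\mathcal{A}_{n''})}\sum(-\log|c_i-c_j|)<\varepsilon$, the sum over $i\in\mathcal{A}_{n'}$, $j\in\mathcal{A}_{n''}$ with $i\ne j$ and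 $|c_i-c_j|<\delta$; (A3) for every $\varepsilon>0$, for all sufficiently large $n$ and all $i\ne j$ in $\mathcal{A}_{n,q(n)}$, $\frac{l_i+l_j}{2|c_i-c_j|}<\varepsilon$. *)

theory Defs
  imports "HOL-Probability.Probability"
begin

definition logker_pos :: "complex \<Rightarrow> complex \<Rightarrow> ennreal" where
  "logker_pos z w = (if z = w then \<infinity> else ennreal (max 0 (- ln (cmod (z - w)))))"

definition logker_neg :: "complex \<Rightarrow> complex \<Rightarrow> ennreal" where
  "logker_neg z w = (if z = w then 0 else ennreal (max 0 (ln (cmod (z - w)))))"

definition interaction :: "complex measure \<Rightarrow> complex measure \<Rightarrow> ereal" where
  "interaction \<nu> \<mu> =
     enn2ereal (\<integral>\<^sup>+ w. (\<integral>\<^sup>+ z. logker_pos z w \<partial>\<nu>) \<partial>\<mu>)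
   - enn2ereal (\<integral>\<^sup>+ w. (\<integral>\<^sup>+ z. logker_neg z w \<partial>\<nu>) \<partial>\<mu>)"

definition energy :: "complex measure \<Rightarrow> ereal" where
  "energy \<mu> = interaction \<mu> \<mu>"

text \<open>Borel probability measures on C whose support is compact and contained in E
  (support contained in a compact K \<subseteq> E, i.e. the complement of K is null).\<close>

definition admissible :: "complex set \<Rightarrow> complex measure set" where
  "admissible E = {\<mu>. sets \<mu> = sets borel \<and> prob_space \<mu> \<and>
      (\<exists>K. compact K \<and> K \<subseteq> E \<and> emeasure \<mu> (UNIV - K) = 0)}"

definition capacity :: "complex set \<Rightarrow> ereal" where
  "capacity E = (case (INF \<mu>\<in>admissible E. energy \<mu>) of
      ereal r \<Rightarrow> ereal (exp (- r)) | PInfty \<Rightarrow> 0 | MInfty \<Rightarrow> \<infinity>)"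

definition blockA :: "nat \<Rightarrow> nat set" where
  "blockA n = {n..<2*n}"

definition blockAq :: "nat \<Rightarrow> nat \<Rightarrow> nat set" where
  "blockAq n q = (\<Union>j\<le>q. blockA (2^j * n))"

definition neglog :: "real \<Rightarrow> ereal" where
  "neglog x = (if x = 0 then \<infinity> else ereal (- ln x))"

end

theory Submission
  imports Defs
begin

text \<open>On the interval \<open>[0, 1]\<close> the energy is the increasing limit of energies for bounded continuous
  truncations of the logarithmic kernel, so it is lower semicontinuous under weak convergence. It
  therefore suffices to start with a measure \<open>g \<phi> dx\<close>, \<open>g\<close> continuous, of nearly minimal energy, and to
  replace it again and again, at an arbitrarily small cost of energy, by a measure \<open>h \<phi> dx\<close> whose support
  lies in the support of \<open>g\<close> and in finitely many \<open>I\<^sub>k\<close> with \<open>k\<close> large: a weak limit lives on a compact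
  subset of the limsup set. For one such step put mass proportional to \<open>g(c\<^sub>k) / (2\<^sup>a n)\<close> on \<open>I\<^sub>k\<close> for \<open>k\<close> in
  the blocks starting at \<open>2\<^sup>a n\<close>, \<open>a \<le> q(n)\<close>. Equidistribution gives the truncated energy, (A2) and (A3)
  control near pairs, and the self-energies \<open>lam k\<close> of the intervals contribute only \<open>O(1 / q(n))\<close>. Passing
  from densities with respect to \<open>dx\<close> to densities with respect to \<open>\<phi> dx\<close> is dominated convergence,
  because (A2) forces \<open>\<phi> dx\<close> to have finite energy.\<close>

subsection \<open>Logarithmic kernel and energy\<close>

text \<open>The obstacle is the diagonal. Mass \<open>1/n\<close> on an interval of length
  \<open>exp (- lam * k)\<close> with \<open>n \<le> k < 2n\<close> has self-energy of order
  \<open>lam * k / n^2\<close>; over the n intervals of one block this adds up to a constant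
  multiple of \<open>lam\<close>, however large n is. The block at \<open>2^a * n\<close> costs the
  same for every a, since its self-energies grow exactly as fast as its number of points. But a
  self-energy carries the square of a weight: sharing the mass among q + 1 blocks divides each cost
  by \<open>(q + 1)^2\<close>, while only q + 1 of them are added. The second constraint is
  repeatability. Equidistribution tests continuous functions against \<open>\<phi> dx\<close>,
  whereas concentration produces a density with respect to \<open>dx\<close>. Returning would need
  the factor \<open>1/\<phi>\<close>, which may be unbounded and discontinuous, so it is truncated
  and approximated by continuous functions. After an initial smoothing, densities are changed only
  by multiplication with continuous nonnegative functions, so that supports can only shrink. Bumps
  of radius \<open>l k / 4\<close> leave room inside the open intervals for passing to
  closures.\<close>

definition logker :: "real \<Rightarrow> real \<Rightarrow> ennreal" where
  "logker x y = (if x = y then \<infinity> else ennreal (max 0 (- ln \<bar>x - y\<bar>)))"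

text \<open>The inner minimum makes the truncated kernel a lower bound for \<open>logker\<close> everywhere, not only
  for points at distance at most \<open>1\<close>.\<close>

definition trunc_log :: "real \<Rightarrow> real \<Rightarrow> real \<Rightarrow> real" where
  "trunc_log \<delta> x y = - ln (max \<delta> (min 1 \<bar>x - y\<bar>))"

definition log_energy :: "real measure \<Rightarrow> ennreal" where
  "log_energy M = (\<integral>\<^sup>+ y. (\<integral>\<^sup>+ x. logker x y \<partial>M) \<partial>M)"

lemma logker_measurable_pair [measurable]:
  assumes [measurable]: "f \<in> borel_measurable M" "g \<in> borel_measurable M"
  shows "(\<lambda>x. logker (f x) (g x)) \<in> borel_measurable M"
  unfolding logker_def by measurable

lemma trunc_log_nonneg: "0 < \<delta> \<Longrightarrow> \<delta> \<le> 1 \<Longrightarrow> 0 \<le> trunc_log \<delta> x y"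
  unfolding trunc_log_def by (auto simp: max_def min_def)

lemma trunc_log_le: "0 < \<delta> \<Longrightarrow> trunc_log \<delta> x y \<le> - ln \<delta>"
  unfolding trunc_log_def by simp

lemma trunc_log_commute: "trunc_log \<delta> x y = trunc_log \<delta> y x"
  by (simp add: trunc_log_def abs_minus_commute)

lemma trunc_log_le_logker: "0 < \<delta> \<Longrightarrow> ennreal (trunc_log \<delta> x y) \<le> logker x y"
  unfolding trunc_log_def logker_def
  by (auto intro!: ennreal_leI simp: max_def min_def)

lemma continuous_on_trunc_log:
  assumes "0 < \<delta>"
  shows "continuous_on UNIV (\<lambda>p. trunc_log \<delta> (fst p) (snd p))"
  unfolding trunc_log_def using assms
  by (intro continuous_intros) (auto simp: max_def min_def split: if_splits)

lemma trunc_log_measurable [measurable]: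
  assumes [measurable]: "f \<in> borel_measurable M" "g \<in> borel_measurable M"
  shows "(\<lambda>x. trunc_log \<delta> (f x) (g x)) \<in> borel_measurable M"
  unfolding trunc_log_def by measurable

lemma SUP_trunc_log: "(SUP n. ennreal (trunc_log (1 / real (Suc n)) x y)) = logker x y"
proof (cases "x = y")
  case True
  have "(SUP n. ennreal (trunc_log (1 / real (Suc n)) x y)) = top"
  proof (rule ennreal_SUP_eq_top)
    fix k :: nat
    obtain m :: nat where m: "exp (real k) < real m" using reals_Archimedean2 by blast
    have "real k = ln (exp (real k))" by simp
    also have "\<dots> \<le> ln (real (Suc m))" using m by (subst ln_le_cancel_iff) auto
    also have "\<dots> = trunc_log (1 / real (Suc m)) x y"
      using True by (simp add: trunc_log_def ln_div max_def)
    finally have "real k \<le> trunc_log (1 / real (Suc m)) x y" .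
    then have "of_nat k \<le> ennreal (trunc_log (1 / real (Suc m)) x y)"
      by (simp add: ennreal_of_nat_eq_real_of_nat ennreal_leI)
    then show "\<exists>i\<in>UNIV. of_nat k \<le> ennreal (trunc_log (1 / real (Suc i)) x y)" by blast
  qed
  then show ?thesis using True by (simp add: logker_def)
next
  case False
  show ?thesis
  proof (rule antisym)
    show "(SUP n. ennreal (trunc_log (1 / real (Suc n)) x y)) \<le> logker x y"
      by (intro SUP_least trunc_log_le_logker) simp
    obtain m :: nat where "max 1 (1 / \<bar>x - y\<bar>) < real m"
      using reals_Archimedean2 by blast
    then have m: "0 < real m" "1 / \<bar>x - y\<bar> < real m" by linarith+
    have "1 / real (Suc m) \<le> \<bar>x - y\<bar>" using m False by (simp add: field_simps)
    moreover have "1 / real (Suc m) \<le> 1" by simp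
    ultimately have "max (1 / real (Suc m)) (min 1 \<bar>x - y\<bar>) = min 1 \<bar>x - y\<bar>"
      by linarith
    then have "trunc_log (1 / real (Suc m)) x y = - ln (min 1 \<bar>x - y\<bar>)"
      by (simp add: trunc_log_def)
    also have "\<dots> = max 0 (- ln \<bar>x - y\<bar>)"
      using False by (auto simp: max_def min_def)
    finally have "logker x y = ennreal (trunc_log (1 / real (Suc m)) x y)"
      using False by (simp add: logker_def)
    then show "logker x y \<le> (SUP n. ennreal (trunc_log (1 / real (Suc n)) x y))"
      by (simp only:) (rule SUP_upper, rule UNIV_I)
  qed
qed

lemma trunc_log_antimono: "0 < \<delta> \<Longrightarrow> \<delta> \<le> \<delta>' \<Longrightarrow> trunc_log \<delta>' x y \<le> trunc_log \<delta> x y"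
  unfolding trunc_log_def by auto

lemma borel_measurable_sets_borel:
  "sets M = sets borel \<Longrightarrow> f \<in> borel_measurable borel \<Longrightarrow> f \<in> borel_measurable M"
  by (simp only: measurable_cong_sets[of M borel borel borel])

lemma measurable_inner_nn_integral:
  fixes F :: "real \<Rightarrow> real \<Rightarrow> ennreal"
  assumes "sets M = sets (borel :: real measure)" "sigma_finite_measure M"
    "case_prod F \<in> borel_measurable (borel \<Otimes>\<^sub>M borel)"
  shows "(\<lambda>y. \<integral>\<^sup>+ x. F y x \<partial>M) \<in> borel_measurable borel"
proof -
  interpret sigma_finite_measure M by fact
  have "case_prod F \<in> borel_measurable (borel \<Otimes>\<^sub>M M)"
    using assms(3) by (subst measurable_cong_sets[OF sets_pair_measure_cong[OF refl assms(1)] refl])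
  then show ?thesis by measurable
qed

text \<open>Monotone convergence in each variable. Its use: a bound on the truncated energies that
  is uniform in the truncation bounds the energy itself, and truncated energies involve only a
  bounded continuous kernel.\<close>

lemma log_energy_eq_SUP:
  assumes sets: "sets M = sets borel" and "sigma_finite_measure M"
  shows "log_energy M = (SUP n. \<integral>\<^sup>+ y. (\<integral>\<^sup>+ x. ennreal (trunc_log (1 / real (Suc n)) x y) \<partial>M) \<partial>M)"
proof -
  have sp: "space M = UNIV" using sets_eq_imp_space_eq[OF sets] by simp
  have [measurable]: "(\<lambda>y. \<integral>\<^sup>+ x. ennreal (trunc_log \<delta> x y) \<partial>M) \<in> borel_measurable M" for \<delta>
  proof -
    have "(\<lambda>y. \<integral>\<^sup>+ x. ennreal (trunc_log \<delta> x y) \<partial>M) \<in> borel_measurable borel"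
      by (rule measurable_inner_nn_integral[OF assms]) measurable
    then show ?thesis by (subst measurable_cong_sets[OF sets refl])
  qed
  have mono: "trunc_log (1 / real (Suc m)) x y \<le> trunc_log (1 / real (Suc n)) x y" if "m \<le> n" for m n x y
    using that by (intro trunc_log_antimono) (auto simp: field_simps)
  have [measurable]: "(\<lambda>x. ennreal (trunc_log \<delta> x y)) \<in> borel_measurable M" for \<delta> y
  proof -
    have "(\<lambda>x. ennreal (trunc_log \<delta> x y)) \<in> borel_measurable borel" by measurable
    then show ?thesis by (subst measurable_cong_sets[OF sets refl])
  qed
  have "log_energy M = (\<integral>\<^sup>+ y. (\<integral>\<^sup>+ x. (SUP n. ennreal (trunc_log (1 / real (Suc n)) x y)) \<partial>M) \<partial>M)"
    unfolding log_energy_def SUP_trunc_log ..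
  also have "\<dots> = (\<integral>\<^sup>+ y. (SUP n. \<integral>\<^sup>+ x. ennreal (trunc_log (1 / real (Suc n)) x y) \<partial>M) \<partial>M)"
    by (intro nn_integral_cong nn_integral_monotone_convergence_SUP)
       (auto simp: incseq_def le_fun_def simp del: of_nat_Suc intro!: ennreal_leI mono)
  also have "\<dots> = (SUP n. \<integral>\<^sup>+ y. (\<integral>\<^sup>+ x. ennreal (trunc_log (1 / real (Suc n)) x y) \<partial>M) \<partial>M)"
    by (intro nn_integral_monotone_convergence_SUP)
       (auto simp: incseq_def le_fun_def simp del: of_nat_Suc intro!: nn_integral_mono ennreal_leI mono)
  finally show ?thesis .
qed

text \<open>Bridge between two worlds: energies are \<open>ennreal\<close> integrals, while averages
  over blocks and weak limits are handled with real integrals.\<close>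

lemma nn_integral_double_bounded:
  fixes F :: "real \<Rightarrow> real \<Rightarrow> real"
  assumes sets: "sets M = sets borel" and "prob_space M"
    and F[measurable]: "case_prod F \<in> borel_measurable (borel \<Otimes>\<^sub>M borel)"
    and bd: "\<And>x y. 0 \<le> F x y" "\<And>x y. F x y \<le> B"
  shows "(\<integral>\<^sup>+ x. (\<integral>\<^sup>+ y. ennreal (F x y) \<partial>M) \<partial>M) = ennreal (\<integral>x. (\<integral>y. F x y \<partial>M) \<partial>M)"
proof -
  interpret prob_space M by fact
  have [measurable]: "(\<lambda>y. F x y) \<in> borel_measurable M" for x
    by (rule borel_measurable_sets_borel[OF sets]) measurable
  have int: "integrable M (F x)" for x
    by (rule integrable_const_bound[where B = B]) (auto simp: bd)
  have 1: "(\<integral>\<^sup>+ y. ennreal (F x y) \<partial>M) = ennreal (\<integral>y. F x y \<partial>M)" for x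
    by (intro nn_integral_eq_integral int) (auto simp: bd)
  have m2: "(\<lambda>x. \<integral>y. F x y \<partial>M) \<in> borel_measurable M"
  proof (rule borel_measurable_lebesgue_integral)
    show "case_prod F \<in> borel_measurable (M \<Otimes>\<^sub>M M)"
      by (subst measurable_cong_sets[OF sets_pair_measure_cong[OF sets sets] refl]) measurable
  qed
  have b: "0 \<le> (\<integral>y. F x y \<partial>M)" "(\<integral>y. F x y \<partial>M) \<le> B" for x
  proof -
    show "0 \<le> (\<integral>y. F x y \<partial>M)" by (simp add: bd)
    have "(\<integral>y. F x y \<partial>M) \<le> (\<integral>y. B \<partial>M)"
      by (intro integral_mono int) (auto simp: bd)
    then show "(\<integral>y. F x y \<partial>M) \<le> B" by (simp add: prob_space)
  qed
  have "integrable M (\<lambda>x. \<integral>y. F x y \<partial>M)"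
    using b m2 by (intro integrable_const_bound[where B = B]) auto
  then show ?thesis
    unfolding 1 using b by (subst nn_integral_eq_integral) auto
qed

lemma nn_integral_trunc_log:
  assumes "sets M = sets borel" "prob_space M" and \<delta>: "0 < \<delta>" "\<delta> \<le> 1"
  shows "(\<integral>\<^sup>+ y. (\<integral>\<^sup>+ x. ennreal (trunc_log \<delta> x y) \<partial>M) \<partial>M) = ennreal (\<integral>x. (\<integral>y. trunc_log \<delta> x y \<partial>M) \<partial>M)"
proof -
  have "(\<integral>\<^sup>+ y. (\<integral>\<^sup>+ x. ennreal (trunc_log \<delta> x y) \<partial>M) \<partial>M) =
      (\<integral>\<^sup>+ y. (\<integral>\<^sup>+ x. ennreal (trunc_log \<delta> y x) \<partial>M) \<partial>M)"
    by (intro nn_integral_cong arg_cong[where f = ennreal] trunc_log_commute)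
  also have "\<dots> = ennreal (\<integral>x. (\<integral>y. trunc_log \<delta> x y \<partial>M) \<partial>M)"
    by (rule nn_integral_double_bounded[OF assms(1,2), where B = "- ln \<delta>"])
       (auto simp: trunc_log_nonneg trunc_log_le \<delta>)
  finally show ?thesis .
qed

lemma log_energy_density:
  assumes sets: "sets M = sets (borel :: real measure)" and [measurable]: "f \<in> borel_measurable borel"
    and "sigma_finite_measure M"
  shows "log_energy (density M f) = (\<integral>\<^sup>+ y. f y * (\<integral>\<^sup>+ x. f x * logker x y \<partial>M) \<partial>M)"
proof -
  have "(\<integral>\<^sup>+ x. logker x y \<partial>density M f) = (\<integral>\<^sup>+ x. f x * logker x y \<partial>M)" for y
    by (intro nn_integral_density borel_measurable_sets_borel[OF sets]) measurable
  moreover have "(\<lambda>y. \<integral>\<^sup>+ x. f x * logker x y \<partial>M) \<in> borel_measurable borel"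
    by (rule measurable_inner_nn_integral[OF sets assms(3)]) measurable
  ultimately show ?thesis
    unfolding log_energy_def
    by (simp only:) (intro nn_integral_density borel_measurable_sets_borel[OF sets] assms(2))
qed

lemma log_energy_density_mono:
  assumes "sets M = sets (borel :: real measure)" "f \<in> borel_measurable borel" "g \<in> borel_measurable borel"
    and "sigma_finite_measure M" and "AE x in M. f x \<le> g x"
  shows "log_energy (density M f) \<le> log_energy (density M g)"
proof -
  have "AE y in M. f y * (\<integral>\<^sup>+ x. f x * logker x y \<partial>M) \<le> g y * (\<integral>\<^sup>+ x. g x * logker x y \<partial>M)"
    using assms(5)
  proof (rule eventually_mono)
    fix y assume y: "f y \<le> g y"
    have "(\<integral>\<^sup>+ x. f x * logker x y \<partial>M) \<le> (\<integral>\<^sup>+ x. g x * logker x y \<partial>M)"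
      by (intro nn_integral_mono_AE eventually_mono[OF assms(5)] mult_right_mono) auto
    then show "f y * (\<integral>\<^sup>+ x. f x * logker x y \<partial>M) \<le> g y * (\<integral>\<^sup>+ x. g x * logker x y \<partial>M)"
      using y by (intro mult_mono) auto
  qed
  then show ?thesis
    by (simp add: log_energy_density assms(1-4) nn_integral_mono_AE)
qed

lemma log_energy_density_const:
  assumes sets: "sets M = sets (borel :: real measure)" and [measurable]: "f \<in> borel_measurable borel"
    and "sigma_finite_measure M"
  shows "log_energy (density M (\<lambda>x. a * f x)) = a^2 * log_energy (density M f)"
proof -
  have sf: "(\<lambda>y. \<integral>\<^sup>+ x. f x * logker x y \<partial>M) \<in> borel_measurable borel"
    by (rule measurable_inner_nn_integral[OF sets assms(3)]) measurable
  have "log_energy (density M (\<lambda>x. a * f x)) = (\<integral>\<^sup>+ y. a * f y * (\<integral>\<^sup>+ x. a * f x * logker x y \<partial>M) \<partial>M)"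
    by (rule log_energy_density[OF sets _ assms(3)]) measurable
  also have "\<dots> = (\<integral>\<^sup>+ y. a * f y * (a * (\<integral>\<^sup>+ x. f x * logker x y \<partial>M)) \<partial>M)"
  proof -
    have "(\<integral>\<^sup>+ x. a * (f x * logker x y) \<partial>M) = a * (\<integral>\<^sup>+ x. f x * logker x y \<partial>M)" for y
      by (intro nn_integral_cmult borel_measurable_sets_borel[OF sets]) measurable
    then show ?thesis by (simp only: mult.assoc)
  qed
  also have "\<dots> = (\<integral>\<^sup>+ y. a^2 * (f y * (\<integral>\<^sup>+ x. f x * logker x y \<partial>M)) \<partial>M)"
    by (simp add: power2_eq_square ac_simps)
  also have "\<dots> = a^2 * (\<integral>\<^sup>+ y. f y * (\<integral>\<^sup>+ x. f x * logker x y \<partial>M) \<partial>M)"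
    by (intro nn_integral_cmult borel_measurable_sets_borel[OF sets] borel_measurable_times_ennreal sf) measurable
  also have "(\<integral>\<^sup>+ y. f y * (\<integral>\<^sup>+ x. f x * logker x y \<partial>M) \<partial>M) = log_energy (density M f)"
    by (rule log_energy_density[OF sets _ assms(3), symmetric]) measurable
  finally show ?thesis .
qed

subsection \<open>Limits of averages and energies\<close>

text \<open>\<open>L n\<close> will be an average over a block of points or an integral: being a contraction for the
  supremum norm is all that passing from single to double limits requires.\<close>

lemma contraction_double_limit:
  fixes L :: "nat \<Rightarrow> (real \<Rightarrow> real) \<Rightarrow> real" and M :: "(real \<Rightarrow> real) \<Rightarrow> real"
  assumes contr: "\<And>n f g e. continuous_on {0..1} f \<Longrightarrow> continuous_on {0..1} g \<Longrightarrow>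
      (\<And>x. x \<in> {0..1} \<Longrightarrow> \<bar>f x - g x\<bar> \<le> e) \<Longrightarrow> \<bar>L n f - L n g\<bar> \<le> e"
    and contr0: "\<And>f g e. continuous_on {0..1} f \<Longrightarrow> continuous_on {0..1} g \<Longrightarrow>
      (\<And>x. x \<in> {0..1} \<Longrightarrow> \<bar>f x - g x\<bar> \<le> e) \<Longrightarrow> \<bar>M f - M g\<bar> \<le> e"
    and conv: "\<And>f. continuous_on {0..1} f \<Longrightarrow> (\<lambda>n. L n f) \<longlonglongrightarrow> M f"
    and F: "continuous_on ({0..1} \<times> {0..1}) (\<lambda>p. F (fst p) (snd p))"
    and e: "0 < e"
  shows "\<exists>N. \<forall>m\<ge>N. \<forall>n\<ge>N. \<bar>L m (\<lambda>x. L n (F x)) - M (\<lambda>x. M (F x))\<bar> < e"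
proof -
  have "uniformly_continuous_on ({0..1} \<times> {0..1}) (\<lambda>p. F (fst p) (snd p))"
    by (intro compact_uniformly_continuous F compact_Times) auto
  then have unif: "\<exists>d>0. \<forall>x\<in>{0..1}. \<forall>x'\<in>{0..1}. \<forall>y\<in>{0..1}. \<bar>x - x'\<bar> < d \<longrightarrow> \<bar>F x y - F x' y\<bar> \<le> \<epsilon>"
    if \<epsilon>: "0 < \<epsilon>" for \<epsilon>
  proof -
    obtain d where d: "d > 0" "\<And>p p'. p \<in> {0..1} \<times> {0..1} \<Longrightarrow> p' \<in> {0..1} \<times> {0..1} \<Longrightarrow> dist p' p < d \<Longrightarrow>
        dist (F (fst p') (snd p')) (F (fst p) (snd p)) < \<epsilon>"
      using \<open>uniformly_continuous_on _ _\<close> \<epsilon> unfolding uniformly_continuous_on_def by meson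
    have "\<bar>F x y - F x' y\<bar> \<le> \<epsilon>" if "x \<in> {0..1}" "x' \<in> {0..1}" "y \<in> {0..1}" "\<bar>x - x'\<bar> < d" for x x' y
      using d(2)[of "(x', y)" "(x, y)"] that by (simp add: dist_Pair_Pair dist_real_def)
    then show ?thesis using d(1) by blast
  qed
  have cF: "continuous_on {0..1} (F x)" if "x \<in> {0..1}" for x
    using continuous_on_compose2[OF F, of "{0..1}" "\<lambda>y. (x, y)"] that
    by (force intro!: continuous_intros)
  \<comment> \<open>Uniform continuity of F makes the sections \<open>F x\<close> and
    \<open>F x'\<close> uniformly close, and a contraction preserves this. So the inner average is
    again a continuous function, to which \<open>conv\<close> applies.\<close>
  have cont: "continuous_on {0..1} (\<lambda>x. \<Lambda> (F x))"
    if \<Lambda>: "\<And>f g e. continuous_on {0..1} f \<Longrightarrow> continuous_on {0..1} g \<Longrightarrow>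
      (\<And>x. x \<in> {0..1} \<Longrightarrow> \<bar>f x - g x\<bar> \<le> e) \<Longrightarrow> \<bar>\<Lambda> f - \<Lambda> g\<bar> \<le> e" for \<Lambda> :: "(real \<Rightarrow> real) \<Rightarrow> real"
    unfolding continuous_on_iff
  proof (intro ballI allI impI)
    fix x \<epsilon> :: real assume x: "x \<in> {0..1}" and \<epsilon>: "0 < \<epsilon>"
    obtain d where d: "d > 0" "\<forall>x\<in>{0..1}. \<forall>x'\<in>{0..1}. \<forall>y\<in>{0..1}. \<bar>x - x'\<bar> < d \<longrightarrow> \<bar>F x y - F x' y\<bar> \<le> \<epsilon>/2"
      using unif[of "\<epsilon>/2"] \<epsilon> by auto
    have "dist (\<Lambda> (F x')) (\<Lambda> (F x)) < \<epsilon>" if "x' \<in> {0..1}" "dist x' x < d" for x'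
    proof -
      have "\<bar>\<Lambda> (F x') - \<Lambda> (F x)\<bar> \<le> \<epsilon>/2"
        using that x d(2) by (intro \<Lambda> cF) (auto simp: dist_real_def)
      then show ?thesis using \<epsilon> by (simp add: dist_real_def)
    qed
    then show "\<exists>d>0. \<forall>x'\<in>{0..1}. dist x' x < d \<longrightarrow> dist (\<Lambda> (F x')) (\<Lambda> (F x)) < \<epsilon>"
      using d(1) by (intro exI[of _ d] conjI ballI impI)
  qed
  define h where "h n x = L n (F x)" for n x
  define h0 where "h0 x = M (F x)" for x
  have ch: "continuous_on {0..1} (h n)" for n
    unfolding h_def[abs_def] by (rule cont) (rule contr)
  have ch0: "continuous_on {0..1} h0"
    unfolding h0_def[abs_def] by (rule cont) (rule contr0)
  obtain d where d: "d > 0" "\<forall>x\<in>{0..1}. \<forall>x'\<in>{0..1}. \<forall>y\<in>{0..1}. \<bar>x - x'\<bar> < d \<longrightarrow> \<bar>F x y - F x' y\<bar> \<le> e/5"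
    using unif[of "e/5"] e by auto
  \<comment> \<open>Convergence of \<open>h n\<close> is known only point by point; a finite d-net
    and the modulus of continuity common to all \<open>h n\<close> and \<open>h0\<close> make it
    uniform.\<close>
  obtain A where A: "finite A" "A \<subseteq> {0..1::real}" "{0..1} \<subseteq> (\<Union>a\<in>A. ball a d)"
  proof -
    have "\<exists>A. finite A \<and> A \<subseteq> {0..1::real} \<and> {0..1} \<subseteq> (\<Union>a\<in>A. ball a d)"
      using seq_compact_imp_totally_bounded[OF compact_imp_seq_compact[OF compact_Icc]] d(1) by simp
    then show ?thesis using that by (elim exE conjE)
  qed
  have "\<forall>\<^sub>F n in sequentially. \<forall>a\<in>A. \<bar>h n a - h0 a\<bar> < e/5"
  proof (rule eventually_ball_finite[OF A(1)], rule ballI)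
    fix a assume "a \<in> A"
    then have "(\<lambda>n. h n a) \<longlonglongrightarrow> h0 a"
      unfolding h_def h0_def using A(2) by (intro conv cF) auto
    from tendstoD[OF this, of "e/5"] e show "\<forall>\<^sub>F n in sequentially. \<bar>h n a - h0 a\<bar> < e/5"
      by (simp add: dist_real_def)
  qed
  moreover have "\<forall>\<^sub>F n in sequentially. \<bar>L n h0 - M h0\<bar> < e/5"
    using tendstoD[OF conv[OF ch0], of "e/5"] e by (simp add: dist_real_def)
  ultimately have "\<forall>\<^sub>F n in sequentially. (\<forall>a\<in>A. \<bar>h n a - h0 a\<bar> < e/5) \<and> \<bar>L n h0 - M h0\<bar> < e/5"
    by (rule eventually_conj)
  then obtain N where N: "\<And>n a. n \<ge> N \<Longrightarrow> a \<in> A \<Longrightarrow> \<bar>h n a - h0 a\<bar> < e/5"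
      "\<And>n. n \<ge> N \<Longrightarrow> \<bar>L n h0 - M h0\<bar> < e/5"
    unfolding eventually_sequentially by blast
  have close: "\<bar>h n x - h0 x\<bar> \<le> 3 * e / 5" if nx: "n \<ge> N" "x \<in> {0..1}" for n x
  proof -
    obtain a where a: "a \<in> A" "\<bar>x - a\<bar> < d"
      using A(3) nx(2) by (auto simp: dist_real_def abs_minus_commute)
    then have a01: "a \<in> {0..1}" using A(2) by auto
    have "\<bar>h n x - h n a\<bar> \<le> e/5"
      unfolding h_def using a a01 nx d(2) by (intro contr cF) auto
    moreover have "\<bar>h0 x - h0 a\<bar> \<le> e/5"
      unfolding h0_def using a a01 nx d(2) by (intro contr0 cF) auto
    ultimately show ?thesis using N(1)[OF nx(1) a(1)] by linarith
  qed
  \<comment> \<open>Three errors \<open>e/5\<close> come from going through the net point and one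
    from the outer limit at \<open>h0\<close>, so \<open>4 * e / 5\<close> in total.\<close>
  have "\<bar>L m (h n) - M h0\<bar> < e" if "m \<ge> N" "n \<ge> N" for m n
  proof -
    have "\<bar>L m (h n) - L m h0\<bar> \<le> 3 * e / 5"
      using close that by (intro contr ch ch0) auto
    then show ?thesis using N(2)[OF that(1)] e by linarith
  qed
  then show ?thesis unfolding h_def[abs_def] h0_def[abs_def] by blast
qed

text \<open>Dominated convergence, inside and outside: the majorants are B times the kernel and
  \<open>B^2\<close> times the potential \<open>U\<close> of M. Finite energy of M makes the second
  integrable and \<open>U\<close> finite almost everywhere, which makes the first integrable for
  almost every y.\<close>

lemma log_energy_density_tendsto:
  fixes g :: "real \<Rightarrow> real" and u :: "nat \<Rightarrow> real \<Rightarrow> real"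
  assumes sets: "sets M = sets (borel :: real measure)" and sf: "sigma_finite_measure M"
    and fin: "log_energy M < \<infinity>"
    and [measurable]: "\<And>j. u j \<in> borel_measurable borel" "g \<in> borel_measurable borel"
    and bd: "\<And>j x. u j x \<le> B"
    and lim: "AE x in M. (\<lambda>j. u j x) \<longlonglongrightarrow> g x"
  shows "(\<lambda>j. log_energy (density M (u j))) \<longlonglongrightarrow> log_energy (density M g)"
proof -
  define U where "U y = (\<integral>\<^sup>+ x. logker x y \<partial>M)" for y
  define I where "I f y = (\<integral>\<^sup>+ x. ennreal (f x) * logker x y \<partial>M)" for f :: "real \<Rightarrow> real" and y
  have I_meas: "I f \<in> borel_measurable borel" if [measurable]: "f \<in> borel_measurable borel" for f
    unfolding I_def by (rule measurable_inner_nn_integral[OF sets sf]) measurable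
  have U_meas: "U \<in> borel_measurable borel"
    unfolding U_def by (rule measurable_inner_nn_integral[OF sets sf]) measurable
  have U_fin: "AE y in M. U y \<noteq> \<infinity>"
    using fin by (intro nn_integral_PInf_AE borel_measurable_sets_borel[OF sets] U_meas)
      (auto simp: log_energy_def U_def)
  have UB: "(\<integral>\<^sup>+ x. ennreal B * logker x y \<partial>M) = ennreal B * U y" for y
    unfolding U_def by (intro nn_integral_cmult borel_measurable_sets_borel[OF sets]) measurable
  have I_le: "I (u j) y \<le> ennreal B * U y" for j y
    unfolding UB[symmetric] I_def
    by (intro nn_integral_mono mult_right_mono ennreal_leI bd) auto
  have inner: "(\<lambda>j. I (u j) y) \<longlonglongrightarrow> I g y" if y: "U y \<noteq> \<infinity>" for y
    unfolding I_def
  proof (rule nn_integral_dominated_convergence[where w = "\<lambda>x. ennreal B * logker x y"])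
    \<comment> \<open>Multiplication in \<open>ennreal\<close> is not continuous at 0 times
      infinity, so the points where the kernel is infinite have to be null.\<close>
    have fin_k: "AE x in M. logker x y \<noteq> \<infinity>"
      using y by (intro nn_integral_PInf_AE borel_measurable_sets_borel[OF sets]) (auto simp: U_def)
    show "AE x in M. (\<lambda>j. ennreal (u j x) * logker x y) \<longlonglongrightarrow> ennreal (g x) * logker x y"
      using fin_k lim
      by eventually_elim (intro tendsto_mult_ennreal tendsto_ennrealI tendsto_const, auto)
    show "(\<integral>\<^sup>+ x. ennreal B * logker x y \<partial>M) < \<infinity>"
      using y by (simp add: UB ennreal_mult_less_top less_top)
    show "AE x in M. ennreal (u j x) * logker x y \<le> ennreal B * logker x y" for j
      by (intro AE_I2 mult_right_mono ennreal_leI bd) auto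
  qed (intro borel_measurable_sets_borel[OF sets], measurable)+
  have eq: "log_energy (density M f) = (\<integral>\<^sup>+ y. ennreal (f y) * I f y \<partial>M)"
    if [measurable]: "f \<in> borel_measurable borel" for f
    unfolding I_def by (rule log_energy_density[OF sets _ sf]) measurable
  have "(\<lambda>j. \<integral>\<^sup>+ y. ennreal (u j y) * I (u j) y \<partial>M) \<longlonglongrightarrow> (\<integral>\<^sup>+ y. ennreal (g y) * I g y \<partial>M)"
  proof (rule nn_integral_dominated_convergence[where w = "\<lambda>y. ennreal B * (ennreal B * U y)"])
    show "AE y in M. ennreal (u j y) * I (u j) y \<le> ennreal B * (ennreal B * U y)" for j
      by (intro AE_I2 mult_mono ennreal_leI bd I_le) auto
    have "(\<integral>\<^sup>+ y. ennreal B * (ennreal B * U y) \<partial>M) = ennreal B * (ennreal B * log_energy M)"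
    proof -
      have [measurable]: "U \<in> borel_measurable M" by (intro borel_measurable_sets_borel[OF sets] U_meas)
      show ?thesis by (simp add: nn_integral_cmult log_energy_def U_def[symmetric])
    qed
    then show "(\<integral>\<^sup>+ y. ennreal B * (ennreal B * U y) \<partial>M) < \<infinity>"
      using fin by (simp add: ennreal_mult_less_top)
    show "AE y in M. (\<lambda>j. ennreal (u j y) * I (u j) y) \<longlonglongrightarrow> ennreal (g y) * I g y"
      using U_fin lim
    proof eventually_elim
      case (elim y)
      have "I g y \<le> ennreal B * U y"
        using LIMSEQ_le_const2[OF inner[OF elim(1)]] I_le by blast
      then have "I g y \<noteq> \<infinity>"
        using elim(1) by (auto simp: top_unique ennreal_mult_eq_top_iff)
      then show ?case
        using inner[OF elim(1)] elim(2)
        by (intro tendsto_mult_ennreal tendsto_ennrealI) auto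
    qed
  qed (use U_meas I_meas in \<open>(intro borel_measurable_sets_borel[OF sets], measurable)+\<close>)
  then show ?thesis by (simp add: eq)
qed

subsection \<open>Tent functions\<close>

text \<open>The triangle has base \<open>2 * r\<close> and height r, hence the normalization by
  \<open>r^2\<close>. A continuous bump is preferred to an indicator because its product with a
  continuous density can enter the next round.\<close>

definition tent :: "real \<Rightarrow> real \<Rightarrow> real" where
  "tent r x = max 0 (r - \<bar>x\<bar>) / r^2"

lemma tent_nonneg: "0 \<le> tent r x"
  by (simp add: tent_def)

lemma tent_le: "0 < r \<Longrightarrow> tent r x \<le> 1 / r"
  by (auto simp: tent_def max_def field_simps power2_eq_square)

lemma tent_eq_0: "r \<le> \<bar>x\<bar> \<Longrightarrow> tent r x = 0"
  by (simp add: tent_def)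

lemma continuous_on_tent [continuous_intros]:
  "continuous_on A f \<Longrightarrow> continuous_on A (\<lambda>x. tent r (f x))"
  unfolding tent_def
  by (cases "r = 0") (auto intro!: continuous_intros)

lemma tent_measurable [measurable]: "tent r \<in> borel_measurable borel"
  by (intro borel_measurable_continuous_onI continuous_intros)

lemma nn_integral_tent:
  assumes r: "0 < r"
  shows "(\<integral>\<^sup>+ x. ennreal (tent r (x - c)) \<partial>lborel) = 1"
proof -
  have 1: "((\<lambda>x. (r + x) / r^2) has_integral ((r * 0 + 0^2/2) / r^2 - (r * (-r) + (-r)^2/2) / r^2)) {-r..0}"
    using r by (intro fundamental_theorem_of_calculus)
      (auto intro!: derivative_eq_intros simp: has_real_derivative_iff_has_vector_derivative[symmetric] field_simps)
  have 2: "((\<lambda>x. (r - x) / r^2) has_integral ((r * r - r^2/2) / r^2 - (r * 0 - 0^2/2) / r^2)) {0..r}"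
    using r by (intro fundamental_theorem_of_calculus)
      (auto intro!: derivative_eq_intros simp: has_real_derivative_iff_has_vector_derivative[symmetric] field_simps)
  have "(tent r has_integral 1/2) {-r..0}"
    using r by (intro has_integral_eq[OF _ has_integral_eq_rhs[OF 1]])
      (auto simp: tent_def max_def field_simps power2_eq_square)
  moreover have "(tent r has_integral 1/2) {0..r}"
    using r by (intro has_integral_eq[OF _ has_integral_eq_rhs[OF 2]])
      (auto simp: tent_def max_def field_simps power2_eq_square)
  ultimately have "(tent r has_integral (1/2 + 1/2)) {-r..r}"
    using r by (intro has_integral_combine[of "-r" 0 r]) auto
  then have "(tent r has_integral 1) {-r..r}" by simp
  then have "(tent r has_integral 1) UNIV"
  proof (rule has_integral_on_superset)
    show "tent r x = 0" if "x \<notin> {-r..r}" for x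
      using that by (intro tent_eq_0) auto
  qed simp
  then have I: "(\<integral>\<^sup>+ x. ennreal (tent r x) \<partial>lborel) = ennreal 1"
    by (intro nn_integral_has_integral_lborel) (auto simp: tent_nonneg)
  have "(\<integral>\<^sup>+ x. ennreal (tent r (x - c)) \<partial>lborel) = (\<integral>\<^sup>+ x. ennreal (tent r x) \<partial>lborel)"
    by (subst nn_integral_real_affine[where c = 1 and t = c]) (auto)
  with I show ?thesis by simp
qed

text \<open>Origin of the summand 8 in the potential bounds: \<open>2 / sqrt \<bar>x\<bar>\<close>
  is an integrable majorant of the logarithmic singularity, by
  \<open>minus_ln_le_inverse_sqrt\<close>.\<close>

lemma nn_integral_inverse_sqrt: "(\<integral>\<^sup>+ x. ennreal (indicator {-1..1} x * (2 / sqrt \<bar>x\<bar>)) \<partial>lborel) = 8"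
proof -
  have 1: "((\<lambda>x. 2 / sqrt \<bar>x\<bar>) has_integral (4 * sqrt 1 - 4 * sqrt 0)) {0..1::real}"
    by (intro fundamental_theorem_of_calculus_interior)
      (auto intro!: derivative_eq_intros continuous_intros
        simp: has_real_derivative_iff_has_vector_derivative[symmetric] field_simps)
  have 2: "((\<lambda>x. 2 / sqrt \<bar>x\<bar>) has_integral (- 4 * sqrt (-0) - (- 4 * sqrt (- (-1))))) {-1..0::real}"
    by (intro fundamental_theorem_of_calculus_interior)
      (auto intro!: derivative_eq_intros continuous_intros
        simp: has_real_derivative_iff_has_vector_derivative[symmetric] field_simps)
  have "((\<lambda>x. 2 / sqrt \<bar>x\<bar>) has_integral 8) {-1..1::real}"
    using has_integral_combine[OF _ _ 2 1] by simp
  then have "((\<lambda>x. indicator {-1..1} x * (2 / sqrt \<bar>x\<bar>)) has_integral 8) (UNIV :: real set)"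
  proof -
    have "(\<lambda>x. indicator {-1..1} x * (2 / sqrt \<bar>x\<bar>)) = (\<lambda>x::real. if x \<in> {-1..1} then 2 / sqrt \<bar>x\<bar> else 0)"
      by (auto simp: indicator_def)
    then show ?thesis
      using \<open>(_ has_integral 8) {-1..1}\<close> by (simp only: has_integral_restrict_UNIV)
  qed
  then show ?thesis
    by (subst nn_integral_has_integral_lborel) auto
qed

lemma minus_ln_le_inverse_sqrt:
  assumes "0 < (x :: real)" shows "- ln x \<le> 2 / sqrt x"
proof -
  have "ln (1 / sqrt x) \<le> 1 / sqrt x - 1" using assms by (intro ln_le_minus_one) simp
  then show ?thesis using assms by (simp add: ln_div ln_sqrt)
qed

text \<open>Scaling: for \<open>\<bar>x - y\<bar> \<le> r\<close> the kernel splits into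
  \<open>- ln r\<close> and \<open>- ln (\<bar>x - y\<bar> / r)\<close>; farther away it is at most
  \<open>- ln r\<close>. The first part is integrated against a probability density. The second is
  bounded with \<open>tent r \<le> 1 / r\<close>, and after substituting \<open>(x - y) / r\<close>
  it costs at most 8, whatever c and y are.\<close>

lemma tent_potential_le:
  assumes r: "0 < r" "r \<le> 1"
  shows "(\<integral>\<^sup>+ x. ennreal (tent r (x - c)) * logker x y \<partial>lborel) \<le> ennreal (- ln r + 8)"
proof -
  define k where "k u = indicator {-1..1} u * (2 / sqrt \<bar>u\<bar>)" for u :: real
  have [measurable]: "k \<in> borel_measurable borel" unfolding k_def by measurable
  have k0: "0 \<le> k u" for u by (simp add: k_def)
  have le: "ennreal (tent r (x - c)) * logker x y \<le>
      ennreal (tent r (x - c)) * ennreal (- ln r) + ennreal (1 / r) * ennreal (k ((x - y) / r))"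
    if xy: "x \<noteq> y" for x
  proof -
    have "max 0 (- ln \<bar>x - y\<bar>) \<le> - ln r + k ((x - y) / r)"
    proof (cases "\<bar>x - y\<bar> \<le> r")
      case True
      have "- ln (\<bar>x - y\<bar> / r) \<le> 2 / sqrt (\<bar>x - y\<bar> / r)"
        using xy r by (intro minus_ln_le_inverse_sqrt) auto
      moreover have "k ((x - y) / r) = 2 / sqrt (\<bar>x - y\<bar> / r)"
        using True r by (auto simp: k_def indicator_def field_simps abs_if split: if_splits)
      moreover have "- ln r \<ge> 0" using r by simp
      moreover have "0 \<le> k ((x - y) / r)" by (rule k0)
      moreover have "- ln (\<bar>x - y\<bar> / r) = - ln \<bar>x - y\<bar> + ln r"
        using xy r by (simp add: ln_div)
      ultimately show ?thesis by linarith
    next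
      case False
      then have "ln r \<le> ln \<bar>x - y\<bar>" using r by (subst ln_le_cancel_iff) auto
      moreover have "- ln r \<ge> 0" using r by simp
      ultimately show ?thesis using k0[of "(x - y) / r"] by simp
    qed
    then have "tent r (x - c) * max 0 (- ln \<bar>x - y\<bar>) \<le> tent r (x - c) * (- ln r + k ((x - y) / r))"
      by (intro mult_left_mono tent_nonneg)
    also have "\<dots> \<le> tent r (x - c) * (- ln r) + 1 / r * k ((x - y) / r)"
      unfolding distrib_left by (intro add_left_mono mult_right_mono tent_le r k0)
    finally have "ennreal (tent r (x - c) * max 0 (- ln \<bar>x - y\<bar>)) \<le>
        ennreal (tent r (x - c) * (- ln r) + 1 / r * k ((x - y) / r))"
      by (rule ennreal_leI)
    also have "\<dots> = ennreal (tent r (x - c)) * ennreal (- ln r) + ennreal (1 / r) * ennreal (k ((x - y) / r))"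
    proof -
      have "0 \<le> - ln r" "0 \<le> 1 / r" using r by auto
      then show ?thesis
        by (simp only: ennreal_plus ennreal_mult mult_nonneg_nonneg tent_nonneg k0)
    qed
    also have "ennreal (tent r (x - c) * max 0 (- ln \<bar>x - y\<bar>)) = ennreal (tent r (x - c)) * logker x y"
      using xy by (simp only: logker_def if_False ennreal_mult tent_nonneg max.cobounded1)
    finally show ?thesis .
  qed
  have "(\<integral>\<^sup>+ x. ennreal (tent r (x - c)) * logker x y \<partial>lborel) \<le>
    (\<integral>\<^sup>+ x. ennreal (tent r (x - c)) * ennreal (- ln r) + ennreal (1 / r) * ennreal (k ((x - y) / r)) \<partial>lborel)"
    by (intro nn_integral_mono_AE eventually_mono[OF AE_lborel_singleton[of y]] le)
  also have "\<dots> = (\<integral>\<^sup>+ x. ennreal (tent r (x - c)) * ennreal (- ln r) \<partial>lborel)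
      + (\<integral>\<^sup>+ x. ennreal (1 / r) * ennreal (k ((x - y) / r)) \<partial>lborel)"
    by (intro nn_integral_add) measurable
  also have "(\<integral>\<^sup>+ x. ennreal (tent r (x - c)) * ennreal (- ln r) \<partial>lborel) = ennreal (- ln r)"
    by (subst nn_integral_multc) (auto simp: nn_integral_tent r)
  also have "(\<integral>\<^sup>+ x. ennreal (1 / r) * ennreal (k ((x - y) / r)) \<partial>lborel) = (\<integral>\<^sup>+ x. ennreal (k x) \<partial>lborel)"
    using r by (subst nn_integral_cmult, measurable)
      (subst nn_integral_real_affine[where c = r and t = y],
       auto simp: mult.assoc[symmetric] ennreal_mult[symmetric])
  also have "\<dots> = ennreal 8"
    using nn_integral_inverse_sqrt by (simp add: k_def)
  also have "ennreal (- ln r) + ennreal 8 = ennreal (- ln r + 8)"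
    using r by (subst ennreal_plus) auto
  finally show ?thesis .
qed

subsection \<open>Densities with respect to a weight\<close>

lemma ennreal_less_add_pos: "x < \<infinity> \<Longrightarrow> 0 < e \<Longrightarrow> x < x + ennreal e"
  by (cases x) (auto simp: ennreal_plus[symmetric] ennreal_less_iff simp del: ennreal_plus)

text \<open>Continuity is demanded on the whole line, so these functions vanish at 0 and 1 as well.
  The class is stable under multiplication by nonnegative continuous functions, the operation by
  which densities are refined.\<close>

definition bump01 :: "(real \<Rightarrow> real) set" where
  "bump01 = {g. continuous_on UNIV g \<and> (\<forall>x. 0 \<le> g x) \<and> (\<forall>x. x \<notin> {0..1} \<longrightarrow> g x = 0)}"

lemma bump01_measurable: "g \<in> bump01 \<Longrightarrow> g \<in> borel_measurable borel"
  by (auto simp: bump01_def intro: borel_measurable_continuous_onI)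

lemma bump01_mult:
  "g \<in> bump01 \<Longrightarrow> continuous_on UNIV h \<Longrightarrow> (\<And>x. 0 \<le> h x) \<Longrightarrow> (\<lambda>x. g x * h x) \<in> bump01"
  by (auto simp: bump01_def intro!: continuous_intros)

lemma bump01_bounded:
  assumes "g \<in> bump01"
  obtains B where "0 < B" "\<And>x. g x \<le> B"
proof -
  have g: "continuous_on {0..1} g" "\<And>x. 0 \<le> g x" "\<And>x. x \<notin> {0..1} \<Longrightarrow> g x = 0"
    using assms by (auto simp: bump01_def intro: continuous_on_subset)
  have "bounded (g ` {0..1})"
    by (intro compact_imp_bounded compact_continuous_image g(1)) simp
  then obtain B where B: "0 < B" "\<And>x. x \<in> {0..1} \<Longrightarrow> \<bar>g x\<bar> \<le> B"
    unfolding bounded_pos by auto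
  have "g x \<le> B" for x
    using B g(3)[of x] by (cases "x \<in> {0..1}") force+
  then show ?thesis using that B(1) by blast
qed

lemma bump01_finite_integral:
  assumes "g \<in> bump01"
  shows "(\<integral>\<^sup>+ x. ennreal (g x) \<partial>lborel) < \<infinity>"
proof -
  obtain B where B: "0 < B" "\<And>x. g x \<le> B" using bump01_bounded[OF assms] by blast
  have "(\<integral>\<^sup>+ x. ennreal (g x) \<partial>lborel) \<le> (\<integral>\<^sup>+ x. ennreal B * indicator {0..1::real} x \<partial>lborel)"
  proof (rule nn_integral_mono)
    fix x show "ennreal (g x) \<le> ennreal B * indicator {0..1} x"
      using B assms by (cases "x \<in> {0..1}") (auto simp: bump01_def intro!: ennreal_leI)
  qed
  also have "\<dots> = ennreal B"
    by (subst nn_integral_cmult) auto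
  finally show ?thesis by (simp add: le_less_trans[OF _ ennreal_less_top])
qed

text \<open>By definition \<open>measurable_on\<close> provides continuous functions converging off
  a negligible set; cutting them at 0 and B supplies the uniform bound for dominated
  convergence.\<close>

lemma borel_measurable_AE_limit_continuous:
  fixes h :: "real \<Rightarrow> real"
  assumes [measurable]: "h \<in> borel_measurable borel" and "\<And>x. 0 \<le> h x" "\<And>x. h x \<le> B"
  obtains u :: "nat \<Rightarrow> real \<Rightarrow> real" where "\<And>j. continuous_on UNIV (u j)" "\<And>j x. 0 \<le> u j x"
    "\<And>j x. u j x \<le> B" "AE x in lborel. (\<lambda>j. u j x) \<longlonglongrightarrow> h x"
proof -
  have B: "0 \<le> B" using assms(2,3) order_trans by blast
  have "h \<in> borel_measurable lebesgue" by (simp add: measurable_completion)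
  then have "h measurable_on UNIV"
    by (rule lebesgue_measurable_imp_measurable_on) simp
  then obtain N g where N: "negligible N" and g: "\<And>n :: nat. continuous_on UNIV (g n)"
      "\<And>x. x \<notin> N \<Longrightarrow> (\<lambda>n. g n x) \<longlonglongrightarrow> h x"
    unfolding measurable_on_def by auto
  have "AE x in lborel. (\<lambda>n. g n x) \<longlonglongrightarrow> h x"
    using N g(2) by (subst AE_completion_iff[symmetric], subst eventually_ae_filter_negligible) blast
  then have ae: "AE x in lborel. (\<lambda>n. max 0 (min B (g n x))) \<longlonglongrightarrow> h x"
  proof (rule eventually_mono)
    fix x assume "(\<lambda>n. g n x) \<longlonglongrightarrow> h x"
    then have "(\<lambda>n. max 0 (min B (g n x))) \<longlonglongrightarrow> max 0 (min B (h x))"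
      by (intro tendsto_intros)
    also have "max 0 (min B (h x)) = h x" using assms by (simp add: min_absorb2 max_absorb2)
    finally show "(\<lambda>n. max 0 (min B (g n x))) \<longlonglongrightarrow> h x" .
  qed
  show thesis
  proof (rule that[OF _ _ _ ae])
    show "continuous_on UNIV (\<lambda>x. max 0 (min B (g j x)))" for j
      by (intro continuous_intros g(1))
  qed (use B in auto)
qed

text \<open>The ideal factor is \<open>1 / w\<close>, since it turns \<open>\<Phi>\<close> back into
  Lebesgue measure. Truncation makes it bounded, and only then is it replaced by a continuous
  function. A factor multiplying p cannot enlarge the support.\<close>

lemma approx_density_by_multiple:
  fixes p w :: "real \<Rightarrow> real"
  defines "\<Phi> \<equiv> density lborel (\<lambda>x. ennreal (w x))"
  assumes wm[measurable]: "w \<in> borel_measurable borel" and w0: "\<And>x. 0 \<le> w x"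
    and w_pos: "AE x in lborel. x \<in> {0..1} \<longrightarrow> 0 < w x"
    and w_fin: "(\<integral>\<^sup>+ x. ennreal (w x) \<partial>lborel) < \<infinity>" and E_fin: "log_energy \<Phi> < \<infinity>"
    and p: "p \<in> bump01" and \<epsilon>: "0 < \<epsilon>"
  obtains \<psi> where "continuous_on UNIV \<psi>" "\<And>x. 0 \<le> \<psi> x"
    "(\<integral>\<^sup>+ x. ennreal (p x) \<partial>lborel) \<le> (\<integral>\<^sup>+ x. ennreal (p x * \<psi> x) \<partial>\<Phi>) + ennreal \<epsilon>"
    "log_energy (density \<Phi> (\<lambda>x. ennreal (p x * \<psi> x))) \<le> log_energy (density lborel (\<lambda>x. ennreal (p x))) + ennreal \<epsilon>"
proof -
  have [measurable]: "p \<in> borel_measurable borel" by (rule bump01_measurable[OF p])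
  have p0: "0 \<le> p x" for x using p by (auto simp: bump01_def)
  obtain B where B: "0 < B" "\<And>x. p x \<le> B" using bump01_bounded[OF p] by blast
  have sets: "sets \<Phi> = sets borel" by (simp add: \<Phi>_def)
  have fm: "finite_measure \<Phi>"
    using w_fin by (intro finite_measureI) (simp add: \<Phi>_def emeasure_density)
  then have sf: "sigma_finite_measure \<Phi>" by (simp add: finite_measure.axioms(1))
  have lsf: "sigma_finite_measure (lborel :: real measure)" by unfold_locales
  \<comment> \<open>Truncated reciprocal of w. Where w vanishes the value is irrelevant for
    \<open>\<Phi>\<close>, and on the unit interval this happens only on a null set.\<close>
  define h where "h n x = (if 0 < w x then min (real n) (1 / w x) else 0)" for n :: nat and x
  have [measurable]: "h n \<in> borel_measurable borel" for n unfolding h_def by measurable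
  have h0: "0 \<le> h n x" for n x by (simp add: h_def)
  have hn: "h n x \<le> real n" for n x by (simp add: h_def)
  have wh: "w x * h n x \<le> 1" for n x
    using mult_left_mono[of "min (real n) (1 / w x)" "1 / w x" "w x"] by (auto simp: h_def)
  have ennw: "ennreal (w x) * ennreal (p x * h n x) = ennreal (w x * h n x * p x)" for n x
    using w0[of x] p0[of x] h0[of n x] by (simp add: ennreal_mult[symmetric] ac_simps)
  have int\<Phi>: "(\<integral>\<^sup>+ x. ennreal (p x * h n x) \<partial>\<Phi>) = (\<integral>\<^sup>+ x. ennreal (w x * h n x * p x) \<partial>lborel)" for n
    unfolding \<Phi>_def by (subst nn_integral_density) (auto simp: ennw)
  have le_p: "ennreal (w x * h n x * p x) \<le> ennreal (p x)" for n x
    using wh[of x n] p0[of x] by (intro ennreal_leI) (simp add: mult_left_le_one_le w0 h0)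
  have "(\<lambda>n. \<integral>\<^sup>+ x. ennreal (w x * h n x * p x) \<partial>lborel) \<longlonglongrightarrow> (\<integral>\<^sup>+ x. ennreal (p x) \<partial>lborel)"
  proof (rule nn_integral_dominated_convergence[where w = "\<lambda>x. ennreal (p x)"])
    show "(\<integral>\<^sup>+ x. ennreal (p x) \<partial>lborel) < \<infinity>" by (rule bump01_finite_integral[OF p])
    show "AE x in lborel. (\<lambda>n. ennreal (w x * h n x * p x)) \<longlonglongrightarrow> ennreal (p x)"
      using w_pos
    proof eventually_elim
      case (elim x)
      have "\<forall>\<^sub>F n in sequentially. w x * h n x * p x = p x"
      proof (cases "x \<in> {0..1}")
        case True
        with elim have w: "0 < w x" by simp
        obtain m :: nat where m: "1 / w x \<le> real m" using real_arch_simple by blast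
        have "w x * h n x * p x = p x" if "n \<ge> m" for n
        proof -
          have "min (real n) (1 / w x) = 1 / w x" using m that by (simp add: min_def)
          then show ?thesis using w by (simp add: h_def)
        qed
        then show ?thesis unfolding eventually_sequentially by blast
      next
        case False
        then show ?thesis using p by (simp add: bump01_def)
      qed
      then have "\<forall>\<^sub>F n in sequentially. ennreal (w x * h n x * p x) = ennreal (p x)"
        by (rule eventually_mono) (simp only:)
      then show ?case by (rule tendsto_eventually)
    qed
  qed (use le_p in auto)
  from tendsto_add[OF this tendsto_const[of "ennreal (\<epsilon>/2)"]]
  have "\<forall>\<^sub>F n in sequentially. (\<integral>\<^sup>+ x. ennreal (p x) \<partial>lborel) <
      (\<integral>\<^sup>+ x. ennreal (w x * h n x * p x) \<partial>lborel) + ennreal (\<epsilon>/2)"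
    using \<epsilon> by (elim order_tendstoD(1)) (intro ennreal_less_add_pos bump01_finite_integral[OF p], simp)
  then obtain n where n: "(\<integral>\<^sup>+ x. ennreal (p x) \<partial>lborel) <
      (\<integral>\<^sup>+ x. ennreal (w x * h n x * p x) \<partial>lborel) + ennreal (\<epsilon>/2)"
    by (auto dest!: eventually_happens)
  obtain u where u: "\<And>j. continuous_on UNIV (u j)" "\<And>j x. 0 \<le> u j x"
    "\<And>j x. u j x \<le> real n" "AE x in lborel. (\<lambda>j. u j x) \<longlonglongrightarrow> h n x"
    using borel_measurable_AE_limit_continuous[of "h n" "real n"] h0 hn by auto
  have [measurable]: "u j \<in> borel_measurable borel" for j
    by (intro borel_measurable_continuous_onI u(1))
  have bd: "p x * u j x \<le> B * real n" for j x
    using B p0 u by (intro mult_mono) (auto intro: less_imp_le)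
  have ae\<Phi>: "AE x in \<Phi>. (\<lambda>j. p x * u j x) \<longlonglongrightarrow> p x * h n x"
    unfolding \<Phi>_def using u(4) by (subst AE_density) (auto elim!: eventually_mono intro: tendsto_intros)
  \<comment> \<open>Here the finite energy of \<open>\<Phi>\<close> enters:
    \<open>B * real n\<close> bounds all the densities \<open>p x * u j x\<close>.\<close>
  have 1: "(\<lambda>j. log_energy (density \<Phi> (\<lambda>x. ennreal (p x * u j x)))) \<longlonglongrightarrow>
      log_energy (density \<Phi> (\<lambda>x. ennreal (p x * h n x)))"
    using ae\<Phi> bd by (intro log_energy_density_tendsto[OF sets sf E_fin, where B = "B * real n"]) auto
  have [measurable_cong]: "sets \<Phi> = sets borel" by (rule sets)
  have em: "emeasure \<Phi> UNIV < \<infinity>"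
    using finite_measure.emeasure_finite[OF fm] by (simp add: less_top)
  have 2: "(\<lambda>j. \<integral>\<^sup>+ x. ennreal (p x * u j x) \<partial>\<Phi>) \<longlonglongrightarrow> (\<integral>\<^sup>+ x. ennreal (p x * h n x) \<partial>\<Phi>)"
  proof (rule nn_integral_dominated_convergence[where w = "\<lambda>x. ennreal (B * real n)"])
    show "AE x in \<Phi>. (\<lambda>j. ennreal (p x * u j x)) \<longlonglongrightarrow> ennreal (p x * h n x)"
      using ae\<Phi> by (rule eventually_mono) (rule tendsto_ennrealI)
    show "(\<integral>\<^sup>+ x. ennreal (B * real n) \<partial>\<Phi>) < \<infinity>"
      using em sets_eq_imp_space_eq[OF sets] by (simp add: ennreal_mult_less_top)
  qed (use bd in \<open>auto intro!: AE_I2 ennreal_leI\<close>)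
  have dd: "density \<Phi> (\<lambda>x. ennreal (p x * h n x)) = density lborel (\<lambda>x. ennreal (w x * h n x * p x))"
    unfolding \<Phi>_def by (subst density_density_eq) (auto simp: ennw)
  \<comment> \<open>Truncating the reciprocal needs no limit of energies:
    \<open>w x * h n x \<le> 1\<close> makes the new density pointwise smaller than p.\<close>
  have E_le: "log_energy (density \<Phi> (\<lambda>x. ennreal (p x * h n x))) \<le> log_energy (density lborel (\<lambda>x. ennreal (p x)))"
    unfolding dd by (intro log_energy_density_mono lsf AE_I2 le_p) auto
  have E_fin2: "log_energy (density \<Phi> (\<lambda>x. ennreal (p x * h n x))) < \<infinity>"
  proof -
    have "log_energy (density \<Phi> (\<lambda>x. ennreal (p x * h n x))) \<le> log_energy (density \<Phi> (\<lambda>x. ennreal (B * real n) * 1))"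
      using B p0 h0 hn by (intro log_energy_density_mono sets sf AE_I2) (auto intro!: ennreal_leI mult_mono intro: less_imp_le)
    also have "\<dots> = ennreal (B * real n)^2 * log_energy (density \<Phi> (\<lambda>x. 1))"
      by (intro log_energy_density_const sets sf) auto
    also have "\<dots> < \<infinity>" using E_fin by (simp add: density_1 ennreal_mult_less_top power_less_top_ennreal)
    finally show ?thesis .
  qed
  have I_fin: "(\<integral>\<^sup>+ x. ennreal (p x * h n x) \<partial>\<Phi>) < \<infinity>"
    unfolding int\<Phi> using bump01_finite_integral[OF p]
    by (rule le_less_trans[rotated]) (intro nn_integral_mono le_p)
  have "\<forall>\<^sub>F j in sequentially. log_energy (density \<Phi> (\<lambda>x. ennreal (p x * u j x))) <
      log_energy (density \<Phi> (\<lambda>x. ennreal (p x * h n x))) + ennreal \<epsilon>"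
    by (intro order_tendstoD(2)[OF 1] ennreal_less_add_pos E_fin2 \<epsilon>)
  moreover have "\<forall>\<^sub>F j in sequentially. (\<integral>\<^sup>+ x. ennreal (p x * h n x) \<partial>\<Phi>) <
      (\<integral>\<^sup>+ x. ennreal (p x * u j x) \<partial>\<Phi>) + ennreal (\<epsilon>/2)"
    using \<epsilon> by (intro order_tendstoD(1)[OF tendsto_add[OF 2 tendsto_const]] ennreal_less_add_pos I_fin) simp
  ultimately have "\<forall>\<^sub>F j in sequentially. log_energy (density \<Phi> (\<lambda>x. ennreal (p x * u j x))) <
      log_energy (density \<Phi> (\<lambda>x. ennreal (p x * h n x))) + ennreal \<epsilon> \<and> (\<integral>\<^sup>+ x. ennreal (p x * h n x) \<partial>\<Phi>) <
      (\<integral>\<^sup>+ x. ennreal (p x * u j x) \<partial>\<Phi>) + ennreal (\<epsilon>/2)"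
    by (rule eventually_conj)
  then obtain j where j: "log_energy (density \<Phi> (\<lambda>x. ennreal (p x * u j x))) <
      log_energy (density \<Phi> (\<lambda>x. ennreal (p x * h n x))) + ennreal \<epsilon>" "(\<integral>\<^sup>+ x. ennreal (p x * h n x) \<partial>\<Phi>) <
      (\<integral>\<^sup>+ x. ennreal (p x * u j x) \<partial>\<Phi>) + ennreal (\<epsilon>/2)"
    by (auto dest!: eventually_happens)
  show thesis
  proof (rule that[OF u(1)[of j] u(2)[of j]])
    have "(\<integral>\<^sup>+ x. ennreal (p x) \<partial>lborel) \<le> (\<integral>\<^sup>+ x. ennreal (p x * h n x) \<partial>\<Phi>) + ennreal (\<epsilon>/2)"
      unfolding int\<Phi> by (rule less_imp_le[OF n])
    also have "\<dots> \<le> (\<integral>\<^sup>+ x. ennreal (p x * u j x) \<partial>\<Phi>) + ennreal (\<epsilon>/2) + ennreal (\<epsilon>/2)"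
      by (intro add_right_mono less_imp_le j(2))
    also have "\<dots> = (\<integral>\<^sup>+ x. ennreal (p x * u j x) \<partial>\<Phi>) + ennreal \<epsilon>"
      using \<epsilon> by (simp add: add.assoc ennreal_plus[symmetric] del: ennreal_plus)
    finally show "(\<integral>\<^sup>+ x. ennreal (p x) \<partial>lborel) \<le> (\<integral>\<^sup>+ x. ennreal (p x * u j x) \<partial>\<Phi>) + ennreal \<epsilon>" .
    show "log_energy (density \<Phi> (\<lambda>x. ennreal (p x * u j x))) \<le> log_energy (density lborel (\<lambda>x. ennreal (p x))) + ennreal \<epsilon>"
      by (rule order_trans[OF less_imp_le[OF j(1)] add_right_mono[OF E_le]])
  qed
qed

subsection \<open>Approximation of measures by densities\<close>

lemma tent_lipschitz:
  assumes "0 < r" shows "\<bar>tent r x - tent r y\<bar> \<le> \<bar>x - y\<bar> / r^2"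
proof -
  have "\<bar>max 0 (r - \<bar>x\<bar>) - max 0 (r - \<bar>y\<bar>)\<bar> \<le> \<bar>x - y\<bar>" by linarith
  then have "\<bar>max 0 (r - \<bar>x\<bar>) - max 0 (r - \<bar>y\<bar>)\<bar> / r^2 \<le> \<bar>x - y\<bar> / r^2"
    by (intro divide_right_mono) auto
  then show ?thesis unfolding tent_def by (simp add: diff_divide_distrib[symmetric])
qed

lemma logker_le:
  assumes "0 < d" "d \<le> \<bar>x - y\<bar>"
  shows "logker x y \<le> ennreal (max 0 (- ln d))"
  using assms by (auto simp: logker_def intro!: ennreal_leI max.mono)

text \<open>Averaging a measure over the contracted, tent-shaped bumps keeps the support in \<open>[0, 1]\<close>,
  unlike an ordinary convolution.\<close>

lemma bump01_average:
  fixes \<mu> :: "real measure"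
  assumes sets: "sets \<mu> = sets borel" and "prob_space \<mu>" and supp: "AE x in \<mu>. x \<in> {0..1}"
    and r: "0 < r" "r \<le> 1/4"
  defines "T \<equiv> \<lambda>x s. tent r (s - (r + (1 - 2 * r) * x))"
  defines "p \<equiv> \<lambda>s. \<integral>x. T x s \<partial>\<mu>"
  shows "p \<in> bump01" (is ?A)
    and "(\<integral>\<^sup>+ s. ennreal (p s) \<partial>lborel) = 1" (is ?B)
    and "log_energy (density lborel (\<lambda>s. ennreal (p s))) =
      (\<integral>\<^sup>+ y. (\<integral>\<^sup>+ x. (\<integral>\<^sup>+ t. ennreal (T y t) * (\<integral>\<^sup>+ s. ennreal (T x s) * logker s t \<partial>lborel) \<partial>lborel) \<partial>\<mu>) \<partial>\<mu>)" (is ?C)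
proof -
  interpret \<mu>: prob_space \<mu> by fact
  interpret pair_sigma_finite lborel \<mu> by unfold_locales
  have [measurable_cong]: "sets \<mu> = sets borel" by (rule sets)
  have T0: "0 \<le> T x s" "T x s \<le> 1 / r" for x s by (auto simp: T_def tent_nonneg tent_le r)
  have Tm[measurable]: "(\<lambda>x. T (f x) (g x)) \<in> borel_measurable M"
    if [measurable]: "f \<in> borel_measurable M" "g \<in> borel_measurable M" for f g and M :: "'b measure"
    unfolding T_def by measurable
  have int: "integrable \<mu> (\<lambda>x. T x s)" for s
    by (rule \<mu>.integrable_const_bound[where B = "1/r"]) (auto simp: T0)
  have p_nn: "ennreal (p s) = (\<integral>\<^sup>+ x. ennreal (T x s) \<partial>\<mu>)" for s
    unfolding p_def by (subst nn_integral_eq_integral[OF int]) (auto simp: T0)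
  have p0: "0 \<le> p s" for s by (simp add: p_def T0)
  have lip: "\<bar>p s - p s'\<bar> \<le> \<bar>s - s'\<bar> / r^2" for s s'
  proof -
    have "\<bar>p s - p s'\<bar> = \<bar>\<integral>x. T x s - T x s' \<partial>\<mu>\<bar>"
      unfolding p_def by (simp add: int)
    also have "\<dots> \<le> (\<integral>x. \<bar>T x s - T x s'\<bar> \<partial>\<mu>)" by (rule integral_abs_bound)
    also have "\<dots> \<le> (\<integral>x. \<bar>s - s'\<bar> / r^2 \<partial>\<mu>)"
    proof (intro integral_mono integrable_abs Bochner_Integration.integrable_diff int)
      show "\<bar>T x s - T x s'\<bar> \<le> \<bar>s - s'\<bar> / r^2" for x
        unfolding T_def using tent_lipschitz[OF r(1), of "s - (r + (1 - 2 * r) * x)" "s' - (r + (1 - 2 * r) * x)"]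
        by simp
    qed auto
    also have "\<dots> = \<bar>s - s'\<bar> / r^2" by (simp add: \<mu>.prob_space)
    finally show ?thesis .
  qed
  have cont: "continuous_on UNIV p"
    unfolding continuous_on_iff
  proof (intro ballI allI impI)
    fix s e :: real assume e: "0 < e"
    have "dist (p s') (p s) < e" if "dist s' s < e * r^2" for s'
    proof -
      have "\<bar>s' - s\<bar> / r^2 < e" using that r by (simp add: dist_real_def field_simps)
      then show ?thesis using lip[of s' s] by (simp add: dist_real_def)
    qed
    then show "\<exists>d>0. \<forall>s'\<in>UNIV. dist s' s < d \<longrightarrow> dist (p s') (p s) < e"
      using e r by (intro exI[of _ "e * r^2"]) auto
  qed
  have "p s = 0" if s: "s \<notin> {0..1}" for s
  proof -
    have "p s = (\<integral>x. 0 \<partial>\<mu>)"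
      unfolding p_def
    proof (rule integral_cong_AE)
      show "AE x in \<mu>. T x s = 0"
        using supp
      proof (rule eventually_mono)
        fix x :: real assume x: "x \<in> {0..1}"
        \<comment> \<open>So the centre \<open>r + (1 - 2 * r) * x\<close> is at distance at least r
          from both endpoints.\<close>
        have "0 \<le> (1 - 2 * r) * x" "(1 - 2 * r) * x \<le> 1 - 2 * r"
          using x r mult_left_le[of x "1 - 2 * r"] by auto
        then show "T x s = 0"
          unfolding T_def using s by (intro tent_eq_0) auto
      qed
    qed auto
    then show ?thesis by simp
  qed
  then show ?A using cont p0 by (simp add: bump01_def)
  then have [measurable]: "p \<in> borel_measurable borel" by (rule bump01_measurable)
  \<comment> \<open>Fubini in one variable with an arbitrary factor f. Used once for s and once for
    t, it expresses the energy of p through pairs of bumps.\<close>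
  have key: "(\<integral>\<^sup>+ s. ennreal (p s) * f s \<partial>lborel) = (\<integral>\<^sup>+ x. (\<integral>\<^sup>+ s. ennreal (T x s) * f s \<partial>lborel) \<partial>\<mu>)"
    if [measurable]: "f \<in> borel_measurable borel" for f :: "real \<Rightarrow> ennreal"
  proof -
    have "(\<integral>\<^sup>+ s. ennreal (p s) * f s \<partial>lborel) = (\<integral>\<^sup>+ s. (\<integral>\<^sup>+ x. ennreal (T x s) * f s \<partial>\<mu>) \<partial>lborel)"
      unfolding p_nn by (intro nn_integral_cong nn_integral_multc[symmetric]) measurable
    also have "\<dots> = (\<integral>\<^sup>+ x. (\<integral>\<^sup>+ s. ennreal (T x s) * f s \<partial>lborel) \<partial>\<mu>)"
      by (rule Fubini'[symmetric]) measurable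
    finally show ?thesis .
  qed
  show ?B
    using key[of "\<lambda>_. 1"] by (simp add: T_def nn_integral_tent r \<mu>.emeasure_space_1)
  have V[measurable]: "(\<lambda>z. \<integral>\<^sup>+ s. ennreal (T (f z) s) * logker s (g z) \<partial>lborel) \<in> borel_measurable M"
    if [measurable]: "f \<in> borel_measurable M" "g \<in> borel_measurable M" for f g and M :: "'b measure"
    by measurable
  have "log_energy (density lborel (\<lambda>s. ennreal (p s))) =
      (\<integral>\<^sup>+ t. ennreal (p t) * (\<integral>\<^sup>+ s. ennreal (p s) * logker s t \<partial>lborel) \<partial>lborel)"
    by (intro log_energy_density lborel.sigma_finite_measure_axioms) auto
  also have "\<dots> = (\<integral>\<^sup>+ t. ennreal (p t) * (\<integral>\<^sup>+ x. (\<integral>\<^sup>+ s. ennreal (T x s) * logker s t \<partial>lborel) \<partial>\<mu>) \<partial>lborel)"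
    by (intro nn_integral_cong arg_cong2[where f = "(*)"] refl key) measurable
  also have "\<dots> = (\<integral>\<^sup>+ y. (\<integral>\<^sup>+ t. ennreal (T y t) * (\<integral>\<^sup>+ x. (\<integral>\<^sup>+ s. ennreal (T x s) * logker s t \<partial>lborel) \<partial>\<mu>) \<partial>lborel) \<partial>\<mu>)"
    by (rule key) measurable
  also have "\<dots> = (\<integral>\<^sup>+ y. (\<integral>\<^sup>+ t. (\<integral>\<^sup>+ x. ennreal (T y t) * (\<integral>\<^sup>+ s. ennreal (T x s) * logker s t \<partial>lborel) \<partial>\<mu>) \<partial>lborel) \<partial>\<mu>)"
    by (intro nn_integral_cong nn_integral_cmult[symmetric]) measurable
  also have "\<dots> = (\<integral>\<^sup>+ y. (\<integral>\<^sup>+ x. (\<integral>\<^sup>+ t. ennreal (T y t) * (\<integral>\<^sup>+ s. ennreal (T x s) * logker s t \<partial>lborel) \<partial>lborel) \<partial>\<mu>) \<partial>\<mu>)"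
    by (intro nn_integral_cong Fubini'[symmetric]) measurable
  finally show ?C .
qed

lemma tent_average_le_const:
  assumes r: "0 < r" "0 < r'"
    and le: "\<And>s t. \<bar>s - a\<bar> < r \<Longrightarrow> \<bar>t - b\<bar> < r' \<Longrightarrow> h s t \<le> C"
  shows "(\<integral>\<^sup>+ t. ennreal (tent r' (t - b)) * (\<integral>\<^sup>+ s. ennreal (tent r (s - a)) * h s t \<partial>lborel) \<partial>lborel) \<le> C"
proof -
  have "(\<integral>\<^sup>+ t. ennreal (tent r' (t - b)) * (\<integral>\<^sup>+ s. ennreal (tent r (s - a)) * h s t \<partial>lborel) \<partial>lborel)
      \<le> (\<integral>\<^sup>+ t. ennreal (tent r' (t - b)) * (\<integral>\<^sup>+ s. ennreal (tent r (s - a)) * C \<partial>lborel) \<partial>lborel)"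
  proof (rule nn_integral_mono)
    fix t
    show "ennreal (tent r' (t - b)) * (\<integral>\<^sup>+ s. ennreal (tent r (s - a)) * h s t \<partial>lborel)
      \<le> ennreal (tent r' (t - b)) * (\<integral>\<^sup>+ s. ennreal (tent r (s - a)) * C \<partial>lborel)"
    proof (cases "\<bar>t - b\<bar> < r'")
      case True
      have "ennreal (tent r (s - a)) * h s t \<le> ennreal (tent r (s - a)) * C" for s
      proof (cases "\<bar>s - a\<bar> < r")
        case s: True
        show ?thesis by (intro mult_left_mono le s True) auto
      qed (simp add: tent_eq_0)
      then have "(\<integral>\<^sup>+ s. ennreal (tent r (s - a)) * h s t \<partial>lborel) \<le> (\<integral>\<^sup>+ s. ennreal (tent r (s - a)) * C \<partial>lborel)"
        by (rule nn_integral_mono)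
      then show ?thesis by (rule mult_left_mono) simp
    qed (simp add: tent_eq_0)
  qed
  also have "\<dots> = C"
    by (simp add: nn_integral_multc nn_integral_tent r)
  finally show ?thesis .
qed

lemma tent_average_le:
  assumes r: "0 < r" "r \<le> 1" "0 < r'"
  shows "(\<integral>\<^sup>+ t. ennreal (tent r' (t - b)) * (\<integral>\<^sup>+ s. ennreal (tent r (s - a)) * logker s t \<partial>lborel) \<partial>lborel)
    \<le> ennreal (- ln r + 8)"
proof -
  have "(\<integral>\<^sup>+ t. ennreal (tent r' (t - b)) * (\<integral>\<^sup>+ s. ennreal (tent r (s - a)) * logker s t \<partial>lborel) \<partial>lborel)
    \<le> (\<integral>\<^sup>+ t. ennreal (tent r' (t - b)) * ennreal (- ln r + 8) \<partial>lborel)"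
    by (intro nn_integral_mono mult_left_mono tent_potential_le r) auto
  also have "\<dots> = ennreal (- ln r + 8)"
    by (simp add: nn_integral_multc nn_integral_tent r)
  finally show ?thesis .
qed

text \<open>Bound for the mutual energy of the contracted bumps belonging to x and y. Their centres
  are \<open>(1 - 2 * r) * \<bar>x - y\<bar>\<close> apart and the supports reduce this by at most
  \<open>2 * r\<close>. The threshold \<open>4 * r\<close> ensures that at least half of the
  distance survives; below it only the potential bound for tents is available.\<close>

definition avg_bound :: "real \<Rightarrow> real \<Rightarrow> real \<Rightarrow> real" where
  "avg_bound r x y = (if 4 * r \<le> (1 - 2 * r) * \<bar>x - y\<bar>
     then max 0 (- ln ((1 - 2 * r) * \<bar>x - y\<bar> - 2 * r)) else - ln r + 8)"

lemma avg_bound_measurable [measurable]: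
  assumes [measurable]: "f \<in> borel_measurable M" "g \<in> borel_measurable M"
  shows "(\<lambda>z. avg_bound r (f z) (g z)) \<in> borel_measurable M"
  unfolding avg_bound_def by measurable

text \<open>Majorant independent of r. Since \<open>1 - 2 * r \<ge> 1/2\<close>, failing the
  threshold \<open>4 * r\<close> means \<open>\<bar>x - y\<bar> < 8 * r\<close>, whence
  \<open>ln 8\<close>; above the threshold the remaining distance is also at least
  \<open>\<bar>x - y\<bar> / 8\<close>. The other 8 comes from
  \<open>tent_average_le\<close>.\<close>

lemma avg_bound_le:
  assumes r: "0 < r" "r \<le> 1/4"
  shows "ennreal (avg_bound r x y) \<le> logker x y + ennreal (ln 8 + 8)"
proof (cases "x = y")
  case False
  have "avg_bound r x y \<le> max 0 (- ln \<bar>x - y\<bar>) + (ln 8 + 8)"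
  proof (cases "4 * r \<le> (1 - 2 * r) * \<bar>x - y\<bar>")
    case True
    have "1/2 * \<bar>x - y\<bar> \<le> (1 - 2 * r) * \<bar>x - y\<bar>" using r by (intro mult_right_mono) auto
    then have 1: "\<bar>x - y\<bar> / 8 \<le> (1 - 2 * r) * \<bar>x - y\<bar> - 2 * r"
    proof -
      have "D / 8 \<le> A - 2 * r" if "1/2 * D \<le> A" "4 * r \<le> A" "0 \<le> D" for A D :: real
        using that by linarith
      then show ?thesis using \<open>1/2 * _ \<le> _\<close> True abs_ge_zero by blast
    qed
    have "ln (\<bar>x - y\<bar> / 8) \<le> ln ((1 - 2 * r) * \<bar>x - y\<bar> - 2 * r)"
      using 1 False by (subst ln_le_cancel_iff) auto
    moreover have "ln (\<bar>x - y\<bar> / 8) = ln \<bar>x - y\<bar> - ln 8" using False by (simp add: ln_div)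
    moreover have "0 \<le> ln (8::real)" by simp
    ultimately show ?thesis unfolding avg_bound_def using True by auto
  next
    case F: False
    have "1/2 * \<bar>x - y\<bar> \<le> (1 - 2 * r) * \<bar>x - y\<bar>" using r by (intro mult_right_mono) auto
    then have 1: "\<bar>x - y\<bar> / 8 \<le> r"
    proof -
      have "D / 8 \<le> r" if "1/2 * D \<le> A" "\<not> 4 * r \<le> A" for A D :: real
        using that by linarith
      then show ?thesis using \<open>1/2 * _ \<le> _\<close> F by blast
    qed
    have "ln (\<bar>x - y\<bar> / 8) \<le> ln r" using 1 False r by (subst ln_le_cancel_iff) auto
    moreover have "ln (\<bar>x - y\<bar> / 8) = ln \<bar>x - y\<bar> - ln 8" using False by (simp add: ln_div)
    ultimately show ?thesis unfolding avg_bound_def using F by auto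
  qed
  then have "ennreal (avg_bound r x y) \<le> ennreal (max 0 (- ln \<bar>x - y\<bar>) + (ln 8 + 8))"
    by (rule ennreal_leI)
  also have "\<dots> = ennreal (max 0 (- ln \<bar>x - y\<bar>)) + ennreal (ln 8 + 8)"
    by (intro ennreal_plus) auto
  finally show ?thesis using False by (simp only: logker_def if_False)
qed (simp add: logker_def)

lemma avg_bound_tendsto:
  assumes "x \<noteq> y" and r: "r \<longlonglongrightarrow> 0"
  shows "(\<lambda>n. ennreal (avg_bound (r n) x y)) \<longlonglongrightarrow> logker x y"
proof -
  have l: "(\<lambda>n. (1 - 2 * r n) * \<bar>x - y\<bar> - 2 * r n) \<longlonglongrightarrow> (1 - 2 * 0) * \<bar>x - y\<bar> - 2 * 0"
    by (intro tendsto_intros r)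
  have "(\<lambda>n. (1 - 2 * r n) * \<bar>x - y\<bar> - 4 * r n) \<longlonglongrightarrow> (1 - 2 * 0) * \<bar>x - y\<bar> - 4 * 0"
    by (intro tendsto_intros r)
  then have "\<forall>\<^sub>F n in sequentially. 0 < (1 - 2 * r n) * \<bar>x - y\<bar> - 4 * r n"
    using assms(1) by (elim order_tendstoD(1)) simp
  then have ev: "\<forall>\<^sub>F n in sequentially. ennreal (avg_bound (r n) x y) =
      ennreal (max 0 (- ln ((1 - 2 * r n) * \<bar>x - y\<bar> - 2 * r n)))"
    by (rule eventually_mono) (simp add: avg_bound_def)
  have "(\<lambda>n. ennreal (max 0 (- ln ((1 - 2 * r n) * \<bar>x - y\<bar> - 2 * r n)))) \<longlonglongrightarrow>
      ennreal (max 0 (- ln ((1 - 2 * 0) * \<bar>x - y\<bar> - 2 * 0)))"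
    using assms(1) by (intro tendsto_ennrealI tendsto_max tendsto_const tendsto_minus tendsto_ln l) auto
  also have "ennreal (max 0 (- ln ((1 - 2 * 0) * \<bar>x - y\<bar> - 2 * 0))) = logker x y"
    using assms(1) by (simp add: logker_def)
  finally show ?thesis using ev by (simp only: tendsto_cong[OF ev])
qed

text \<open>The averaged measures have energies below the integrals \<open>H n\<close> of
  \<open>avg_bound\<close> over the product measure, and these converge to the energy of
  \<open>\<mu>\<close> by dominated convergence as the bump width tends to 0.\<close>

lemma approx_measure_by_density:
  fixes \<mu> :: "real measure"
  assumes sets: "sets \<mu> = sets borel" and "prob_space \<mu>" and supp: "AE x in \<mu>. x \<in> {0..1}"
    and fin: "log_energy \<mu> < \<infinity>" and \<epsilon>: "0 < \<epsilon>"
  obtains p where "p \<in> bump01" "(\<integral>\<^sup>+ s. ennreal (p s) \<partial>lborel) = 1"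
    "log_energy (density lborel (\<lambda>s. ennreal (p s))) \<le> log_energy \<mu> + ennreal \<epsilon>"
proof -
  interpret \<mu>: prob_space \<mu> by fact
  have [measurable_cong]: "sets \<mu> = sets borel" by (rule sets)
  define r :: "nat \<Rightarrow> real" where "r n = 1 / real (n + 4)" for n
  have r: "0 < r n" "r n \<le> 1/4" for n by (auto simp: r_def field_simps)
  have r_lim: "r \<longlonglongrightarrow> 0"
    unfolding r_def[abs_def] by (rule LIMSEQ_ignore_initial_segment[OF lim_1_over_n])
  define H where "H n = (\<integral>\<^sup>+ z. ennreal (avg_bound (r n) (snd z) (fst z)) \<partial>(\<mu> \<Otimes>\<^sub>M \<mu>))" for n
  have E: "(\<integral>\<^sup>+ z. logker (snd z) (fst z) \<partial>(\<mu> \<Otimes>\<^sub>M \<mu>)) = log_energy \<mu>"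
    unfolding log_energy_def by (subst \<mu>.nn_integral_fst[symmetric]) auto
  have pp: "prob_space (\<mu> \<Otimes>\<^sub>M \<mu>)" by (intro prob_space_pair \<mu>.prob_space_axioms)
  have "H \<longlonglongrightarrow> (\<integral>\<^sup>+ z. logker (snd z) (fst z) \<partial>(\<mu> \<Otimes>\<^sub>M \<mu>))"
    unfolding H_def[abs_def]
  proof (rule nn_integral_dominated_convergence[where w = "\<lambda>z. logker (snd z) (fst z) + ennreal (ln 8 + 8)"])
    show "AE z in \<mu> \<Otimes>\<^sub>M \<mu>. ennreal (avg_bound (r j) (snd z) (fst z)) \<le> logker (snd z) (fst z) + ennreal (ln 8 + 8)" for j
      by (intro AE_I2 avg_bound_le r)
    have "(\<integral>\<^sup>+ z. logker (snd z) (fst z) + ennreal (ln 8 + 8) \<partial>(\<mu> \<Otimes>\<^sub>M \<mu>)) = log_energy \<mu> + ennreal (ln 8 + 8)"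
      by (subst nn_integral_add) (auto simp: E prob_space.emeasure_space_1[OF pp])
    then show "(\<integral>\<^sup>+ z. logker (snd z) (fst z) + ennreal (ln 8 + 8) \<partial>(\<mu> \<Otimes>\<^sub>M \<mu>)) < \<infinity>"
      using fin by simp
    \<comment> \<open>Pointwise convergence holds off the diagonal. The diagonal is null because the
      kernel is infinite there and has finite integral.\<close>
    have "AE z in \<mu> \<Otimes>\<^sub>M \<mu>. logker (snd z) (fst z) \<noteq> \<infinity>"
      using fin by (intro nn_integral_PInf_AE) (auto simp: E)
    then show "AE z in \<mu> \<Otimes>\<^sub>M \<mu>. (\<lambda>n. ennreal (avg_bound (r n) (snd z) (fst z))) \<longlonglongrightarrow> logker (snd z) (fst z)"
      by (rule eventually_mono) (rule avg_bound_tendsto[OF _ r_lim], auto simp: logker_def)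
  qed measurable
  then have "\<forall>\<^sub>F n in sequentially. H n < log_energy \<mu> + ennreal \<epsilon>"
    unfolding E by (rule order_tendstoD(2)) (intro ennreal_less_add_pos fin \<epsilon>)
  then obtain n where n: "H n < log_energy \<mu> + ennreal \<epsilon>"
    by (auto dest!: eventually_happens)
  define T where "T x s = tent (r n) (s - (r n + (1 - 2 * r n) * x))" for x s
  define p where "p s = (\<integral>x. T x s \<partial>\<mu>)" for s
  note avg = bump01_average[OF assms(1-3) r[of n], folded T_def, folded p_def]
  have "log_energy (density lborel (\<lambda>s. ennreal (p s))) =
      (\<integral>\<^sup>+ y. (\<integral>\<^sup>+ x. (\<integral>\<^sup>+ t. ennreal (T y t) * (\<integral>\<^sup>+ s. ennreal (T x s) * logker s t \<partial>lborel) \<partial>lborel) \<partial>\<mu>) \<partial>\<mu>)"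
    by (rule avg(3))
  also have "\<dots> \<le> (\<integral>\<^sup>+ y. (\<integral>\<^sup>+ x. ennreal (avg_bound (r n) x y) \<partial>\<mu>) \<partial>\<mu>)"
  proof (intro nn_integral_mono)
    fix x y :: real
    have rn: "0 < r n" "r n \<le> 1" using r[of n] by auto
    show "(\<integral>\<^sup>+ t. ennreal (T y t) * (\<integral>\<^sup>+ s. ennreal (T x s) * logker s t \<partial>lborel) \<partial>lborel)
        \<le> ennreal (avg_bound (r n) x y)"
    proof (cases "4 * r n \<le> (1 - 2 * r n) * \<bar>x - y\<bar>")
      case True
      have "(\<integral>\<^sup>+ t. ennreal (T y t) * (\<integral>\<^sup>+ s. ennreal (T x s) * logker s t \<partial>lborel) \<partial>lborel)
        \<le> ennreal (max 0 (- ln ((1 - 2 * r n) * \<bar>x - y\<bar> - 2 * r n)))"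
        unfolding T_def
      proof (rule tent_average_le_const[OF rn(1) rn(1)], rule logker_le)
        show "0 < (1 - 2 * r n) * \<bar>x - y\<bar> - 2 * r n" using True rn(1) by linarith
        fix s t assume st: "\<bar>s - (r n + (1 - 2 * r n) * x)\<bar> < r n" "\<bar>t - (r n + (1 - 2 * r n) * y)\<bar> < r n"
        have "(1 - 2 * r n) * \<bar>x - y\<bar> = \<bar>(1 - 2 * r n) * x - (1 - 2 * r n) * y\<bar>"
          using r[of n] by (simp add: right_diff_distrib[symmetric] abs_mult)
        then show "(1 - 2 * r n) * \<bar>x - y\<bar> - 2 * r n \<le> \<bar>s - t\<bar>"
          using st by linarith
      qed
      then show ?thesis using True by (simp add: avg_bound_def)
    next
      case False
      have "(\<integral>\<^sup>+ t. ennreal (T y t) * (\<integral>\<^sup>+ s. ennreal (T x s) * logker s t \<partial>lborel) \<partial>lborel)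
        \<le> ennreal (- ln (r n) + 8)"
        unfolding T_def by (rule tent_average_le) (use rn in auto)
      then show ?thesis using False by (simp add: avg_bound_def)
    qed
  qed
  also have "\<dots> = H n"
    unfolding H_def by (subst \<mu>.nn_integral_fst[symmetric]) auto
  finally have "log_energy (density lborel (\<lambda>s. ennreal (p s))) \<le> log_energy \<mu> + ennreal \<epsilon>"
    using n by (auto intro: less_imp_le order_trans)
  then show thesis by (rule that[OF avg(1,2)])
qed

subsection \<open>Energy of sums of bumps\<close>

text \<open>Moving the values of g into the kernel leaves an average against two pure tents, to
  which \<open>tent_average_le_const\<close> applies.\<close>

lemma bump_pair_energy_eq:
  assumes [measurable]: "g \<in> borel_measurable borel" and g0: "\<And>x. 0 \<le> g x"
  shows "(\<integral>\<^sup>+ t. ennreal (g t * tent r' (t - b)) * (\<integral>\<^sup>+ s. ennreal (g s * tent r (s - a)) * logker s t \<partial>lborel) \<partial>lborel)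
    = (\<integral>\<^sup>+ t. ennreal (tent r' (t - b)) * (\<integral>\<^sup>+ s. ennreal (tent r (s - a)) * (ennreal (g s * g t) * logker s t) \<partial>lborel) \<partial>lborel)"
proof (rule nn_integral_cong)
  fix t
  have "(\<integral>\<^sup>+ s. ennreal (tent r (s - a)) * (ennreal (g s * g t) * logker s t) \<partial>lborel) =
      (\<integral>\<^sup>+ s. ennreal (g t) * (ennreal (g s * tent r (s - a)) * logker s t) \<partial>lborel)"
    by (simp add: ennreal_mult g0 tent_nonneg ac_simps)
  also have "\<dots> = ennreal (g t) * (\<integral>\<^sup>+ s. ennreal (g s * tent r (s - a)) * logker s t \<partial>lborel)"
    by (intro nn_integral_cmult) measurable
  finally show "ennreal (g t * tent r' (t - b)) * (\<integral>\<^sup>+ s. ennreal (g s * tent r (s - a)) * logker s t \<partial>lborel) =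
      ennreal (tent r' (t - b)) * (\<integral>\<^sup>+ s. ennreal (tent r (s - a)) * (ennreal (g s * g t) * logker s t) \<partial>lborel)"
    by (simp add: ennreal_mult g0 tent_nonneg ac_simps)
qed

text \<open>Covers coinciding bumps, where no lower bound on distances exists: g is replaced by G
  and the potential bound for a tent does the rest.\<close>

lemma bump_pair_energy_diagonal:
  assumes g: "g \<in> bump01" and G: "\<And>x. g x \<le> G" and r: "0 < r" "r \<le> 1" "0 < r'"
  shows "(\<integral>\<^sup>+ t. ennreal (g t * tent r' (t - b)) * (\<integral>\<^sup>+ s. ennreal (g s * tent r (s - a)) * logker s t \<partial>lborel) \<partial>lborel)
    \<le> ennreal (G^2 * (- ln r + 8))"
proof -
  have [measurable]: "g \<in> borel_measurable borel" by (rule bump01_measurable[OF g])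
  have g0: "0 \<le> g x" for x using g by (simp add: bump01_def)
  have G0: "0 \<le> G" using g0 G order_trans by blast
  have GG: "ennreal (G^2) = ennreal G * ennreal G" by (simp add: power2_eq_square ennreal_mult G0)
  have "(\<integral>\<^sup>+ t. ennreal (g t * tent r' (t - b)) * (\<integral>\<^sup>+ s. ennreal (g s * tent r (s - a)) * logker s t \<partial>lborel) \<partial>lborel)
    \<le> (\<integral>\<^sup>+ t. ennreal (G * tent r' (t - b)) * (\<integral>\<^sup>+ s. ennreal (G * tent r (s - a)) * logker s t \<partial>lborel) \<partial>lborel)"
    by (intro nn_integral_mono mult_mono mult_right_mono ennreal_leI G tent_nonneg) auto
  also have "\<dots> = (\<integral>\<^sup>+ t. ennreal (G^2) * (ennreal (tent r' (t - b)) * (\<integral>\<^sup>+ s. ennreal (tent r (s - a)) * logker s t \<partial>lborel)) \<partial>lborel)"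
  proof (rule nn_integral_cong)
    fix t
    have "(\<integral>\<^sup>+ s. ennreal (G * tent r (s - a)) * logker s t \<partial>lborel) =
        ennreal G * (\<integral>\<^sup>+ s. ennreal (tent r (s - a)) * logker s t \<partial>lborel)"
      by (subst nn_integral_cmult[symmetric]) (auto simp: ennreal_mult G0 tent_nonneg mult.assoc)
    then show "ennreal (G * tent r' (t - b)) * (\<integral>\<^sup>+ s. ennreal (G * tent r (s - a)) * logker s t \<partial>lborel) =
        ennreal (G^2) * (ennreal (tent r' (t - b)) * (\<integral>\<^sup>+ s. ennreal (tent r (s - a)) * logker s t \<partial>lborel))"
      by (simp add: ennreal_mult G0 tent_nonneg GG ac_simps)
  qed
  also have "\<dots> = ennreal (G^2) * (\<integral>\<^sup>+ t. ennreal (tent r' (t - b)) * (\<integral>\<^sup>+ s. ennreal (tent r (s - a)) * logker s t \<partial>lborel) \<partial>lborel)"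
    by (intro nn_integral_cmult) measurable
  also have "\<dots> \<le> ennreal (G^2) * ennreal (- ln r + 8)"
    by (intro mult_left_mono tent_average_le r) auto
  also have "\<dots> = ennreal (G^2 * (- ln r + 8))"
  proof -
    have "0 \<le> - ln r" using r by simp
    then show ?thesis by (subst ennreal_mult) auto
  qed
  finally show ?thesis .
qed

text \<open>The separation leaves \<open>\<bar>s - t\<bar> \<ge> \<bar>a - b\<bar> / 2\<close> on
  the supports. If \<open>\<bar>s - t\<bar> \<ge> \<delta>\<close>, kernel and truncated kernel
  agree and C suffices. Otherwise \<open>\<bar>a - b\<bar> < 2 * \<delta>\<close>, and the excess
  over the truncated kernel is charged to the logarithm at the centres, the quantity that (A2)
  controls.\<close>

lemma bump_pair_energy_separated:
  assumes g: "g \<in> bump01" and G: "\<And>x. g x \<le> G" and r: "0 < r" "0 < r'"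
    and sep: "2 * (r + r') \<le> \<bar>a - b\<bar>" and \<delta>: "0 < \<delta>" "2 * \<delta> \<le> 1" and C: "0 \<le> C"
    and close: "\<And>s t. s \<in> {0..1} \<Longrightarrow> t \<in> {0..1} \<Longrightarrow> \<bar>s - a\<bar> < r \<Longrightarrow> \<bar>t - b\<bar> < r' \<Longrightarrow>
      g s * g t * trunc_log \<delta> s t \<le> C"
  shows "(\<integral>\<^sup>+ t. ennreal (g t * tent r' (t - b)) * (\<integral>\<^sup>+ s. ennreal (g s * tent r (s - a)) * logker s t \<partial>lborel) \<partial>lborel)
    \<le> ennreal (C + G^2 * (if \<bar>a - b\<bar> < 2 * \<delta> then - ln \<bar>a - b\<bar> else 0))" (is "_ \<le> ennreal ?R")
proof -
  have [measurable]: "g \<in> borel_measurable borel" by (rule bump01_measurable[OF g])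
  have g0: "0 \<le> g x" for x using g by (simp add: bump01_def)
  have R: "0 \<le> G^2 * (if \<bar>a - b\<bar> < 2 * \<delta> then - ln \<bar>a - b\<bar> else 0)"
    using \<delta> r sep by auto
  show ?thesis
    unfolding bump_pair_energy_eq[OF \<open>g \<in> borel_measurable borel\<close> g0]
  proof (rule tent_average_le_const[OF r])
    fix s t assume s: "\<bar>s - a\<bar> < r" and t: "\<bar>t - b\<bar> < r'"
    have st: "\<bar>a - b\<bar> / 2 \<le> \<bar>s - t\<bar>" "0 < \<bar>a - b\<bar>"
    proof -
      have "\<bar>a - b\<bar> \<le> \<bar>s - a\<bar> + \<bar>s - t\<bar> + \<bar>t - b\<bar>" by linarith
      then show "\<bar>a - b\<bar> / 2 \<le> \<bar>s - t\<bar>" using s t sep by argo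
      show "0 < \<bar>a - b\<bar>" using sep r by argo
    qed
    then have ne: "s \<noteq> t" by auto
    have gg: "0 \<le> g s * g t" "g s * g t \<le> G^2"
      using g0 G order_trans[OF g0 G] by (auto simp: power2_eq_square intro!: mult_mono)
    have "g s * g t * max 0 (- ln \<bar>s - t\<bar>) \<le> ?R"
    proof (cases "s \<in> {0..1} \<and> t \<in> {0..1}")
      case False
      then have "g s * g t = 0" using g by (auto simp: bump01_def)
      then have "g s * g t * max 0 (- ln \<bar>s - t\<bar>) = 0" by (simp only: mult_zero_left)
      then show ?thesis using add_nonneg_nonneg[OF C R] by (simp only:)
    next
      case True
      then have le1: "\<bar>s - t\<bar> \<le> 1" by auto
      have c: "g s * g t * trunc_log \<delta> s t \<le> C" using close s t True by blast
      show ?thesis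
      proof (cases "\<delta> \<le> \<bar>s - t\<bar>")
        case True
        have "max 0 (- ln \<bar>s - t\<bar>) = trunc_log \<delta> s t"
          using True le1 ne by (simp add: trunc_log_def max_def min_def)
        then show ?thesis using c R by simp
      next
        case False
        then have ab: "\<bar>a - b\<bar> < 2 * \<delta>" using st by argo
        have tr: "trunc_log \<delta> s t = - ln \<delta>" using False le1 by (simp add: trunc_log_def max_def min_def)
        \<comment> \<open>Because \<open>\<delta> \<le> 1/2\<close>, the product
          \<open>\<bar>a - b\<bar> * \<delta>\<close> is at most
          \<open>\<bar>a - b\<bar> / 2\<close>. Its logarithm separates the truncated value
          \<open>- ln \<delta>\<close> from \<open>- ln \<bar>a - b\<bar>\<close> with coefficient 1
          and no additive constant.\<close>
        have "ln (\<bar>a - b\<bar> * \<delta>) \<le> ln \<bar>s - t\<bar>"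
        proof (subst ln_le_cancel_iff)
          have "\<bar>a - b\<bar> * \<delta> \<le> \<bar>a - b\<bar> * (1/2)" using \<delta> by (intro mult_left_mono) auto
          then show "\<bar>a - b\<bar> * \<delta> \<le> \<bar>s - t\<bar>" using st(1) by (elim order_trans) simp
        qed (use st \<delta> ne in auto)
        moreover have "ln (\<bar>a - b\<bar> * \<delta>) = ln \<bar>a - b\<bar> + ln \<delta>"
          using st \<delta> by (simp add: ln_mult)
        moreover have "ln \<delta> \<le> 0" "ln \<bar>a - b\<bar> \<le> 0" using \<delta> ab st by auto
        ultimately have "max 0 (- ln \<bar>s - t\<bar>) \<le> trunc_log \<delta> s t + (- ln \<bar>a - b\<bar>)"
          unfolding tr by linarith
        then have "g s * g t * max 0 (- ln \<bar>s - t\<bar>) \<le> g s * g t * (trunc_log \<delta> s t + (- ln \<bar>a - b\<bar>))"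
          by (intro mult_left_mono gg)
        also have "\<dots> = g s * g t * trunc_log \<delta> s t + g s * g t * (- ln \<bar>a - b\<bar>)"
          by (rule distrib_left)
        also have "\<dots> \<le> C + G^2 * (- ln \<bar>a - b\<bar>)"
          using \<open>ln \<bar>a - b\<bar> \<le> 0\<close> by (intro add_mono c mult_right_mono gg) auto
        finally show ?thesis using ab by simp
      qed
    qed
    then have "ennreal (g s * g t * max 0 (- ln \<bar>s - t\<bar>)) \<le> ennreal ?R" by (rule ennreal_leI)
    then show "ennreal (g s * g t) * logker s t \<le> ennreal ?R"
      using ne gg(1) by (simp only: logker_def if_False ennreal_mult max.cobounded1)
  qed
qed

lemma bump_sum_energy_le:
  assumes fin: "finite I" and g: "g \<in> bump01" and wt: "\<And>i. i \<in> I \<Longrightarrow> 0 \<le> wt i"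
    and B0: "\<And>i j. i \<in> I \<Longrightarrow> j \<in> I \<Longrightarrow> 0 \<le> B i j"
    and B: "\<And>i j. i \<in> I \<Longrightarrow> j \<in> I \<Longrightarrow>
      (\<integral>\<^sup>+ t. ennreal (g t * tent (r j) (t - a j)) * (\<integral>\<^sup>+ s. ennreal (g s * tent (r i) (s - a i)) * logker s t \<partial>lborel) \<partial>lborel)
        \<le> ennreal (B i j)"
  shows "log_energy (density lborel (\<lambda>x. ennreal (g x * (\<Sum>i\<in>I. wt i * tent (r i) (x - a i)))))
    \<le> ennreal (\<Sum>i\<in>I. \<Sum>j\<in>I. wt i * wt j * B i j)"
proof -
  have [measurable]: "g \<in> borel_measurable borel" by (rule bump01_measurable[OF g])
  have g0: "0 \<le> g x" for x using g by (simp add: bump01_def)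
  define u where "u i x = ennreal (g x * tent (r i) (x - a i))" for i x
  have [measurable]: "u i \<in> borel_measurable borel" for i unfolding u_def by measurable
  have eq: "ennreal (g x * (\<Sum>i\<in>I. wt i * tent (r i) (x - a i))) = (\<Sum>i\<in>I. ennreal (wt i) * u i x)" for x
  proof -
    have "(\<Sum>i\<in>I. ennreal (wt i) * u i x) = (\<Sum>i\<in>I. ennreal (wt i * (g x * tent (r i) (x - a i))))"
      unfolding u_def by (intro sum.cong refl ennreal_mult[symmetric] wt mult_nonneg_nonneg g0 tent_nonneg)
    also have "\<dots> = ennreal (\<Sum>i\<in>I. wt i * (g x * tent (r i) (x - a i)))"
      by (intro sum_ennreal mult_nonneg_nonneg wt g0 tent_nonneg)
    finally show ?thesis by (simp add: sum_distrib_left ac_simps)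
  qed
  define J where "J i t = (\<integral>\<^sup>+ s. u i s * logker s t \<partial>lborel)" for i t
  have [measurable]: "J i \<in> borel_measurable borel" for i unfolding J_def by measurable
  have inner: "(\<integral>\<^sup>+ s. (\<Sum>i\<in>I. ennreal (wt i) * u i s) * logker s t \<partial>lborel) = (\<Sum>i\<in>I. ennreal (wt i) * J i t)" for t
    unfolding J_def sum_distrib_right by (simp add: nn_integral_sum nn_integral_cmult mult.assoc)
  have "log_energy (density lborel (\<lambda>x. ennreal (g x * (\<Sum>i\<in>I. wt i * tent (r i) (x - a i))))) =
     (\<integral>\<^sup>+ t. (\<Sum>j\<in>I. ennreal (wt j) * u j t) * (\<Sum>i\<in>I. ennreal (wt i) * J i t) \<partial>lborel)"
    unfolding eq by (subst log_energy_density) (auto intro: lborel.sigma_finite_measure_axioms simp: inner)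
  also have "\<dots> = (\<integral>\<^sup>+ t. (\<Sum>j\<in>I. \<Sum>i\<in>I. ennreal (wt j) * ennreal (wt i) * (u j t * J i t)) \<partial>lborel)"
    unfolding sum_product by (intro nn_integral_cong sum.cong refl) (simp only: ac_simps)
  also have "\<dots> = (\<Sum>j\<in>I. \<Sum>i\<in>I. ennreal (wt j) * ennreal (wt i) * (\<integral>\<^sup>+ t. u j t * J i t \<partial>lborel))"
    by (simp add: nn_integral_sum nn_integral_cmult)
  also have "\<dots> \<le> (\<Sum>j\<in>I. \<Sum>i\<in>I. ennreal (wt j) * ennreal (wt i) * ennreal (B i j))"
    unfolding u_def J_def by (intro sum_mono mult_left_mono B) auto
  also have "\<dots> = (\<Sum>j\<in>I. \<Sum>i\<in>I. ennreal (wt j * wt i * B i j))"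
    by (intro sum.cong refl) (simp add: ennreal_mult wt B0)
  also have "\<dots> = ennreal (\<Sum>j\<in>I. \<Sum>i\<in>I. wt j * wt i * B i j)"
    by (simp add: sum_ennreal wt B0 sum_nonneg)
  also have "(\<Sum>j\<in>I. \<Sum>i\<in>I. wt j * wt i * B i j) = (\<Sum>i\<in>I. \<Sum>j\<in>I. wt i * wt j * B i j)"
    by (subst sum.swap) (simp only: mult.commute)
  finally show ?thesis .
qed

subsection \<open>Systems of points\<close>

text \<open>Composition with \<open>clamp01\<close> turns a function that is continuous on \<open>[0, 1]\<close> only, with arbitrary
  values elsewhere, into a bounded Borel function.\<close>

definition clamp01 :: "real \<Rightarrow> real" where "clamp01 x = max 0 (min 1 x)"

lemma clamp01_in: "clamp01 x \<in> {0..1}"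
  by (simp add: clamp01_def)

lemma clamp01_id: "x \<in> {0..1} \<Longrightarrow> clamp01 x = x"
  by (simp add: clamp01_def)

lemma continuous_on_clamp01: "continuous_on UNIV clamp01"
  unfolding clamp01_def[abs_def] by (intro continuous_intros)

lemma continuous_on_compose_clamp01:
  "continuous_on {0..1} f \<Longrightarrow> continuous_on UNIV (\<lambda>x. f (clamp01 x))"
  by (rule continuous_on_compose2[OF _ continuous_on_clamp01]) (use clamp01_in in auto)

lemma clamp01_measurable [measurable]: "clamp01 \<in> borel_measurable borel"
  by (intro borel_measurable_continuous_onI continuous_on_clamp01)

lemma integrable_compose_clamp01:
  fixes f :: "real \<Rightarrow> real"
  assumes sets: "sets M = sets borel" and "finite_measure M" and f: "continuous_on {0..1} f"
  shows "integrable M (\<lambda>x. f (clamp01 x))"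
proof -
  interpret finite_measure M by fact
  have "bounded (f ` {0..1})" by (intro compact_imp_bounded compact_continuous_image f) simp
  then obtain B where "\<forall>y\<in>f ` {0..1}. norm y \<le> B" unfolding bounded_iff by (elim exE)
  then have B: "\<bar>f x\<bar> \<le> B" if "x \<in> {0..1}" for x using that by (simp only: ball_simps real_norm_def) blast
  show ?thesis
    by (intro integrable_const_bound[where B = B] borel_measurable_sets_borel[OF sets]
        borel_measurable_continuous_onI continuous_on_compose_clamp01 f)
      (use B clamp01_in in auto)
qed

lemma integral_clamp01_contraction:
  fixes f g :: "real \<Rightarrow> real"
  assumes sets: "sets M = sets borel" and "prob_space M"
    and fg: "continuous_on {0..1} f" "continuous_on {0..1} g"
    and e: "\<And>x. x \<in> {0..1} \<Longrightarrow> \<bar>f x - g x\<bar> \<le> e"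
  shows "\<bar>(\<integral>x. f (clamp01 x) \<partial>M) - (\<integral>x. g (clamp01 x) \<partial>M)\<bar> \<le> e"
proof -
  interpret prob_space M by fact
  note int = integrable_compose_clamp01[OF sets finite_measure_axioms]
  have e': "\<bar>f (clamp01 x) - g (clamp01 x)\<bar> \<le> e" for x by (rule e[OF clamp01_in])
  have "\<bar>(\<integral>x. f (clamp01 x) \<partial>M) - (\<integral>x. g (clamp01 x) \<partial>M)\<bar> = \<bar>\<integral>x. f (clamp01 x) - g (clamp01 x) \<partial>M\<bar>"
    by (simp add: int fg)
  also have "\<dots> \<le> (\<integral>x. \<bar>f (clamp01 x) - g (clamp01 x)\<bar> \<partial>M)" by (rule integral_abs_bound)
  also have "\<dots> \<le> (\<integral>x. e \<partial>M)"
    by (intro integral_mono integrable_abs Bochner_Integration.integrable_diff int fg e') simp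
  also have "\<dots> = e" by (simp add: prob_space)
  finally show ?thesis .
qed

lemma double_integral_clamp01:
  fixes F :: "real \<Rightarrow> real \<Rightarrow> real"
  assumes sets: "sets M = sets borel" and "prob_space M" and supp: "AE x in M. x \<in> {0..1}"
    and F: "case_prod F \<in> borel_measurable (borel \<Otimes>\<^sub>M borel)"
  shows "(\<integral>x. (\<integral>y. F (clamp01 x) (clamp01 y) \<partial>M) \<partial>M) = (\<integral>x. (\<integral>y. F x y \<partial>M) \<partial>M)"
proof -
  interpret prob_space M by fact
  have [measurable_cong]: "sets M = sets borel" by (rule sets)
  note [measurable] = F
  have 1: "(\<integral>y. F x (clamp01 y) \<partial>M) = (\<integral>y. F x y \<partial>M)" for x
    by (intro integral_cong_AE eventually_mono[OF supp] arg_cong[where f = "F x"] clamp01_id) measurable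
  have "(\<integral>x. (\<integral>y. F (clamp01 x) y \<partial>M) \<partial>M) = (\<integral>x. (\<integral>y. F x y \<partial>M) \<partial>M)"
    by (intro integral_cong_AE eventually_mono[OF supp]) (measurable, simp only: clamp01_id)
  then show ?thesis unfolding 1 .
qed

lemma finite_blockA [simp]: "finite (blockA n)" and card_blockA [simp]: "card (blockA n) = n"
  by (auto simp: blockA_def)

lemma blockA_disjoint:
  assumes "k \<in> blockA (2^a * n)" "k \<in> blockA (2^b * n)" shows "a = b"
proof (rule ccontr)
  have False if "a < b" "k \<in> blockA (2^a * n)" "k \<in> blockA (2^b * n)" for a b :: nat
  proof -
    have "2 * (2^a * n) = 2^(Suc a) * n" by simp
    also have "\<dots> \<le> 2^b * n" using that(1) by (intro mult_right_mono power_increasing) auto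
    finally have "2 * (2^a * n) \<le> 2^b * n" .
    moreover have "k < 2 * (2^a * n)" "2^b * n \<le> k"
      using that(2,3) unfolding blockA_def atLeastLessThan_iff by auto
    ultimately show False by linarith
  qed
  moreover assume "a \<noteq> b"
  ultimately show False using assms by (cases "a < b") (auto dest: linorder_neqE_nat)
qed

text \<open>\<open>w\<close> is the density \<open>\<phi>\<close> of (A1), made nonnegative and extended by \<open>0\<close> outside \<open>[0, 1]\<close>.\<close>

locale log_point_system =
  fixes lam :: real and c l w :: "_ \<Rightarrow> real" and q :: "nat \<Rightarrow> nat" and \<Phi> :: "real measure"
  defines "\<Phi> \<equiv> density lborel (\<lambda>x :: real. ennreal (w x))"
  assumes lam_pos: "0 < lam"
    and c01: "\<And>k :: nat. 1 \<le> k \<Longrightarrow> 0 < c k \<and> c k < 1"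
    and l_eq: "\<And>k :: nat. l k = exp (- lam * real k)"
    and w_measurable [measurable]: "w \<in> borel_measurable borel"
    and w_nonneg: "\<And>x. 0 \<le> w x" and w_zero: "\<And>x. x \<notin> {0..1} \<Longrightarrow> w x = 0"
    and w_pos: "AE x in lborel. x \<in> {0..1} \<longrightarrow> 0 < w x"
    and w_int: "(\<integral>\<^sup>+ x. ennreal (w x) \<partial>lborel) = 1"
    and equidist: "\<And>f. continuous_on {0..1} f \<Longrightarrow>
      (\<lambda>n. (\<Sum>k\<in>blockA n. f (c k)) / real n) \<longlonglongrightarrow> (\<integral>x. f (clamp01 x) \<partial>\<Phi>)"
    and q_lim: "filterlim q at_top sequentially"
    and close_pairs: "\<And>\<epsilon>. 0 < \<epsilon> \<Longrightarrow> \<exists>\<delta>>0. \<forall>\<^sub>F n in sequentially. \<forall>a\<le>q n. \<forall>b\<le>q n.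
      (\<Sum>i\<in>blockA (2^a * n). \<Sum>j\<in>blockA (2^b * n).
         if i \<noteq> j \<and> \<bar>c i - c j\<bar> < \<delta> then - ln \<bar>c i - c j\<bar> else 0) \<le> \<epsilon> * real (2^a * n) * real (2^b * n)"
    and separated: "\<forall>\<^sub>F n in sequentially. \<forall>i\<in>blockAq n (q n). \<forall>j\<in>blockAq n (q n). i \<noteq> j \<longrightarrow>
      l i + l j < 2 * \<bar>c i - c j\<bar>"
begin

section \<open>Block averages and finite energy of the weight\<close>

lemma sets_\<Phi> [measurable_cong]: "sets \<Phi> = sets borel"
  by (simp add: \<Phi>_def)

lemma prob_\<Phi>: "prob_space \<Phi>"
  by (rule prob_spaceI) (simp add: \<Phi>_def emeasure_density w_int)

lemma sigma_finite_\<Phi>: "sigma_finite_measure \<Phi>"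
  using prob_\<Phi> by (simp add: prob_space_def finite_measure_def)

lemma AE_\<Phi>: "AE x in \<Phi>. x \<in> {0..1}"
proof -
  have "x \<in> {0..1}" if "0 < ennreal (w x)" for x
    using that w_zero[of x] by (cases "x \<in> {0..1}") auto
  then show ?thesis unfolding \<Phi>_def by (subst AE_density) auto
qed

definition avg :: "nat \<Rightarrow> (real \<Rightarrow> real) \<Rightarrow> real" where
  "avg n f = (\<Sum>k\<in>blockA n. f (c k)) / real n"

lemma c_blockA: "k \<in> blockA n \<Longrightarrow> c k \<in> {0..1}"
  using c01[of k] by (cases "n = 0") (auto simp: blockA_def)

lemma avg_contraction:
  assumes "\<And>x. x \<in> {0..1} \<Longrightarrow> \<bar>f x - g x\<bar> \<le> e" shows "\<bar>avg n f - avg n g\<bar> \<le> e"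
proof (cases "n = 0")
  \<comment> \<open>Division by zero makes both averages 0, so only \<open>0 \<le> e\<close> is
    needed; the hypothesis at the point 0 provides it.\<close>
  case True
  then show ?thesis using order_trans[OF abs_ge_zero assms[of 0]] by (simp add: avg_def)
next
  case False
  have "\<bar>\<Sum>k\<in>blockA n. f (c k) - g (c k)\<bar> \<le> (\<Sum>k\<in>blockA n. \<bar>f (c k) - g (c k)\<bar>)" by (rule sum_abs)
  also have "\<dots> \<le> (\<Sum>k\<in>blockA n. e)" by (intro sum_mono assms c_blockA)
  finally have "\<bar>\<Sum>k\<in>blockA n. f (c k) - g (c k)\<bar> \<le> real n * e" by simp
  moreover have "avg n f - avg n g = (\<Sum>k\<in>blockA n. f (c k) - g (c k)) / real n"
    by (simp add: avg_def sum_subtractf diff_divide_distrib)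
  ultimately have "\<bar>avg n f - avg n g\<bar> \<le> real n * e / real n"
    by (simp only: abs_divide abs_of_nat) (intro divide_right_mono, auto)
  then show ?thesis using False by simp
qed

text \<open>The indices m and n are independent: pairs of points from blocks of different lengths
  have to be averaged with one and the same threshold.\<close>

lemma avg_double_limit:
  fixes F :: "real \<Rightarrow> real \<Rightarrow> real"
  assumes F: "continuous_on UNIV (\<lambda>p. F (fst p) (snd p))" and e: "0 < e"
  shows "\<exists>N. \<forall>m\<ge>N. \<forall>n\<ge>N. \<bar>avg m (\<lambda>x. avg n (F x)) - (\<integral>x. (\<integral>y. F x y \<partial>\<Phi>) \<partial>\<Phi>)\<bar> < e"
proof -
  have "case_prod F \<in> borel_measurable (borel \<Otimes>\<^sub>M borel)"
    using borel_measurable_continuous_onI[OF F] by (simp add: case_prod_beta' borel_prod)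
  from double_integral_clamp01[OF sets_\<Phi> prob_\<Phi> AE_\<Phi> this]
  have eq: "(\<integral>x. (\<integral>y. F (clamp01 x) (clamp01 y) \<partial>\<Phi>) \<partial>\<Phi>) = (\<integral>x. (\<integral>y. F x y \<partial>\<Phi>) \<partial>\<Phi>)" .
  have "\<exists>N. \<forall>m\<ge>N. \<forall>n\<ge>N. \<bar>avg m (\<lambda>x. avg n (F x)) -
      (\<lambda>f. \<integral>x. f (clamp01 x) \<partial>\<Phi>) (\<lambda>x. (\<lambda>f. \<integral>x. f (clamp01 x) \<partial>\<Phi>) (F x))\<bar> < e"
  proof (rule contraction_double_limit[where L = avg and M = "\<lambda>f. \<integral>x. f (clamp01 x) \<partial>\<Phi>" and F = F and e = e])
    show "(\<lambda>n. avg n f) \<longlonglongrightarrow> (\<integral>x. f (clamp01 x) \<partial>\<Phi>)" if "continuous_on {0..1} f" for f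
      unfolding avg_def by (rule equidist[OF that])
    show "continuous_on ({0..1} \<times> {0..1}) (\<lambda>p. F (fst p) (snd p))"
      using F by (rule continuous_on_subset) simp
    show "\<bar>avg n f - avg n g\<bar> \<le> e" if "\<And>x. x \<in> {0..1} \<Longrightarrow> \<bar>f x - g x\<bar> \<le> e" for n f g e
      by (rule avg_contraction) (rule that)
    show "\<bar>(\<integral>x. f (clamp01 x) \<partial>\<Phi>) - (\<integral>x. g (clamp01 x) \<partial>\<Phi>)\<bar> \<le> e"
      if "continuous_on {0..1} f" "continuous_on {0..1} g" "\<And>x. x \<in> {0..1} \<Longrightarrow> \<bar>f x - g x\<bar> \<le> e" for f g :: "real \<Rightarrow> real" and e
      by (rule integral_clamp01_contraction[OF sets_\<Phi> prob_\<Phi> that(1,2)]) (rule that(3))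
  qed (rule e)
  then show ?thesis by (simp add: eq)
qed

text \<open>A truncated energy of \<open>\<Phi>\<close> is the limit of averages over pairs from one
  block. Close pairs contribute at most 1 by (A2), other distinct pairs at most C, the diagonal at
  most 1 for large n, and the limit costs another 1. The bound \<open>3 + C\<close> does not depend
  on the truncation \<open>\<eta>\<close>, only the choice of n does.\<close>

lemma log_energy_\<Phi>_finite: "log_energy \<Phi> < \<infinity>"
proof -
  obtain \<delta> where \<delta>: "0 < \<delta>" "\<forall>\<^sub>F n in sequentially. \<forall>a\<le>q n. \<forall>b\<le>q n.
      (\<Sum>i\<in>blockA (2^a * n). \<Sum>j\<in>blockA (2^b * n).
         if i \<noteq> j \<and> \<bar>c i - c j\<bar> < \<delta> then - ln \<bar>c i - c j\<bar> else 0) \<le> 1 * real (2^a * n) * real (2^b * n)"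
    using close_pairs[of 1] by auto
  define C where "C = max 0 (- ln \<delta>)"
  have bound: "(\<integral>x. (\<integral>y. trunc_log \<eta> x y \<partial>\<Phi>) \<partial>\<Phi>) \<le> 3 + C" if \<eta>: "0 < \<eta>" "\<eta> \<le> 1" for \<eta>
  proof -
    obtain N where N: "\<And>m n. m \<ge> N \<Longrightarrow> n \<ge> N \<Longrightarrow>
        \<bar>avg m (\<lambda>x. avg n (trunc_log \<eta> x)) - (\<integral>x. (\<integral>y. trunc_log \<eta> x y \<partial>\<Phi>) \<partial>\<Phi>)\<bar> < 1"
      using avg_double_limit[OF continuous_on_trunc_log[OF \<eta>(1)], of 1] by auto
    \<comment> \<open>A diagonal term is at most \<open>- ln \<eta>\<close> and there are n of them
      among \<open>n^2\<close> pairs, so \<open>n \<ge> - ln \<eta>\<close> bounds their average by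
      1.\<close>
    obtain K :: nat where K: "- ln \<eta> \<le> real K" using real_arch_simple by blast
    obtain n where n: "max 1 (max N K) \<le> n"
      and cl: "\<forall>a\<le>q n. \<forall>b\<le>q n. (\<Sum>i\<in>blockA (2^a * n). \<Sum>j\<in>blockA (2^b * n).
         if i \<noteq> j \<and> \<bar>c i - c j\<bar> < \<delta> then - ln \<bar>c i - c j\<bar> else 0) \<le> 1 * real (2^a * n) * real (2^b * n)"
      and sep: "\<forall>i\<in>blockAq n (q n). \<forall>j\<in>blockAq n (q n). i \<noteq> j \<longrightarrow> l i + l j < 2 * \<bar>c i - c j\<bar>"
      using eventually_happens[OF eventually_conj[OF \<delta>(2) eventually_conj[OF separated eventually_ge_at_top[of "max 1 (max N K)"]]]]
      by auto
    let ?cl = "\<lambda>i j. if i \<noteq> j \<and> \<bar>c i - c j\<bar> < \<delta> then - ln \<bar>c i - c j\<bar> else 0"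
    have cl0: "(\<Sum>i\<in>blockA n. \<Sum>j\<in>blockA n. ?cl i j) \<le> real n * real n"
      using cl[rule_format, of 0 0] by simp
    have le: "trunc_log \<eta> (c i) (c j) \<le> ?cl i j + C + (if i = j then - ln \<eta> else 0)"
      if ij: "i \<in> blockA n" "j \<in> blockA n" for i j
    proof (cases "i = j")
      case True
      then show ?thesis using trunc_log_le[OF \<eta>(1), of "c i" "c j"] by (simp add: C_def)
    next
      case False
      have "i \<in> blockAq n (q n)" "j \<in> blockAq n (q n)"
        using ij by (auto simp: blockAq_def intro!: exI[of _ 0] bexI[of _ 0])
      then have "l i + l j < 2 * \<bar>c i - c j\<bar>" using sep False by blast
      then have pos: "0 < \<bar>c i - c j\<bar>"
        unfolding l_eq using exp_gt_zero[of "- lam * real i"] exp_gt_zero[of "- lam * real j"] by argo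
      have "1 \<le> i" "1 \<le> j" using ij n by (auto simp: blockA_def)
      then have le1: "\<bar>c i - c j\<bar> \<le> 1" using c01[of i] c01[of j] by auto
      show ?thesis
      proof (cases "\<bar>c i - c j\<bar> < \<delta>")
        case True
        have "trunc_log \<eta> (c i) (c j) \<le> - ln \<bar>c i - c j\<bar>"
          unfolding trunc_log_def using pos le1 by (auto simp: ln_le_cancel_iff)
        then show ?thesis using False True by (simp add: C_def)
      next
        case F: False
        have "trunc_log \<eta> (c i) (c j) \<le> - ln \<delta>"
          unfolding trunc_log_def using F \<delta>(1) le1 by auto
        then show ?thesis using False F by (simp add: C_def)
      qed
    qed
    have "(\<Sum>i\<in>blockA n. \<Sum>j\<in>blockA n. trunc_log \<eta> (c i) (c j)) \<le>
        (\<Sum>i\<in>blockA n. \<Sum>j\<in>blockA n. ?cl i j + C + (if i = j then - ln \<eta> else 0))"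
      by (intro sum_mono le)
    also have "\<dots> = (\<Sum>i\<in>blockA n. \<Sum>j\<in>blockA n. ?cl i j) + real n * real n * C + real n * (- ln \<eta>)"
      unfolding sum.distrib by (simp add: mult.assoc)
    also have "\<dots> \<le> real n * real n + real n * real n * C + real n * real n"
    proof (intro add_mono cl0 mult_left_mono order_refl)
      show "- ln \<eta> \<le> real n" using K n by (meson le_trans max.bounded_iff of_nat_mono order_trans)
    qed auto
    also have "\<dots> = real n * real n * (2 + C)" by (simp add: algebra_simps)
    finally have "(\<Sum>i\<in>blockA n. \<Sum>j\<in>blockA n. trunc_log \<eta> (c i) (c j)) \<le> real n * real n * (2 + C)" .
    moreover have "avg n (\<lambda>x. avg n (trunc_log \<eta> x)) =
        (\<Sum>i\<in>blockA n. \<Sum>j\<in>blockA n. trunc_log \<eta> (c i) (c j)) / (real n * real n)"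
      by (simp add: avg_def sum_divide_distrib[symmetric])
    ultimately have "avg n (\<lambda>x. avg n (trunc_log \<eta> x)) \<le> 2 + C"
      using n by (simp add: divide_le_eq mult.commute)
    then show ?thesis using N[of n n] n by auto
  qed
  have "log_energy \<Phi> \<le> ennreal (3 + C)"
    unfolding log_energy_eq_SUP[OF sets_\<Phi> sigma_finite_\<Phi>]
    by (intro SUP_least, subst nn_integral_trunc_log[OF sets_\<Phi> prob_\<Phi>])
      (auto intro!: ennreal_leI bound)
  then show ?thesis by (simp add: le_less_trans[OF _ ennreal_less_top])
qed

end

lemma nn_integral_tent_sum:
  assumes "finite I" "\<And>i. i \<in> I \<Longrightarrow> 0 \<le> v i" "\<And>i. i \<in> I \<Longrightarrow> 0 < r i"
  shows "(\<integral>\<^sup>+ x. ennreal (\<Sum>i\<in>I. v i * tent (r i) (x - a i)) \<partial>lborel) = ennreal (\<Sum>i\<in>I. v i)"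
proof -
  have "(\<integral>\<^sup>+ x. ennreal (\<Sum>i\<in>I. v i * tent (r i) (x - a i)) \<partial>lborel) =
      (\<integral>\<^sup>+ x. (\<Sum>i\<in>I. ennreal (v i) * ennreal (tent (r i) (x - a i))) \<partial>lborel)"
    by (intro nn_integral_cong) (simp add: sum_ennreal[symmetric] ennreal_mult assms tent_nonneg)
  also have "\<dots> = (\<Sum>i\<in>I. ennreal (v i) * (\<integral>\<^sup>+ x. ennreal (tent (r i) (x - a i)) \<partial>lborel))"
    by (simp add: nn_integral_sum nn_integral_cmult)
  also have "\<dots> = (\<Sum>i\<in>I. ennreal (v i))"
    by (intro sum.cong refl) (simp add: nn_integral_tent assms)
  also have "\<dots> = ennreal (\<Sum>i\<in>I. v i)"
    by (rule sum_ennreal) (rule assms(2))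
  finally show ?thesis .
qed

lemma uniformly_close_on_square:
  fixes F :: "real \<Rightarrow> real \<Rightarrow> real"
  assumes "continuous_on UNIV (\<lambda>p. F (fst p) (snd p))" "0 < e"
  obtains d where "0 < d" "\<And>x x' y y'. x \<in> {0..1} \<Longrightarrow> x' \<in> {0..1} \<Longrightarrow> y \<in> {0..1} \<Longrightarrow> y' \<in> {0..1} \<Longrightarrow>
    \<bar>x - x'\<bar> < d \<Longrightarrow> \<bar>y - y'\<bar> < d \<Longrightarrow> \<bar>F x y - F x' y'\<bar> < e"
proof -
  have "uniformly_continuous_on ({0..1} \<times> {0..1}) (\<lambda>p. F (fst p) (snd p))"
    by (intro compact_uniformly_continuous compact_Times continuous_on_subset[OF assms(1)]) auto
  then obtain d where d: "d > 0" "\<And>p p'. p \<in> {0..1} \<times> {0..1} \<Longrightarrow> p' \<in> {0..1} \<times> {0..1} \<Longrightarrow> dist p' p < d \<Longrightarrow>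
      dist (F (fst p') (snd p')) (F (fst p) (snd p)) < e"
    using assms(2) unfolding uniformly_continuous_on_def by meson
  show thesis
  proof (rule that[of "d/2"])
    fix x x' y y' :: real
    assume *: "x \<in> {0..1}" "x' \<in> {0..1}" "y \<in> {0..1}" "y' \<in> {0..1}" "\<bar>x - x'\<bar> < d/2" "\<bar>y - y'\<bar> < d/2"
    have "dist (x, y) (x', y') \<le> \<bar>x - x'\<bar> + \<bar>y - y'\<bar>"
      by (simp add: dist_Pair_Pair dist_real_def sqrt_sum_squares_le_sum_abs)
    then have "dist (x, y) (x', y') < d" using *(5,6) by linarith
    then show "\<bar>F x y - F x' y'\<bar> < e" using d(2)[of "(x', y')" "(x, y)"] *(1-4) by (simp add: dist_real_def)
  qed (use d(1) in simp)
qed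

context log_point_system
begin

lemma l_pos: "0 < l k" and l_antimono: "m \<le> k \<Longrightarrow> l k \<le> l m"
  using lam_pos by (auto simp: l_eq)

lemma l_tendsto_0: "l \<longlonglongrightarrow> 0"
proof -
  have "(\<lambda>k. exp (- lam) ^ k) \<longlonglongrightarrow> 0" using lam_pos by (intro LIMSEQ_realpow_zero) auto
  moreover have "exp (- lam) ^ k = l k" for k
    by (simp add: l_eq exp_of_nat_mult[symmetric] mult.commute)
  ultimately show ?thesis by (simp only:)
qed

lemma truncated_energy_le:
  assumes g: "g \<in> bump01" and \<delta>: "0 < \<delta>" "\<delta> \<le> 1"
  shows "ennreal (\<integral>x. (\<integral>y. g x * g y * trunc_log \<delta> x y \<partial>\<Phi>) \<partial>\<Phi>) \<le> log_energy (density \<Phi> (\<lambda>x. ennreal (g x)))"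
proof -
  have gm[measurable]: "g \<in> borel_measurable borel" by (rule bump01_measurable[OF g])
  have g0: "0 \<le> g x" for x using g by (simp add: bump01_def)
  obtain G where G: "0 < G" "\<And>x. g x \<le> G" using bump01_bounded[OF g] by blast
  have "ennreal (\<integral>x. (\<integral>y. g x * g y * trunc_log \<delta> x y \<partial>\<Phi>) \<partial>\<Phi>) =
      (\<integral>\<^sup>+ y. (\<integral>\<^sup>+ x. ennreal (g y * g x * trunc_log \<delta> y x) \<partial>\<Phi>) \<partial>\<Phi>)"
  proof (rule nn_integral_double_bounded[OF sets_\<Phi> prob_\<Phi>, symmetric])
    show "g x * g y * trunc_log \<delta> x y \<le> G * G * (- ln \<delta>)" for x y
      using G g0 \<delta> by (intro mult_mono trunc_log_le) (auto intro: trunc_log_nonneg less_imp_le)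
  qed (auto simp: g0 trunc_log_nonneg \<delta>)
  also have "\<dots> \<le> (\<integral>\<^sup>+ y. ennreal (g y) * (\<integral>\<^sup>+ x. ennreal (g x) * logker x y \<partial>\<Phi>) \<partial>\<Phi>)"
  proof (rule nn_integral_mono)
    fix y
    have "(\<integral>\<^sup>+ x. ennreal (g y * g x * trunc_log \<delta> y x) \<partial>\<Phi>) \<le> (\<integral>\<^sup>+ x. ennreal (g y) * (ennreal (g x) * logker x y) \<partial>\<Phi>)"
    proof (rule nn_integral_mono)
      fix x
      have "ennreal (g y * g x * trunc_log \<delta> y x) = ennreal (g y) * (ennreal (g x) * ennreal (trunc_log \<delta> x y))"
        by (simp add: ennreal_mult g0 trunc_log_nonneg \<delta> trunc_log_commute[of \<delta> y x] mult.assoc)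
      also have "\<dots> \<le> ennreal (g y) * (ennreal (g x) * logker x y)"
        by (intro mult_left_mono trunc_log_le_logker \<delta>) auto
      finally show "ennreal (g y * g x * trunc_log \<delta> y x) \<le> ennreal (g y) * (ennreal (g x) * logker x y)" .
    qed
    also have "\<dots> = ennreal (g y) * (\<integral>\<^sup>+ x. ennreal (g x) * logker x y \<partial>\<Phi>)"
      by (intro nn_integral_cmult) measurable
    finally show "(\<integral>\<^sup>+ x. ennreal (g y * g x * trunc_log \<delta> y x) \<partial>\<Phi>) \<le>
        ennreal (g y) * (\<integral>\<^sup>+ x. ennreal (g x) * logker x y \<partial>\<Phi>)" .
  qed
  also have "\<dots> = log_energy (density \<Phi> (\<lambda>x. ennreal (g x)))"
    by (rule log_energy_density[OF sets_\<Phi> _ sigma_finite_\<Phi>, symmetric]) measurable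
  finally show ?thesis .
qed

lemma avg_avg:
  "avg m (\<lambda>x. avg n (F x)) = (\<Sum>i\<in>blockA m. \<Sum>j\<in>blockA n. F (c i) (c j)) / (real m * real n)"
  by (simp add: avg_def sum_divide_distrib[symmetric])

text \<open>A single block has diagonal energy of order \<open>lam\<close>; spreading the mass evenly over \<open>q + 1\<close>
  blocks divides this contribution by \<open>q + 1\<close>.\<close>

lemma block_energy_sum_le:
  fixes B :: "nat \<Rightarrow> nat \<Rightarrow> real" and D :: "nat \<Rightarrow> real"
  assumes n: "1 \<le> n" and C: "0 \<le> C"
    and I: "I = (SIGMA a:{..Q}. blockA (2^a * n))"
    and wt: "\<And>z. wt z = 1 / (real (Suc Q) * real (2 ^ fst z * n))"
    and B: "\<And>a b. a \<le> Q \<Longrightarrow> b \<le> Q \<Longrightarrow>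
      (\<Sum>i\<in>blockA (2^a * n). \<Sum>j\<in>blockA (2^b * n). B i j) \<le> real (2^a * n) * real (2^b * n) * R"
    and D: "\<And>a i. a \<le> Q \<Longrightarrow> i \<in> blockA (2^a * n) \<Longrightarrow> D i \<le> C * real (2^a * n)"
  shows "(\<Sum>z\<in>I. \<Sum>z'\<in>I. wt z * wt z' * (B (snd z) (snd z') + (if snd z = snd z' then D (snd z) else 0)))
    \<le> R + C / real (Suc Q)"
proof -
  have finI: "finite I" unfolding I by auto
  \<comment> \<open>The point weight on block a is chosen so that every block receives the same mass
    \<open>1 / (Q + 1)\<close>.\<close>
  define v where "v a = 1 / (real (Suc Q) * real (2 ^ a * n))" for a :: nat
  have v0: "0 \<le> v a" and vn: "v a * real (2^a * n) = 1 / real (Suc Q)" for a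
    using n by (auto simp: v_def)
  have sumI: "(\<Sum>z\<in>I. f z) = (\<Sum>a\<le>Q. \<Sum>i\<in>blockA (2^a * n). f (a, i))" for f :: "nat \<times> nat \<Rightarrow> real"
    unfolding I by (subst sum.Sigma) auto
  have "(\<Sum>z\<in>I. \<Sum>z'\<in>I. wt z * wt z' * B (snd z) (snd z')) =
      (\<Sum>a\<le>Q. \<Sum>i\<in>blockA (2^a * n). \<Sum>b\<le>Q. \<Sum>j\<in>blockA (2^b * n). v a * v b * B i j)"
    unfolding sumI by (simp add: wt v_def)
  also have "\<dots> = (\<Sum>a\<le>Q. \<Sum>b\<le>Q. \<Sum>i\<in>blockA (2^a * n). \<Sum>j\<in>blockA (2^b * n). v a * v b * B i j)"
    by (intro sum.cong refl sum.swap)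
  also have "\<dots> = (\<Sum>a\<le>Q. \<Sum>b\<le>Q. v a * v b * (\<Sum>i\<in>blockA (2^a * n). \<Sum>j\<in>blockA (2^b * n). B i j))"
    by (simp only: sum_distrib_left)
  also have "\<dots> \<le> (\<Sum>a\<le>Q. \<Sum>b\<le>Q. v a * v b * (real (2^a * n) * real (2^b * n) * R))"
    by (intro sum_mono mult_left_mono B mult_nonneg_nonneg v0) auto
  also have "\<dots> = (\<Sum>a\<le>Q. \<Sum>b\<le>Q. (v a * real (2^a * n)) * (v b * real (2^b * n)) * R)"
    by (simp only: ac_simps)
  also have "\<dots> = R" unfolding vn by simp
  finally have 1: "(\<Sum>z\<in>I. \<Sum>z'\<in>I. wt z * wt z' * B (snd z) (snd z')) \<le> R" .
  \<comment> \<open>An index k lies in at most one of the doubled blocks, so equal second components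
    mean equal pairs, and the terms D sit on the true diagonal of I.\<close>
  have inj: "z = z'" if "z \<in> I" "z' \<in> I" "snd z = snd z'" for z z'
    using that blockA_disjoint[of "snd z" "fst z" n "fst z'"] unfolding I by (auto simp: prod_eq_iff)
  have "(\<Sum>z\<in>I. \<Sum>z'\<in>I. wt z * wt z' * (if snd z = snd z' then D (snd z) else 0)) =
      (\<Sum>z\<in>I. \<Sum>z'\<in>I. if z' = z then wt z * wt z * D (snd z) else 0)"
    by (intro sum.cong refl) (auto dest: inj)
  also have "\<dots> = (\<Sum>z\<in>I. wt z * wt z * D (snd z))"
    using finI by (intro sum.cong refl) simp
  also have "\<dots> = (\<Sum>a\<le>Q. \<Sum>i\<in>blockA (2^a * n). v a * v a * D i)"
    unfolding sumI by (simp add: wt v_def)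
  also have "\<dots> \<le> (\<Sum>a\<le>Q. \<Sum>i\<in>blockA (2^a * n). v a * v a * (C * real (2^a * n)))"
    by (intro sum_mono mult_left_mono D mult_nonneg_nonneg v0) auto
  \<comment> \<open>The number of points and the growth of D each supply a factor
    \<open>2^a * n\<close>, which cancels one weight: every block contributes
    \<open>C / (Q + 1)^2\<close>, independently of a.\<close>
  also have "\<dots> = (\<Sum>a\<le>Q. (v a * real (2^a * n)) * (v a * real (2^a * n)) * C)"
    by (simp only: sum_constant card_blockA ac_simps)
  also have "\<dots> = C / real (Suc Q)" unfolding vn by simp
  finally have 2: "(\<Sum>z\<in>I. \<Sum>z'\<in>I. wt z * wt z' * (if snd z = snd z' then D (snd z) else 0)) \<le> C / real (Suc Q)" .
  show ?thesis
    using add_mono[OF 1 2] by (simp only: distrib_left sum.distrib)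
qed

subsection \<open>Concentration on intervals\<close>


text \<open>The new density is the product of g with a sum of tents, not a sum of tents weighted by
  \<open>g (c k)\<close>; this keeps the support inside that of g, and uniform continuity makes the
  difference negligible. The energy loses \<open>\<epsilon>/4\<close> four times: equidistribution
  of pairs, replacing points by centres, close pairs, and the diagonal.\<close>

lemma concentrate_on_intervals:
  assumes g: "g \<in> bump01" and \<epsilon>: "0 < \<epsilon>"
  obtains \<rho> K where "continuous_on UNIV \<rho>" "\<And>x. 0 \<le> \<rho> x" "finite K" "K \<subseteq> {N..}"
    "\<And>x. \<rho> x \<noteq> 0 \<Longrightarrow> \<exists>k\<in>K. \<bar>x - c k\<bar> \<le> l k / 4"
    "(\<integral>\<^sup>+ x. ennreal (g x) \<partial>\<Phi>) \<le> (\<integral>\<^sup>+ x. ennreal (g x * \<rho> x) \<partial>lborel) + ennreal \<epsilon>"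
    "log_energy (density lborel (\<lambda>x. ennreal (g x * \<rho> x))) \<le> log_energy (density \<Phi> (\<lambda>x. ennreal (g x))) + ennreal \<epsilon>"
proof -
  have gm[measurable]: "g \<in> borel_measurable borel" by (rule bump01_measurable[OF g])
  have g0: "0 \<le> g x" for x using g by (simp add: bump01_def)
  have gc: "continuous_on A g" for A using g by (auto simp: bump01_def intro: continuous_on_subset)
  obtain G where G: "0 < G" "\<And>x. g x \<le> G" using bump01_bounded[OF g] by blast
  \<comment> \<open>A bump of radius \<open>l i / 4\<close> has self-energy at most
    \<open>G^2 * (lam * i + ln 4 + 8)\<close>. With \<open>i < 2 * (2^a * n)\<close> and
    \<open>2^a * n \<ge> 1\<close> this is at most C times the length of the block.\<close>
  define C where "C = G^2 * (2 * lam + ln 4 + 8)"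
  have C: "0 \<le> C" using lam_pos by (simp add: C_def)
  obtain \<delta>0 where \<delta>0: "0 < \<delta>0" and close: "\<forall>\<^sub>F n in sequentially. \<forall>a\<le>q n. \<forall>b\<le>q n.
      (\<Sum>i\<in>blockA (2^a * n). \<Sum>j\<in>blockA (2^b * n).
         if i \<noteq> j \<and> \<bar>c i - c j\<bar> < \<delta>0 then - ln \<bar>c i - c j\<bar> else 0) \<le> \<epsilon> / (4 * G^2) * real (2^a * n) * real (2^b * n)"
    using close_pairs[of "\<epsilon> / (4 * G^2)"] \<epsilon> G(1) by auto
  \<comment> \<open>Separated pairs are charged as soon as the centres are closer than
    \<open>2 * \<delta>\<close>, which must stay below the threshold of (A2). The bound 1/2 is what
    \<open>bump_pair_energy_separated\<close> requires.\<close>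
  define \<delta> where "\<delta> = min (\<delta>0 / 2) (1 / 2)"
  have \<delta>: "0 < \<delta>" "2 * \<delta> \<le> 1" "\<delta> \<le> 1" "2 * \<delta> \<le> \<delta>0" using \<delta>0 by (auto simp: \<delta>_def)
  define F where "F x y = g x * g y * trunc_log \<delta> x y" for x y
  have F0: "0 \<le> F x y" for x y by (simp add: F_def g0 trunc_log_nonneg \<delta>)
  have Fc: "continuous_on UNIV (\<lambda>p. F (fst p) (snd p))"
    unfolding F_def
    by (intro continuous_intros continuous_on_trunc_log \<delta> continuous_on_compose2[OF gc[of UNIV]]) auto
  define m where "m = (\<integral>x. (\<integral>y. F x y \<partial>\<Phi>) \<partial>\<Phi>)"
  have m0: "0 \<le> m" by (simp add: m_def F0)
  obtain N1 where N1: "\<And>a b. a \<ge> N1 \<Longrightarrow> b \<ge> N1 \<Longrightarrow> \<bar>avg a (\<lambda>x. avg b (F x)) - m\<bar> < \<epsilon> / 4"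
    using avg_double_limit[OF Fc, of "\<epsilon>/4"] \<epsilon> unfolding m_def by auto
  obtain d1 where d1: "0 < d1" "\<And>x x' y y'. x \<in> {0..1} \<Longrightarrow> x' \<in> {0..1} \<Longrightarrow> y \<in> {0..1} \<Longrightarrow> y' \<in> {0..1} \<Longrightarrow>
      \<bar>x - x'\<bar> < d1 \<Longrightarrow> \<bar>y - y'\<bar> < d1 \<Longrightarrow> \<bar>F x y - F x' y'\<bar> < \<epsilon> / 4"
    using uniformly_close_on_square[OF Fc, of "\<epsilon>/4"] \<epsilon> by auto
  \<comment> \<open>Bumps around centres near 0 or 1 may leave the unit interval; their radius is
    less than 1, hence the larger interval.\<close>
  have "uniformly_continuous_on {-1..2} g"
    by (intro compact_uniformly_continuous gc) simp
  then obtain d2 where d2: "0 < d2" "\<And>x y. x \<in> {-1..2} \<Longrightarrow> y \<in> {-1..2} \<Longrightarrow> dist y x < d2 \<Longrightarrow> dist (g y) (g x) < \<epsilon>/2"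
    unfolding uniformly_continuous_on_def using \<epsilon> half_gt_zero by meson
  define M where "M = (\<integral>x. g (clamp01 x) \<partial>\<Phi>)"
  have M0: "0 \<le> M" by (simp add: M_def g0)
  have M_nn: "(\<integral>\<^sup>+ x. ennreal (g x) \<partial>\<Phi>) = ennreal M"
  proof -
    interpret prob_space \<Phi> by (rule prob_\<Phi>)
    have "(\<integral>\<^sup>+ x. ennreal (g x) \<partial>\<Phi>) = (\<integral>\<^sup>+ x. ennreal (g (clamp01 x)) \<partial>\<Phi>)"
      by (intro nn_integral_cong_AE eventually_mono[OF AE_\<Phi>]) (simp only: clamp01_id)
    also have "\<dots> = ennreal M"
      unfolding M_def
      by (intro nn_integral_eq_integral integrable_compose_clamp01[OF sets_\<Phi> finite_measure_axioms gc]) (simp add: g0)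
    finally show ?thesis .
  qed
  have "(\<lambda>n. avg n g) \<longlonglongrightarrow> M" unfolding avg_def M_def by (rule equidist[OF gc])
  from tendstoD[OF this, of "\<epsilon>/2"] \<epsilon> obtain N2 where N2: "\<And>n. n \<ge> N2 \<Longrightarrow> \<bar>avg n g - M\<bar> < \<epsilon> / 2"
    by (auto simp: eventually_sequentially dist_real_def)
  \<comment> \<open>Makes the diagonal contribution \<open>C / (q n + 1)\<close> at most
    \<open>\<epsilon>/4\<close>.\<close>
  obtain Q0 :: nat where Q0: "4 * C / \<epsilon> \<le> real Q0" using real_arch_simple by blast
  have ev_q: "\<forall>\<^sub>F n in sequentially. Q0 \<le> q n" using q_lim by (simp add: filterlim_at_top)
  have ev_l: "\<forall>\<^sub>F n in sequentially. l n < min (min d1 d2) 1"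
    using d1(1) d2(1) by (intro order_tendstoD(2)[OF l_tendsto_0]) auto
  have "\<forall>\<^sub>F n in sequentially. max (max 1 N) (max N1 N2) \<le> n" by (rule eventually_ge_at_top)
  from eventually_happens'[OF sequentially_bot eventually_conj[OF close eventually_conj[OF separated
      eventually_conj[OF ev_q eventually_conj[OF ev_l this]]]]]
  obtain n where cl': "\<forall>a\<le>q n. \<forall>b\<le>q n. (\<Sum>i\<in>blockA (2^a * n). \<Sum>j\<in>blockA (2^b * n).
         if i \<noteq> j \<and> \<bar>c i - c j\<bar> < \<delta>0 then - ln \<bar>c i - c j\<bar> else 0) \<le> \<epsilon> / (4 * G^2) * real (2^a * n) * real (2^b * n)"
    and sep': "\<forall>i\<in>blockAq n (q n). \<forall>j\<in>blockAq n (q n). i \<noteq> j \<longrightarrow> l i + l j < 2 * \<bar>c i - c j\<bar>"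
    and qn: "Q0 \<le> q n" and ln': "l n < min (min d1 d2) 1" and nN': "max (max 1 N) (max N1 N2) \<le> n"
    by (elim exE conjE) (rule that)
  note cl = cl'[rule_format] and sep = sep'[rule_format]
  have ln: "l n < d1" "l n < d2" "l n < 1" using ln' by auto
  have nN: "1 \<le> n" "N \<le> n" "N1 \<le> n" "N2 \<le> n" using nN' by auto
  have n_le: "n \<le> 2^a * n" for a by simp
  \<comment> \<open>Indices carry the number of their block, because the weight depends on it and
    the double sums then split block by block.\<close>
  define I where "I = (SIGMA a:{..q n}. blockA (2^a * n))"
  define wt where "wt z = 1 / (real (Suc (q n)) * real (2 ^ fst z * n))" for z :: "nat \<times> nat"
  have finI: "finite I" by (simp add: I_def)
  have wt0: "0 \<le> wt z" for z by (simp add: wt_def)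
  have I_snd: "snd z \<in> blockAq n (q n)" "n \<le> snd z" if "z \<in> I" for z
  proof -
    show "snd z \<in> blockAq n (q n)" using that by (auto simp: I_def blockAq_def)
    have "2 ^ fst z * n \<le> snd z" using that by (auto simp: I_def blockA_def)
    then show "n \<le> snd z" using n_le le_trans by blast
  qed
  have c_I: "c (snd z) \<in> {0<..<1}" if "z \<in> I" for z
    using c01[of "snd z"] I_snd(2)[OF that] nN(1) by auto
  have l_I: "l (snd z) \<le> l n" if "z \<in> I" for z using I_snd(2)[OF that] by (rule l_antimono)
  define \<rho> where "\<rho> x = (\<Sum>z\<in>I. wt z * tent (l (snd z) / 4) (x - c (snd z)))" for x
  have \<rho>c: "continuous_on UNIV \<rho>"
    unfolding \<rho>_def[abs_def] by (intro continuous_intros)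
  have \<rho>0: "0 \<le> \<rho> x" for x
    unfolding \<rho>_def by (intro sum_nonneg mult_nonneg_nonneg wt0 tent_nonneg)
  have supp: "\<exists>k\<in>snd ` I. \<bar>x - c k\<bar> \<le> l k / 4" if "\<rho> x \<noteq> 0" for x
  proof (rule ccontr)
    assume none: "\<not> (\<exists>k\<in>snd ` I. \<bar>x - c k\<bar> \<le> l k / 4)"
    have "wt z * tent (l (snd z) / 4) (x - c (snd z)) = 0" if "z \<in> I" for z
      using none that by (subst tent_eq_0) force+
    then show False using \<open>\<rho> x \<noteq> 0\<close> unfolding \<rho>_def by (simp add: sum.neutral)
  qed
  have sumI: "(\<Sum>z\<in>I. wt z * f (snd z)) = (\<Sum>a\<le>q n. (\<Sum>i\<in>blockA (2^a * n). f i) / real (2^a * n)) / real (Suc (q n))"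
    for f :: "nat \<Rightarrow> real"
  proof -
    have "(\<Sum>z\<in>I. wt z * f (snd z)) = (\<Sum>a\<le>q n. \<Sum>i\<in>blockA (2^a * n). wt (a, i) * f i)"
      unfolding I_def by (subst sum.Sigma) (auto simp: case_prod_beta')
    also have "\<dots> = (\<Sum>a\<le>q n. (\<Sum>i\<in>blockA (2^a * n). f i) / real (2^a * n) / real (Suc (q n)))"
      by (simp add: wt_def sum_divide_distrib mult.commute)
    finally show ?thesis by (simp only: sum_divide_distrib)
  qed
  have wt1: "(\<Sum>z\<in>I. wt z) = 1"
    using sumI[of "\<lambda>_. 1"] nN(1) by simp
  \<comment> \<open>Half of \<open>\<epsilon>\<close> pays for replacing M by the block averages of
    g, the other half for replacing \<open>g (c k)\<close> by \<open>g x\<close> on the bump, where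
    the total mass 1 of \<open>\<rho>\<close> is used.\<close>
  have mass: "ennreal M \<le> (\<integral>\<^sup>+ x. ennreal (g x * \<rho> x) \<partial>lborel) + ennreal \<epsilon>"
  proof -
    have "M - \<epsilon>/2 \<le> (\<Sum>a\<le>q n. (\<Sum>i\<in>blockA (2^a * n). g (c i)) / real (2^a * n)) / real (Suc (q n))"
    proof -
      have "(\<Sum>a\<le>q n. M - \<epsilon>/2) \<le> (\<Sum>a\<le>q n. avg (2^a * n) g)"
      proof (rule sum_mono)
        fix a
        have "\<bar>avg (2^a * n) g - M\<bar> < \<epsilon>/2" by (rule N2[OF le_trans[OF nN(4) n_le]])
        then show "M - \<epsilon>/2 \<le> avg (2^a * n) g" by linarith
      qed
      then show ?thesis by (simp add: avg_def field_simps del: of_nat_Suc)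
    qed
    also have "\<dots> = (\<Sum>z\<in>I. wt z * g (c (snd z)))" by (rule sumI[symmetric])
    finally have "ennreal M \<le> ennreal ((\<Sum>z\<in>I. wt z * g (c (snd z))) + \<epsilon>/2)"
      by (intro ennreal_leI) linarith
    also have "\<dots> = ennreal (\<Sum>z\<in>I. wt z * g (c (snd z))) + ennreal (\<epsilon>/2)"
      using \<epsilon> by (intro ennreal_plus sum_nonneg mult_nonneg_nonneg wt0 g0) auto
    also have "ennreal (\<Sum>z\<in>I. wt z * g (c (snd z))) =
        (\<integral>\<^sup>+ x. ennreal (\<Sum>z\<in>I. (wt z * g (c (snd z))) * tent (l (snd z) / 4) (x - c (snd z))) \<partial>lborel)"
      by (rule nn_integral_tent_sum[symmetric]) (auto simp: finI wt0 g0 l_pos)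
    also have "\<dots> \<le> (\<integral>\<^sup>+ x. ennreal (g x * \<rho> x) + ennreal (\<epsilon>/2) * ennreal (\<rho> x) \<partial>lborel)"
    proof (rule nn_integral_mono)
      fix x
      have "(\<Sum>z\<in>I. (wt z * g (c (snd z))) * tent (l (snd z) / 4) (x - c (snd z))) \<le>
          (\<Sum>z\<in>I. (g x + \<epsilon>/2) * (wt z * tent (l (snd z) / 4) (x - c (snd z))))"
      proof (rule sum_mono)
        fix z assume z: "z \<in> I"
        show "(wt z * g (c (snd z))) * tent (l (snd z) / 4) (x - c (snd z)) \<le>
            (g x + \<epsilon>/2) * (wt z * tent (l (snd z) / 4) (x - c (snd z)))"
        proof (cases "\<bar>x - c (snd z)\<bar> < l (snd z) / 4")
          case True
          have "\<bar>x - c (snd z)\<bar> < l n" using True l_I[OF z] l_pos[of "snd z"] by argo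
          then have "dist (g (c (snd z))) (g x) < \<epsilon>/2"
            using c_I[OF z] ln by (intro d2(2)) (auto simp: dist_real_def abs_less_iff)
          then have "g (c (snd z)) \<le> g x + \<epsilon>/2" unfolding dist_real_def by linarith
          then have "g (c (snd z)) * (wt z * tent (l (snd z) / 4) (x - c (snd z))) \<le>
            (g x + \<epsilon>/2) * (wt z * tent (l (snd z) / 4) (x - c (snd z)))"
            by (intro mult_right_mono mult_nonneg_nonneg wt0 tent_nonneg)
          then show ?thesis by (simp only: ac_simps)
        qed (simp add: tent_eq_0)
      qed
      also have "\<dots> = g x * \<rho> x + \<epsilon>/2 * \<rho> x"
        unfolding sum_distrib_left[symmetric] \<rho>_def[symmetric] by (rule distrib_right)
      finally show "ennreal (\<Sum>z\<in>I. (wt z * g (c (snd z))) * tent (l (snd z) / 4) (x - c (snd z))) \<le>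
          ennreal (g x * \<rho> x) + ennreal (\<epsilon>/2) * ennreal (\<rho> x)"
        using \<epsilon> by (simp add: ennreal_mult[symmetric] ennreal_plus[symmetric] g0 \<rho>0 ennreal_leI del: ennreal_plus)
    qed
    also have "\<dots> = (\<integral>\<^sup>+ x. ennreal (g x * \<rho> x) \<partial>lborel) + ennreal (\<epsilon>/2) * (\<integral>\<^sup>+ x. ennreal (\<rho> x) \<partial>lborel)"
    proof -
      have [measurable]: "\<rho> \<in> borel_measurable borel" by (rule borel_measurable_continuous_onI[OF \<rho>c])
      show ?thesis by (simp add: nn_integral_add nn_integral_cmult)
    qed
    also have "(\<integral>\<^sup>+ x. ennreal (\<rho> x) \<partial>lborel) = ennreal 1"
      unfolding \<rho>_def wt1[symmetric] by (rule nn_integral_tent_sum) (auto simp: finI wt0 l_pos)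
    also have "(\<integral>\<^sup>+ x. ennreal (g x * \<rho> x) \<partial>lborel) + ennreal (\<epsilon>/2) * ennreal 1 + ennreal (\<epsilon>/2) =
        (\<integral>\<^sup>+ x. ennreal (g x * \<rho> x) \<partial>lborel) + ennreal \<epsilon>"
      using \<epsilon> by (simp add: add.assoc ennreal_plus[symmetric] del: ennreal_plus)
    finally show ?thesis by (simp add: add_right_mono)
  qed
  \<comment> \<open>\<open>B\<close> bounds the mutual energy of distinct bumps, its
    \<open>\<epsilon>/4\<close> being the oscillation of F. It is kept for \<open>i = j\<close> too,
    since block averages of F include the diagonal; \<open>D\<close> is added there for the
    self-energy.\<close>
  define \<eta> where "\<eta> i j = (if i \<noteq> j \<and> \<bar>c i - c j\<bar> < \<delta>0 then - ln \<bar>c i - c j\<bar> else 0)" for i j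
  define D where "D i = G^2 * (lam * real i + ln 4 + 8)" for i :: nat
  define B where "B i j = F (c i) (c j) + \<epsilon>/4 + G^2 * \<eta> i j" for i j
  have D0: "0 \<le> D i" for i using lam_pos by (simp add: D_def)
  have \<eta>0: "0 \<le> \<eta> (snd z) (snd z')" if "z \<in> I" "z' \<in> I" for z z'
  proof -
    have "\<bar>c (snd z) - c (snd z')\<bar> \<le> 1" using c_I[OF that(1)] c_I[OF that(2)] by auto
    then show ?thesis using ln_le_zero_iff[of "\<bar>c (snd z) - c (snd z')\<bar>"]
      by (cases "c (snd z) = c (snd z')") (auto simp: \<eta>_def)
  qed
  have B0: "0 \<le> B (snd z) (snd z')" if "z \<in> I" "z' \<in> I" for z z'
    using \<eta>0[OF that] F0 \<epsilon> by (simp add: B_def)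
  have J: "(\<integral>\<^sup>+ t. ennreal (g t * tent (l (snd z') / 4) (t - c (snd z'))) *
        (\<integral>\<^sup>+ s. ennreal (g s * tent (l (snd z) / 4) (s - c (snd z))) * logker s t \<partial>lborel) \<partial>lborel)
      \<le> ennreal (B (snd z) (snd z') + (if snd z = snd z' then D (snd z) else 0))"
    if z: "z \<in> I" "z' \<in> I" for z z'
  proof (cases "snd z = snd z'")
    case True
    have "(\<integral>\<^sup>+ t. ennreal (g t * tent (l (snd z') / 4) (t - c (snd z'))) *
        (\<integral>\<^sup>+ s. ennreal (g s * tent (l (snd z) / 4) (s - c (snd z))) * logker s t \<partial>lborel) \<partial>lborel)
      \<le> ennreal (G^2 * (- ln (l (snd z) / 4) + 8))"
      using l_I[OF z(1)] ln(3) by (intro bump_pair_energy_diagonal g G) (auto simp: l_pos)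
    also have "- ln (l (snd z) / 4) = lam * real (snd z) + ln 4"
      by (subst ln_div) (auto simp: l_eq)
    finally have "(\<integral>\<^sup>+ t. ennreal (g t * tent (l (snd z') / 4) (t - c (snd z'))) *
        (\<integral>\<^sup>+ s. ennreal (g s * tent (l (snd z) / 4) (s - c (snd z))) * logker s t \<partial>lborel) \<partial>lborel) \<le> ennreal (D (snd z))"
      by (simp only: D_def)
    also have "\<dots> \<le> ennreal (B (snd z) (snd z') + (if snd z = snd z' then D (snd z) else 0))"
      using True B0[OF z] by (intro ennreal_leI) simp
    finally show ?thesis .
  next
    case False
    let ?R = "(F (c (snd z)) (c (snd z')) + \<epsilon>/4) + G^2 * (if \<bar>c (snd z) - c (snd z')\<bar> < 2 * \<delta> then - ln \<bar>c (snd z) - c (snd z')\<bar> else 0)"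
    have lsep: "l (snd z) + l (snd z') < 2 * \<bar>c (snd z) - c (snd z')\<bar>"
      by (rule sep[OF I_snd(1)[OF z(1)] I_snd(1)[OF z(2)] False])
    have "(\<integral>\<^sup>+ t. ennreal (g t * tent (l (snd z') / 4) (t - c (snd z'))) *
        (\<integral>\<^sup>+ s. ennreal (g s * tent (l (snd z) / 4) (s - c (snd z))) * logker s t \<partial>lborel) \<partial>lborel) \<le> ennreal ?R"
    proof (rule bump_pair_energy_separated[OF g G(2) _ _ _ \<delta>(1,2)])
      show "0 < l (snd z) / 4" "0 < l (snd z') / 4" by (simp_all add: l_pos)
      show "2 * (l (snd z) / 4 + l (snd z') / 4) \<le> \<bar>c (snd z) - c (snd z')\<bar>" using lsep by argo
      show "0 \<le> F (c (snd z)) (c (snd z')) + \<epsilon>/4" using F0 \<epsilon> by simp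
      fix s t :: real
      assume st: "s \<in> {0..1}" "t \<in> {0..1}" "\<bar>s - c (snd z)\<bar> < l (snd z) / 4" "\<bar>t - c (snd z')\<bar> < l (snd z') / 4"
      have "\<bar>s - c (snd z)\<bar> < d1" using st(3) l_I[OF z(1)] ln(1) l_pos[of "snd z"] by argo
      moreover have "\<bar>t - c (snd z')\<bar> < d1" using st(4) l_I[OF z(2)] ln(1) l_pos[of "snd z'"] by argo
      ultimately have "\<bar>F s t - F (c (snd z)) (c (snd z'))\<bar> < \<epsilon>/4"
        using c_I[OF z(1)] c_I[OF z(2)] st(1,2) by (intro d1(2)) auto
      then show "g s * g t * trunc_log \<delta> s t \<le> F (c (snd z)) (c (snd z')) + \<epsilon>/4"
        unfolding F_def[symmetric] by linarith
    qed
    also have "?R \<le> B (snd z) (snd z')"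
      using \<eta>0[OF z] False \<delta>(4) unfolding B_def \<eta>_def by (intro add_left_mono mult_left_mono) auto
    finally show ?thesis using False by (simp add: ennreal_leI)
  qed
  have "log_energy (density lborel (\<lambda>x. ennreal (g x * \<rho> x))) \<le>
      ennreal (\<Sum>z\<in>I. \<Sum>z'\<in>I. wt z * wt z' * (B (snd z) (snd z') + (if snd z = snd z' then D (snd z) else 0)))"
    unfolding \<rho>_def
  proof (rule bump_sum_energy_le[OF finI g wt0])
    show "0 \<le> B (snd z) (snd z') + (if snd z = snd z' then D (snd z) else 0)" if "z \<in> I" "z' \<in> I" for z z'
      using B0[OF that] D0 by simp
  qed (rule J)
  also have "(\<Sum>z\<in>I. \<Sum>z'\<in>I. wt z * wt z' * (B (snd z) (snd z') + (if snd z = snd z' then D (snd z) else 0)))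
      \<le> (m + \<epsilon>/4 + \<epsilon>/4 + \<epsilon>/4) + C / real (Suc (q n))"
  proof (rule block_energy_sum_le[OF nN(1) C I_def wt_def])
    fix a i assume "a \<le> q n" "i \<in> blockA (2^a * n)"
    then have i: "real i \<le> 2 * real (2^a * n)"
      unfolding blockA_def by (simp flip: of_nat_mult of_nat_power)
    have one: "1 \<le> real (2^a * n)" using nN(1) n_le[of a] by linarith
    have "lam * real i \<le> lam * (2 * real (2^a * n))" using i lam_pos by (intro mult_left_mono) auto
    moreover have "(ln 4 + 8) * 1 \<le> (ln 4 + 8) * real (2^a * n)" using one by (intro mult_left_mono) auto
    ultimately have "lam * real i + ln 4 + 8 \<le> (2 * lam + ln 4 + 8) * real (2^a * n)"
      unfolding distrib_right by linarith
    then show "D i \<le> C * real (2^a * n)"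
      unfolding D_def C_def mult.assoc by (intro mult_left_mono) auto
  next
    fix a b assume ab: "a \<le> q n" "b \<le> q n"
    let ?a = "real (2^a * n)" and ?b = "real (2^b * n)"
    have pos: "0 < ?a" "0 < ?b" using nN(1) by auto
    have "\<bar>avg (2^a * n) (\<lambda>x. avg (2^b * n) (F x)) - m\<bar> < \<epsilon>/4"
      by (rule N1[OF le_trans[OF nN(3) n_le] le_trans[OF nN(3) n_le]])
    then have "(\<Sum>i\<in>blockA (2^a * n). \<Sum>j\<in>blockA (2^b * n). F (c i) (c j)) / (?a * ?b) \<le> m + \<epsilon>/4"
      unfolding avg_avg by linarith
    then have 1: "(\<Sum>i\<in>blockA (2^a * n). \<Sum>j\<in>blockA (2^b * n). F (c i) (c j)) \<le> ?a * ?b * (m + \<epsilon>/4)"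
      using pos by (simp only: divide_le_eq mult_pos_pos if_True mult.commute)
    have "G^2 * (\<Sum>i\<in>blockA (2^a * n). \<Sum>j\<in>blockA (2^b * n). \<eta> i j) \<le> G^2 * (\<epsilon> / (4 * G^2) * ?a * ?b)"
      unfolding \<eta>_def by (intro mult_left_mono cl ab) auto
    also have "\<dots> = ?a * ?b * (\<epsilon>/4)" using G(1) by (simp add: field_simps)
    finally have 2: "G^2 * (\<Sum>i\<in>blockA (2^a * n). \<Sum>j\<in>blockA (2^b * n). \<eta> i j) \<le> ?a * ?b * (\<epsilon>/4)" .
    have "(\<Sum>i\<in>blockA (2^a * n). \<Sum>j\<in>blockA (2^b * n). B i j) =
        (\<Sum>i\<in>blockA (2^a * n). \<Sum>j\<in>blockA (2^b * n). F (c i) (c j)) + ?a * ?b * (\<epsilon>/4) +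
        G^2 * (\<Sum>i\<in>blockA (2^a * n). \<Sum>j\<in>blockA (2^b * n). \<eta> i j)"
      unfolding B_def sum.distrib by (simp add: sum_distrib_left)
    also have "\<dots> \<le> ?a * ?b * (m + \<epsilon>/4) + ?a * ?b * (\<epsilon>/4) + ?a * ?b * (\<epsilon>/4)"
      by (intro add_mono 1 2 order_refl)
    finally show "(\<Sum>i\<in>blockA (2^a * n). \<Sum>j\<in>blockA (2^b * n). B i j) \<le> ?a * ?b * (m + \<epsilon>/4 + \<epsilon>/4 + \<epsilon>/4)"
      by (simp only: distrib_left)
  qed
  also have "C / real (Suc (q n)) \<le> \<epsilon>/4"
  proof -
    have "4 * C / \<epsilon> \<le> real (Suc (q n))" using Q0 qn by linarith
    then show ?thesis using \<epsilon> by (simp add: field_simps del: of_nat_Suc)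
  qed
  finally have "log_energy (density lborel (\<lambda>x. ennreal (g x * \<rho> x))) \<le> ennreal (m + \<epsilon>)"
    by (simp add: ennreal_leI add.commute)
  also have "\<dots> = ennreal m + ennreal \<epsilon>" using m0 \<epsilon> by simp
  also have "\<dots> \<le> log_energy (density \<Phi> (\<lambda>x. ennreal (g x))) + ennreal \<epsilon>"
    unfolding m_def F_def by (intro add_right_mono truncated_energy_le g \<delta>)
  finally have energy: "log_energy (density lborel (\<lambda>x. ennreal (g x * \<rho> x))) \<le>
      log_energy (density \<Phi> (\<lambda>x. ennreal (g x))) + ennreal \<epsilon>" .
  have "snd ` I \<subseteq> {N..}" using I_snd(2) nN(2) by force
  then show thesis
    using that[of \<rho> "snd ` I"] \<rho>c \<rho>0 finI supp mass energy unfolding M_nn by blast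
qed

end

section \<open>Renormalization and iteration of the concentration step\<close>

lemma exists_small_perturbation:
  fixes X \<epsilon> :: real
  assumes "0 < \<epsilon>"
  obtains t where "0 < t" "t < 1" "(X + t) / (1 - t)^2 \<le> X + \<epsilon>"
proof -
  have "((\<lambda>t. (X + t) / (1 - t)^2) \<longlongrightarrow> (X + 0) / (1 - 0)^2) (at_right 0)"
    by (intro tendsto_intros) auto
  then have "\<forall>\<^sub>F t in at_right 0. (X + t) / (1 - t)^2 < X + \<epsilon>"
    using assms by (elim order_tendstoD(2)) simp
  moreover have "\<forall>\<^sub>F t in at_right 0. t \<in> {0<..<1::real}"
    by (rule eventually_at_right_real) simp
  ultimately have "\<forall>\<^sub>F t in at_right 0. (X + t) / (1 - t)^2 < X + \<epsilon> \<and> t \<in> {0<..<1}"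
    by (rule eventually_conj)
  from eventually_happens'[OF _ this] show thesis using that by (auto simp: less_imp_le)
qed

context log_point_system
begin

text \<open>Energy is quadratic, so dividing by the mass M divides it by \<open>M^2\<close>, and
  \<open>M \<ge> 1 - t\<close> yields the quotient \<open>(X + t) / (1 - t)^2\<close>. This covers
  \<open>M > 1\<close> as well, where the division only lowers the energy.\<close>

lemma normalize_density:
  assumes h: "h \<in> bump01" and t: "0 < t" "t < 1" and X: "0 \<le> X" and Y: "(X + t) / (1 - t)^2 \<le> Y"
    and mass: "1 \<le> (\<integral>\<^sup>+ x. ennreal (h x) \<partial>\<Phi>) + ennreal t"
    and energy: "log_energy (density \<Phi> (\<lambda>x. ennreal (h x))) \<le> ennreal (X + t)"
  obtains a where "0 < a" "(\<lambda>x. h x * a) \<in> bump01" "(\<integral>\<^sup>+ x. ennreal (h x * a) \<partial>\<Phi>) = 1"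
    "log_energy (density \<Phi> (\<lambda>x. ennreal (h x * a))) \<le> ennreal Y"
proof -
  have hm[measurable]: "h \<in> borel_measurable borel" by (rule bump01_measurable[OF h])
  have h0: "0 \<le> h x" for x using h by (simp add: bump01_def)
  obtain G where G: "0 < G" "\<And>x. h x \<le> G" using bump01_bounded[OF h] by blast
  interpret prob_space \<Phi> by (rule prob_\<Phi>)
  have "(\<integral>\<^sup>+ x. ennreal (h x) \<partial>\<Phi>) \<le> (\<integral>\<^sup>+ x. ennreal G \<partial>\<Phi>)"
    by (intro nn_integral_mono ennreal_leI G)
  also have "\<dots> < \<infinity>" by (simp add: emeasure_space_1)
  finally obtain M where M: "0 \<le> M" "(\<integral>\<^sup>+ x. ennreal (h x) \<partial>\<Phi>) = ennreal M"
    by (cases "\<integral>\<^sup>+ x. ennreal (h x) \<partial>\<Phi>") auto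
  have "ennreal 1 \<le> ennreal (M + t)" using mass M t by simp
  then have Mt: "1 - t \<le> M" using M t by (subst (asm) ennreal_le_iff) auto
  then have M_pos: "0 < M" using t by linarith
  define a where "a = 1 / M"
  have a: "0 < a" using M_pos by (simp add: a_def)
  have ha: "ennreal (h x * a) = ennreal a * ennreal (h x)" for x
    using a h0 by (simp add: ennreal_mult[symmetric] mult.commute)
  have "(\<integral>\<^sup>+ x. ennreal (h x * a) \<partial>\<Phi>) = ennreal a * ennreal M"
    unfolding ha M(2)[symmetric] by (intro nn_integral_cmult) measurable
  also have "\<dots> = 1" using M_pos by (simp add: ennreal_mult[symmetric] a_def)
  finally have 1: "(\<integral>\<^sup>+ x. ennreal (h x * a) \<partial>\<Phi>) = 1" .
  have "log_energy (density \<Phi> (\<lambda>x. ennreal (h x * a))) = ennreal a ^ 2 * log_energy (density \<Phi> (\<lambda>x. ennreal (h x)))"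
    unfolding ha by (rule log_energy_density_const[OF sets_\<Phi> _ sigma_finite_\<Phi>]) measurable
  also have "\<dots> \<le> ennreal a ^ 2 * ennreal (X + t)" by (intro mult_left_mono energy) simp
  also have "\<dots> = ennreal (a^2 * (X + t))" using a X t by (simp add: ennreal_power ennreal_mult)
  also have "a^2 * (X + t) \<le> (X + t) / (1 - t)^2"
  proof -
    have "(1 - t)^2 \<le> M^2" using Mt t by (intro power_mono) auto
    then have "(X + t) / M^2 \<le> (X + t) / (1 - t)^2"
      using X t M_pos by (intro divide_left_mono mult_pos_pos) auto
    then show ?thesis by (simp add: a_def power_one_over field_simps)
  qed
  also note Y
  finally have 2: "log_energy (density \<Phi> (\<lambda>x. ennreal (h x * a))) \<le> ennreal Y" by (simp add: ennreal_leI)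
  have "(\<lambda>x. h x * a) \<in> bump01" using a by (intro bump01_mult h) auto
  with a 1 2 show thesis by (intro that)
qed

text \<open>Closes the loop: concentration consumes a density with respect to \<open>\<Phi>\<close>
  and returns one with respect to Lebesgue measure. Half of t is reserved for errors already made,
  half for the conversion.\<close>

lemma density_to_weight:
  assumes p: "p \<in> bump01" and X: "0 \<le> X" and Y: "(X + t) / (1 - t)^2 \<le> Y" and t: "0 < t" "t < 1"
    and mass: "1 \<le> (\<integral>\<^sup>+ x. ennreal (p x) \<partial>lborel) + ennreal (t/2)"
    and energy: "log_energy (density lborel (\<lambda>x. ennreal (p x))) \<le> ennreal (X + t/2)"
  obtains g where "g \<in> bump01" "(\<integral>\<^sup>+ x. ennreal (g x) \<partial>\<Phi>) = 1"
    "log_energy (density \<Phi> (\<lambda>x. ennreal (g x))) \<le> ennreal Y" "\<And>x. g x \<noteq> 0 \<Longrightarrow> p x \<noteq> 0"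
proof -
  have half: "ennreal (t/2) + ennreal (t/2) = ennreal t"
    using t by (simp add: ennreal_plus[symmetric] del: ennreal_plus)
  obtain \<psi> where \<psi>: "continuous_on UNIV \<psi>" "\<And>x. 0 \<le> \<psi> x"
    "(\<integral>\<^sup>+ x. ennreal (p x) \<partial>lborel) \<le> (\<integral>\<^sup>+ x. ennreal (p x * \<psi> x) \<partial>\<Phi>) + ennreal (t/2)"
    "log_energy (density \<Phi> (\<lambda>x. ennreal (p x * \<psi> x))) \<le> log_energy (density lborel (\<lambda>x. ennreal (p x))) + ennreal (t/2)"
    using approx_density_by_multiple[OF w_measurable w_nonneg w_pos _ _ p, of "t/2"]
      log_energy_\<Phi>_finite w_int t unfolding \<Phi>_def by auto
  have "(\<lambda>x. p x * \<psi> x) \<in> bump01" by (intro bump01_mult p \<psi>)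
  moreover have "1 \<le> (\<integral>\<^sup>+ x. ennreal (p x * \<psi> x) \<partial>\<Phi>) + ennreal t"
    using order_trans[OF mass add_right_mono[OF \<psi>(3)]] by (simp add: add.assoc half)
  moreover have "log_energy (density \<Phi> (\<lambda>x. ennreal (p x * \<psi> x))) \<le> ennreal (X + t)"
  proof -
    have "log_energy (density \<Phi> (\<lambda>x. ennreal (p x * \<psi> x))) \<le> ennreal (X + t/2) + ennreal (t/2)"
      by (rule order_trans[OF \<psi>(4) add_right_mono[OF energy]])
    also have "\<dots> = ennreal (X + t)" using X t by (simp add: ennreal_plus[symmetric] del: ennreal_plus)
    finally show ?thesis .
  qed
  ultimately obtain a where "0 < a" "(\<lambda>x. p x * \<psi> x * a) \<in> bump01" "(\<integral>\<^sup>+ x. ennreal (p x * \<psi> x * a) \<partial>\<Phi>) = 1"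
    "log_energy (density \<Phi> (\<lambda>x. ennreal (p x * \<psi> x * a))) \<le> ennreal Y"
    using normalize_density[OF _ t X Y] by blast
  then show thesis by (intro that[of "\<lambda>x. p x * \<psi> x * a"]) auto
qed

lemma initial_density:
  fixes \<mu> :: "real measure"
  assumes "sets \<mu> = sets borel" "prob_space \<mu>" "AE x in \<mu>. x \<in> {0..1}"
    and X: "log_energy \<mu> \<le> ennreal X" "0 \<le> X" and \<epsilon>: "0 < \<epsilon>"
  obtains g where "g \<in> bump01" "(\<integral>\<^sup>+ x. ennreal (g x) \<partial>\<Phi>) = 1"
    "log_energy (density \<Phi> (\<lambda>x. ennreal (g x))) \<le> ennreal (X + \<epsilon>)"
proof -
  obtain t where t: "0 < t" "t < 1" "(X + t) / (1 - t)^2 \<le> X + \<epsilon>"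
    by (rule exists_small_perturbation[OF \<epsilon>])
  have "log_energy \<mu> < \<infinity>" using X by (simp add: le_less_trans[OF _ ennreal_less_top])
  then obtain p where p: "p \<in> bump01" "(\<integral>\<^sup>+ s. ennreal (p s) \<partial>lborel) = 1"
    "log_energy (density lborel (\<lambda>s. ennreal (p s))) \<le> log_energy \<mu> + ennreal (t/2)"
    using approx_measure_by_density[OF assms(1-3), of "t/2"] t(1) by auto
  have "log_energy (density lborel (\<lambda>s. ennreal (p s))) \<le> ennreal (X + t/2)"
    using order_trans[OF p(3) add_right_mono[OF X(1)]] X(2) t(1) by simp
  then show thesis
    using density_to_weight[OF p(1) X(2) t(3,1,2)] p(2) that by auto
qed

lemma refine_density:
  assumes g: "g \<in> bump01" "(\<integral>\<^sup>+ x. ennreal (g x) \<partial>\<Phi>) = 1"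
    and X: "log_energy (density \<Phi> (\<lambda>x. ennreal (g x))) \<le> ennreal X" "0 \<le> X" and \<epsilon>: "0 < \<epsilon>"
  obtains h K where "h \<in> bump01" "(\<integral>\<^sup>+ x. ennreal (h x) \<partial>\<Phi>) = 1"
    "log_energy (density \<Phi> (\<lambda>x. ennreal (h x))) \<le> ennreal (X + \<epsilon>)"
    "finite K" "K \<subseteq> {N..}" "\<And>x. h x \<noteq> 0 \<Longrightarrow> g x \<noteq> 0 \<and> (\<exists>k\<in>K. \<bar>x - c k\<bar> \<le> l k / 4)"
proof -
  obtain t where t: "0 < t" "t < 1" "(X + t) / (1 - t)^2 \<le> X + \<epsilon>"
    by (rule exists_small_perturbation[OF \<epsilon>])
  have t2: "0 < t/2" using t by simp
  obtain \<rho> K where \<rho>: "continuous_on UNIV \<rho>" "\<And>x. 0 \<le> \<rho> x" and K: "finite K" "K \<subseteq> {N..}"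
    and supp: "\<And>x. \<rho> x \<noteq> 0 \<Longrightarrow> \<exists>k\<in>K. \<bar>x - c k\<bar> \<le> l k / 4"
    and mass: "(\<integral>\<^sup>+ x. ennreal (g x) \<partial>\<Phi>) \<le> (\<integral>\<^sup>+ x. ennreal (g x * \<rho> x) \<partial>lborel) + ennreal (t/2)"
    and energy: "log_energy (density lborel (\<lambda>x. ennreal (g x * \<rho> x))) \<le> log_energy (density \<Phi> (\<lambda>x. ennreal (g x))) + ennreal (t/2)"
    by (rule concentrate_on_intervals[OF g(1) t2, where N = N]) (rule that)
  have "(\<lambda>x. g x * \<rho> x) \<in> bump01" by (intro bump01_mult g \<rho>)
  moreover have "1 \<le> (\<integral>\<^sup>+ x. ennreal (g x * \<rho> x) \<partial>lborel) + ennreal (t/2)" using mass g(2) by simp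
  moreover have "log_energy (density lborel (\<lambda>x. ennreal (g x * \<rho> x))) \<le> ennreal (X + t/2)"
    using order_trans[OF energy add_right_mono[OF X(1)]] X(2) t(1) by simp
  ultimately obtain h where h: "h \<in> bump01" "(\<integral>\<^sup>+ x. ennreal (h x) \<partial>\<Phi>) = 1"
    "log_energy (density \<Phi> (\<lambda>x. ennreal (h x))) \<le> ennreal (X + \<epsilon>)" "\<And>x. h x \<noteq> 0 \<Longrightarrow> g x * \<rho> x \<noteq> 0"
    using density_to_weight[OF _ X(2) t(3,1,2)] by blast
  show thesis by (rule that[OF h(1-3) K]) (use h(4) supp in auto)
qed

text \<open>Step n may spend \<open>\<epsilon> * (1/2)^Suc n\<close>, so the energy after n steps
  exceeds X by at most \<open>\<epsilon> * (1 - (1/2)^n)\<close>. The invariant has to contain this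
  partial sum, not just the final bound.\<close>

lemma refining_sequence:
  assumes g: "g \<in> bump01" "(\<integral>\<^sup>+ x. ennreal (g x) \<partial>\<Phi>) = 1"
    and X: "log_energy (density \<Phi> (\<lambda>x. ennreal (g x))) \<le> ennreal X" "0 \<le> X" and \<epsilon>: "0 < \<epsilon>"
  obtains u :: "nat \<Rightarrow> real \<Rightarrow> real" and K :: "nat \<Rightarrow> nat set"
  where "\<And>n. u n \<in> bump01" "\<And>n. (\<integral>\<^sup>+ x. ennreal (u n x) \<partial>\<Phi>) = 1"
    "\<And>n. log_energy (density \<Phi> (\<lambda>x. ennreal (u n x))) \<le> ennreal (X + \<epsilon>)"
    "\<And>n x. u (Suc n) x \<noteq> 0 \<Longrightarrow> u n x \<noteq> 0"
    "\<And>n. finite (K n)" "\<And>n. K n \<subseteq> {Suc n..}"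
    "\<And>n x. u (Suc n) x \<noteq> 0 \<Longrightarrow> \<exists>k\<in>K n. \<bar>x - c k\<bar> \<le> l k / 4"
proof -
  define P where "P n h \<longleftrightarrow> h \<in> bump01 \<and> (\<integral>\<^sup>+ x. ennreal (h x) \<partial>\<Phi>) = 1 \<and>
    log_energy (density \<Phi> (\<lambda>x. ennreal (h x))) \<le> ennreal (X + \<epsilon> * (1 - (1/2)^n))" for n :: nat and h
  define R where "R n h h' \<longleftrightarrow> (\<exists>K. finite K \<and> K \<subseteq> {Suc n..} \<and>
    (\<forall>x. h' x \<noteq> 0 \<longrightarrow> h x \<noteq> 0 \<and> (\<exists>k\<in>K. \<bar>x - c k\<bar> \<le> l k / 4)))" for n :: nat and h h' :: "real \<Rightarrow> real"
  have "\<exists>u. \<forall>n. P n (u n) \<and> R n (u n) (u (Suc n))"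
  proof (rule dependent_nat_choice)
    show "\<exists>h. P 0 h" using g X by (auto simp: P_def)
    fix h n assume "P n h"
    then have h1: "h \<in> bump01" and h2: "(\<integral>\<^sup>+ x. ennreal (h x) \<partial>\<Phi>) = 1"
      and h3: "log_energy (density \<Phi> (\<lambda>x. ennreal (h x))) \<le> ennreal (X + \<epsilon> * (1 - (1/2)^n))"
      by (simp_all add: P_def)
    have nn: "0 \<le> X + \<epsilon> * (1 - (1/2)^n)"
      using X \<epsilon> by (intro add_nonneg_nonneg mult_nonneg_nonneg) (auto simp: power_le_one)
    have eq: "X + \<epsilon> * (1 - (1/2)^n) + \<epsilon> * (1/2)^Suc n = X + \<epsilon> * (1 - (1/2)^Suc n)"
      by (simp add: field_simps)
    have e: "0 < \<epsilon> * (1/2)^Suc n" using \<epsilon> by simp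
    obtain h' K where "h' \<in> bump01" "(\<integral>\<^sup>+ x. ennreal (h' x) \<partial>\<Phi>) = 1"
      "log_energy (density \<Phi> (\<lambda>x. ennreal (h' x))) \<le> ennreal (X + \<epsilon> * (1 - (1/2)^n) + \<epsilon> * (1/2)^Suc n)"
      "finite K" "K \<subseteq> {Suc n..}" "\<And>x. h' x \<noteq> 0 \<Longrightarrow> h x \<noteq> 0 \<and> (\<exists>k\<in>K. \<bar>x - c k\<bar> \<le> l k / 4)"
      by (rule refine_density[OF h1 h2 h3 nn e, where N = "Suc n"]) (rule that)
    then have "P (Suc n) h'" "R n h h'" unfolding P_def R_def eq by blast+
    then show "\<exists>h'. P (Suc n) h' \<and> R n h h'" by blast
  qed
  then obtain u where u: "\<And>n. P n (u n)" "\<And>n. R n (u n) (u (Suc n))" by blast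
  then obtain K where K: "\<And>n. finite (K n) \<and> K n \<subseteq> {Suc n..} \<and>
    (\<forall>x. u (Suc n) x \<noteq> 0 \<longrightarrow> u n x \<noteq> 0 \<and> (\<exists>k\<in>K n. \<bar>x - c k\<bar> \<le> l k / 4))"
    unfolding R_def by metis
  show thesis
  proof (rule that[of u K])
    fix n
    have "log_energy (density \<Phi> (\<lambda>x. ennreal (u n x))) \<le> ennreal (X + \<epsilon> * (1 - (1/2)^n))"
      using u(1)[of n] by (simp add: P_def)
    also have "\<dots> \<le> ennreal (X + \<epsilon>)"
      using \<epsilon> by (intro ennreal_leI add_left_mono) (simp add: mult_le_cancel_left1)
    finally show "log_energy (density \<Phi> (\<lambda>x. ennreal (u n x))) \<le> ennreal (X + \<epsilon>)" .
  qed (use u(1) K in \<open>auto simp: P_def\<close>)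
qed

end

subsection \<open>Transfer to the plane and weak limits\<close>

lemma logker_pos_of_real:
  "logker_pos (complex_of_real x) (complex_of_real y) = logker x y"
  by (simp add: logker_pos_def logker_def norm_of_real flip: of_real_diff)

text \<open>Distances within the unit interval do not exceed 1. Hence the subtracted integral in
  \<open>interaction\<close> vanishes for measures on it, and infinity minus infinity cannot
  occur.\<close>

lemma logker_neg_of_real:
  assumes "x \<in> {0..1}" "y \<in> {0..1}"
  shows "logker_neg (complex_of_real x) (complex_of_real y) = 0"
proof (cases "x = y")
  case False
  then have "ln \<bar>x - y\<bar> \<le> 0" using assms by (subst ln_le_zero_iff) auto
  then show ?thesis by (simp add: logker_neg_def norm_of_real flip: of_real_diff)
qed (simp add: logker_neg_def)

text \<open>\<open>Re\<close> is an isometry on the segment that carries the measure, so the kernel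
  is unchanged by the projection.\<close>

lemma energy_eq_log_energy:
  assumes sets: "sets \<mu> = sets borel" and pr: "prob_space \<mu>"
    and supp: "AE z in \<mu>. z \<in> complex_of_real ` {0..1}"
  shows "energy \<mu> = enn2ereal (log_energy (distr \<mu> borel Re))"
proof -
  note [measurable_cong] = sets
  have nu: "prob_space (distr \<mu> borel Re)" by (rule prob_space.prob_space_distr[OF pr]) simp
  then have sf: "sigma_finite_measure (distr \<mu> borel Re)" by (simp add: prob_space_def finite_measure_def)
  have "(\<integral>\<^sup>+ w. (\<integral>\<^sup>+ z. logker_pos z w \<partial>\<mu>) \<partial>\<mu>) = (\<integral>\<^sup>+ w. (\<integral>\<^sup>+ z. logker (Re z) (Re w) \<partial>\<mu>) \<partial>\<mu>)"
  proof (rule nn_integral_cong_AE, rule eventually_mono[OF supp])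
    fix w :: complex assume w: "w \<in> complex_of_real ` {0..1}"
    show "(\<integral>\<^sup>+ z. logker_pos z w \<partial>\<mu>) = (\<integral>\<^sup>+ z. logker (Re z) (Re w) \<partial>\<mu>)"
    proof (rule nn_integral_cong_AE, rule eventually_mono[OF supp])
      fix z :: complex assume "z \<in> complex_of_real ` {0..1}"
      then show "logker_pos z w = logker (Re z) (Re w)"
        using w by (auto simp: logker_pos_of_real)
    qed
  qed
  also have "\<dots> = (\<integral>\<^sup>+ w. (\<integral>\<^sup>+ x. logker x (Re w) \<partial>distr \<mu> borel Re) \<partial>\<mu>)"
    by (intro nn_integral_cong nn_integral_distr[symmetric]) auto
  also have "\<dots> = (\<integral>\<^sup>+ y. (\<integral>\<^sup>+ x. logker x y \<partial>distr \<mu> borel Re) \<partial>distr \<mu> borel Re)"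
  proof -
    have "(\<lambda>y. \<integral>\<^sup>+ x. logker x y \<partial>distr \<mu> borel Re) \<in> borel_measurable borel"
      by (rule measurable_inner_nn_integral[OF _ sf]) auto
    moreover have "Re \<in> measurable \<mu> borel" by measurable
    ultimately show ?thesis by (intro nn_integral_distr[symmetric]) auto
  qed
  finally have 1: "(\<integral>\<^sup>+ w. (\<integral>\<^sup>+ z. logker_pos z w \<partial>\<mu>) \<partial>\<mu>) = log_energy (distr \<mu> borel Re)"
    by (simp only: log_energy_def)
  have "(\<integral>\<^sup>+ w. (\<integral>\<^sup>+ z. logker_neg z w \<partial>\<mu>) \<partial>\<mu>) = (\<integral>\<^sup>+ w. (\<integral>\<^sup>+ z. 0 \<partial>\<mu>) \<partial>\<mu>)"
  proof (rule nn_integral_cong_AE, rule eventually_mono[OF supp])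
    fix w :: complex assume w: "w \<in> complex_of_real ` {0..1}"
    show "(\<integral>\<^sup>+ z. logker_neg z w \<partial>\<mu>) = (\<integral>\<^sup>+ z. 0 \<partial>\<mu>)"
    proof (rule nn_integral_cong_AE, rule eventually_mono[OF supp])
      fix z :: complex assume "z \<in> complex_of_real ` {0..1}"
      then show "logker_neg z w = 0"
        using w logker_neg_of_real by auto
    qed
  qed
  then show ?thesis unfolding energy_def interaction_def 1 by (simp add: zero_ennreal.rep_eq)
qed

lemma admissible_of_real:
  assumes sets: "sets \<nu> = sets borel" and pr: "prob_space \<nu>"
    and K: "compact K" "K \<subseteq> E" "AE x in \<nu>. x \<in> K" and E: "E \<subseteq> {0..1}"
  shows "distr \<nu> borel complex_of_real \<in> admissible (complex_of_real ` E)"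
    and "energy (distr \<nu> borel complex_of_real) = enn2ereal (log_energy \<nu>)"
proof -
  have [measurable_cong]: "sets \<nu> = sets borel" by (rule sets)
  have m: "complex_of_real \<in> measurable \<nu> borel" by measurable
  have pr': "prob_space (distr \<nu> borel complex_of_real)"
    by (rule prob_space.prob_space_distr[OF pr m])
  have cK: "compact (complex_of_real ` K)"
    by (intro compact_continuous_image K continuous_intros)
  have mK: "complex_of_real ` K \<in> sets borel" by (intro borel_closed compact_imp_closed cK)
  have ae: "AE z in distr \<nu> borel complex_of_real. z \<in> complex_of_real ` K"
    using K(3) mK by (subst AE_distr_iff[OF m]) (auto elim!: eventually_mono)
  have "emeasure (distr \<nu> borel complex_of_real) (UNIV - complex_of_real ` K) = 0"
    using ae mK by (subst (asm) AE_iff_measurable[where N = "UNIV - complex_of_real ` K"]) auto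
  then show "distr \<nu> borel complex_of_real \<in> admissible (complex_of_real ` E)"
    unfolding admissible_def using pr' cK K(2) by auto
  \<comment> \<open>\<open>Re\<close> inverts the embedding, so the projected measure in
    \<open>energy_eq_log_energy\<close> is \<open>\<nu>\<close> again.\<close>
  have "distr (distr \<nu> borel complex_of_real) borel Re = distr \<nu> borel (\<lambda>x. x)"
    by (subst distr_distr) (auto simp: comp_def)
  also have "\<dots> = \<nu>" by (rule distr_id2) (simp add: sets)
  finally have "distr (distr \<nu> borel complex_of_real) borel Re = \<nu>" .
  moreover have "energy (distr \<nu> borel complex_of_real) =
      enn2ereal (log_energy (distr (distr \<nu> borel complex_of_real) borel Re))"
  proof (rule energy_eq_log_energy)
    show "AE z in distr \<nu> borel complex_of_real. z \<in> complex_of_real ` {0..1}"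
      using ae by (rule eventually_mono) (use K(2) E in auto)
  qed (simp_all add: pr')
  ultimately show "energy (distr \<nu> borel complex_of_real) = enn2ereal (log_energy \<nu>)" by simp
qed

lemma admissible_unit_interval_real:
  assumes "\<mu> \<in> admissible (complex_of_real ` {0..1})"
  defines "\<nu> \<equiv> distr \<mu> borel Re"
  shows "prob_space \<nu>" "AE x in \<nu>. x \<in> {0..1}" "energy \<mu> = enn2ereal (log_energy \<nu>)"
proof -
  obtain K where \<mu>: "sets \<mu> = sets borel" "prob_space \<mu>" and K: "compact K" "K \<subseteq> complex_of_real ` {0..1}"
    "emeasure \<mu> (UNIV - K) = 0"
    using assms(1) unfolding admissible_def by blast
  have [measurable_cong]: "sets \<mu> = sets borel" by (rule \<mu>(1))
  have m: "Re \<in> measurable \<mu> borel" by measurable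
  have "K \<in> sets borel" by (intro borel_closed compact_imp_closed K)
  then have "AE z in \<mu>. z \<in> K"
    using K(3) sets_eq_imp_space_eq[OF \<mu>(1)] by (subst AE_iff_measurable[where N = "UNIV - K"]) (auto simp: \<mu>(1))
  then have ae: "AE z in \<mu>. z \<in> complex_of_real ` {0..1}"
    by (rule eventually_mono) (use K(2) in auto)
  show "prob_space \<nu>" unfolding \<nu>_def by (rule prob_space.prob_space_distr[OF \<mu>(2) m])
  show "AE x in \<nu>. x \<in> {0..1}"
    unfolding \<nu>_def using ae by (subst AE_distr_iff[OF m]) (auto elim!: eventually_mono)
  show "energy \<mu> = enn2ereal (log_energy \<nu>)"
    unfolding \<nu>_def by (rule energy_eq_log_energy[OF \<mu> ae])
qed

text \<open>Lower semicontinuity. For a fixed truncation the kernel is continuous and bounded, so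
  the double integrals converge by \<open>contraction_double_limit\<close> on the diagonal
  \<open>m = n\<close>; the supremum over truncations is taken only after the limit.\<close>

lemma log_energy_weak_limit_le:
  fixes \<nu> :: "nat \<Rightarrow> real measure"
  assumes rd: "\<And>n. real_distribution (\<nu> n)" "real_distribution \<nu>'" and weak: "weak_conv_m \<nu> \<nu>'"
    and supp: "\<And>n. AE x in \<nu> n. x \<in> {0..1}" "AE x in \<nu>'. x \<in> {0..1}"
    and X: "\<And>n. log_energy (\<nu> n) \<le> ennreal X" "0 \<le> X"
  shows "log_energy \<nu>' \<le> ennreal X"
proof -
  have sets: "sets (\<nu> n) = sets borel" "sets \<nu>' = sets borel" and pr: "prob_space (\<nu> n)" "prob_space \<nu>'" for n
    using rd by (auto simp: real_distribution_def real_distribution_axioms_def)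
  have sf: "sigma_finite_measure M" if "prob_space M" for M :: "real measure"
    using that by (simp add: prob_space_def finite_measure_def)
  have bound: "(\<integral>x. (\<integral>y. trunc_log \<delta> x y \<partial>\<nu>') \<partial>\<nu>') \<le> X" if \<delta>: "0 < \<delta>" "\<delta> \<le> 1" for \<delta>
  proof (rule field_le_epsilon)
    fix e :: real assume e: "0 < e"
    have F: "case_prod (trunc_log \<delta>) \<in> borel_measurable (borel \<Otimes>\<^sub>M borel)" by measurable
    have "\<exists>N. \<forall>m\<ge>N. \<forall>n\<ge>N. \<bar>(\<integral>x. (\<integral>y. trunc_log \<delta> (clamp01 x) (clamp01 y) \<partial>\<nu> n) \<partial>\<nu> m) -
        (\<integral>x. (\<integral>y. trunc_log \<delta> (clamp01 x) (clamp01 y) \<partial>\<nu>') \<partial>\<nu>')\<bar> < e"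
    proof (rule contraction_double_limit[where L = "\<lambda>n f. \<integral>x. f (clamp01 x) \<partial>\<nu> n" and M = "\<lambda>f. \<integral>x. f (clamp01 x) \<partial>\<nu>'" and F = "trunc_log \<delta>" and e = e])
      show "\<bar>(\<integral>x. f (clamp01 x) \<partial>\<nu> n) - (\<integral>x. g (clamp01 x) \<partial>\<nu> n)\<bar> \<le> e"
        if "continuous_on {0..1} f" "continuous_on {0..1} g" "\<And>x. x \<in> {0..1} \<Longrightarrow> \<bar>f x - g x\<bar> \<le> e"
        for n e and f g :: "real \<Rightarrow> real"
        by (rule integral_clamp01_contraction[OF sets(1) pr(1) that(1,2)]) (rule that(3))
      show "\<bar>(\<integral>x. f (clamp01 x) \<partial>\<nu>') - (\<integral>x. g (clamp01 x) \<partial>\<nu>')\<bar> \<le> e"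
        if "continuous_on {0..1} f" "continuous_on {0..1} g" "\<And>x. x \<in> {0..1} \<Longrightarrow> \<bar>f x - g x\<bar> \<le> e"
        for e and f g :: "real \<Rightarrow> real"
        by (rule integral_clamp01_contraction[OF sets(2) pr(2) that(1,2)]) (rule that(3))
      show "(\<lambda>n. \<integral>x. f (clamp01 x) \<partial>\<nu> n) \<longlonglongrightarrow> (\<integral>x. f (clamp01 x) \<partial>\<nu>')"
        if f: "continuous_on {0..1} f" for f :: "real \<Rightarrow> real"
      proof -
        have "bounded (f ` {0..1})" by (intro compact_imp_bounded compact_continuous_image f) simp
        then obtain B where "\<forall>y\<in>f ` {0..1}. norm y \<le> B" unfolding bounded_iff by (elim exE)
        then have B: "norm (f (clamp01 x)) \<le> B" for x using clamp01_in[of x] by blast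
        show ?thesis
          using continuous_on_compose_clamp01[OF f] B
          by (intro weak_conv_imp_integral_bdd_continuous_conv[OF rd weak])
            (auto simp: continuous_on_eq_continuous_at)
      qed
      show "continuous_on ({0..1} \<times> {0..1}) (\<lambda>p. trunc_log \<delta> (fst p) (snd p))"
        by (rule continuous_on_subset[OF continuous_on_trunc_log[OF \<delta>(1)]]) simp
    qed (rule e)
    then obtain N where "\<bar>(\<integral>x. (\<integral>y. trunc_log \<delta> (clamp01 x) (clamp01 y) \<partial>\<nu> N) \<partial>\<nu> N) -
        (\<integral>x. (\<integral>y. trunc_log \<delta> (clamp01 x) (clamp01 y) \<partial>\<nu>') \<partial>\<nu>')\<bar> < e" by blast
    then have lt: "\<bar>(\<integral>x. (\<integral>y. trunc_log \<delta> x y \<partial>\<nu> N) \<partial>\<nu> N) - (\<integral>x. (\<integral>y. trunc_log \<delta> x y \<partial>\<nu>') \<partial>\<nu>')\<bar> < e"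
      unfolding double_integral_clamp01[OF sets(1) pr(1) supp(1) F] double_integral_clamp01[OF sets(2) pr(2) supp(2) F] .
    have "ennreal (\<integral>x. (\<integral>y. trunc_log \<delta> x y \<partial>\<nu> N) \<partial>\<nu> N) = (\<integral>\<^sup>+ y. (\<integral>\<^sup>+ x. ennreal (trunc_log \<delta> x y) \<partial>\<nu> N) \<partial>\<nu> N)"
      by (rule nn_integral_trunc_log[OF sets(1) pr(1) \<delta>, symmetric])
    also have "\<dots> \<le> log_energy (\<nu> N)"
      unfolding log_energy_def by (intro nn_integral_mono trunc_log_le_logker \<delta>)
    also note X(1)
    finally have "(\<integral>x. (\<integral>y. trunc_log \<delta> x y \<partial>\<nu> N) \<partial>\<nu> N) \<le> X"
      using X(2) by (simp add: ennreal_le_iff)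
    then show "(\<integral>x. (\<integral>y. trunc_log \<delta> x y \<partial>\<nu>') \<partial>\<nu>') \<le> X + e" using lt by linarith
  qed
  show ?thesis
    unfolding log_energy_eq_SUP[OF sets(2) sf[OF pr(2)]]
    by (intro SUP_least, subst nn_integral_trunc_log[OF sets(2) pr(2)])
      (auto intro!: ennreal_leI bound)
qed

text \<open>The truncated distance to K is a bounded continuous test function whose zero set is K.
  Nonemptiness matters because \<open>infdist\<close> to the empty set is 0 by convention.\<close>

lemma weak_limit_null_outside:
  fixes \<nu> :: "nat \<Rightarrow> real measure"
  assumes rd: "\<And>n. real_distribution (\<nu> n)" "real_distribution \<nu>'" and weak: "weak_conv_m \<nu> \<nu>'"
    and K: "closed K" "K \<noteq> {}" and supp: "\<forall>\<^sub>F n in sequentially. AE x in \<nu> n. x \<in> K"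
  shows "AE x in \<nu>'. x \<in> K"
proof -
  interpret real_distribution \<nu>' by (rule rd)
  define f where "f x = min 1 (infdist x K)" for x
  have f0: "0 \<le> f x" "norm (f x) \<le> 1" for x by (auto simp: f_def infdist_nonneg)
  have fc: "continuous_on UNIV f" unfolding f_def[abs_def] by (intro continuous_intros)
  have "(\<lambda>n. integral\<^sup>L (\<nu> n) f) \<longlonglongrightarrow> integral\<^sup>L \<nu>' f"
    using fc f0(2) by (intro weak_conv_imp_integral_bdd_continuous_conv[OF rd weak])
      (auto simp: continuous_on_eq_continuous_at)
  moreover have "\<forall>\<^sub>F n in sequentially. integral\<^sup>L (\<nu> n) f = 0"
    using supp
  proof (rule eventually_mono)
    fix n assume "AE x in \<nu> n. x \<in> K"
    then have "AE x in \<nu> n. f x = 0" by (rule eventually_mono) (simp add: f_def)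
    then show "integral\<^sup>L (\<nu> n) f = 0" by (rule integral_eq_zero_AE)
  qed
  ultimately have "integral\<^sup>L \<nu>' f = 0"
    by (metis LIMSEQ_unique tendsto_eventually)
  moreover have "integrable \<nu>' f"
    using f0 borel_measurable_continuous_onI[OF fc] by (intro integrable_const_bound[where B = 1]) auto
  ultimately have "AE x in \<nu>'. f x = 0"
    using f0 by (subst (asm) integral_nonneg_eq_0_iff_AE) auto
  then show ?thesis
  proof (rule eventually_mono)
    fix x assume "f x = 0"
    then have "infdist x K = 0" using infdist_nonneg[of x K] by (simp add: f_def min_def split: if_splits)
    then show "x \<in> K" using in_closed_iff_infdist_zero[OF K] by simp
  qed
qed

subsection \<open>Capacity of the limsup set\<close>

context log_point_system
begin

text \<open>The supports of the refined densities decrease, so a weak limit is carried by each of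
  their closures and therefore by the intersection, which is compact. Membership in infinitely many
  intervals is built into the nesting.\<close>

lemma measure_on_limsup_set:
  assumes g: "g \<in> bump01" "(\<integral>\<^sup>+ x. ennreal (g x) \<partial>\<Phi>) = 1"
    and X: "log_energy (density \<Phi> (\<lambda>x. ennreal (g x))) \<le> ennreal X" "0 \<le> X" and \<epsilon>: "0 < \<epsilon>"
    and S: "S = (\<Inter>m\<in>{1..}. \<Union>k\<in>{m..}. {c k - l k / 2 <..< c k + l k / 2})"
  obtains \<nu> K where "sets \<nu> = sets borel" "prob_space \<nu>" "compact K" "K \<subseteq> S" "K \<subseteq> {0..1}" "AE x in \<nu>. x \<in> K"
    "log_energy \<nu> \<le> ennreal (X + \<epsilon>)"
proof -
  obtain u :: "nat \<Rightarrow> real \<Rightarrow> real" and A :: "nat \<Rightarrow> nat set"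
  where u: "\<And>n. u n \<in> bump01" "\<And>n. (\<integral>\<^sup>+ x. ennreal (u n x) \<partial>\<Phi>) = 1"
    "\<And>n. log_energy (density \<Phi> (\<lambda>x. ennreal (u n x))) \<le> ennreal (X + \<epsilon>)"
    and nest: "\<And>n x. u (Suc n) x \<noteq> 0 \<Longrightarrow> u n x \<noteq> 0"
    and A: "\<And>n. finite (A n)" "\<And>n. A n \<subseteq> {Suc n..}"
    "\<And>n x. u (Suc n) x \<noteq> 0 \<Longrightarrow> \<exists>k\<in>A n. \<bar>x - c k\<bar> \<le> l k / 4"
    by (rule refining_sequence[OF g X \<epsilon>]) (rule that)
  define \<nu> where "\<nu> n = density \<Phi> (\<lambda>x. ennreal (u n x))" for n
  have um[measurable]: "u n \<in> borel_measurable borel" for n by (rule bump01_measurable[OF u(1)])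
  have sets: "sets (\<nu> n) = sets borel" for n by (simp add: \<nu>_def sets_\<Phi>)
  have pr: "prob_space (\<nu> n)" for n
  proof (rule prob_spaceI)
    have "emeasure (\<nu> n) (space (\<nu> n)) = (\<integral>\<^sup>+ x. ennreal (u n x) * indicator (space \<Phi>) x \<partial>\<Phi>)"
      unfolding \<nu>_def by (subst emeasure_density) auto
    also have "\<dots> = (\<integral>\<^sup>+ x. ennreal (u n x) \<partial>\<Phi>)" by (rule nn_integral_cong) simp
    finally show "emeasure (\<nu> n) (space (\<nu> n)) = 1" using u(2) by simp
  qed
  have rd: "real_distribution (\<nu> n)" for n
    using sets pr by (simp add: real_distribution_def real_distribution_axioms_def)
  \<comment> \<open>Closures are needed: the sets where the densities are positive are open, and a
    weak limit may charge their boundaries.\<close>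
  define K where "K n = closure {x. u n x \<noteq> 0}" for n
  have K_sub: "K (Suc n) \<subseteq> K n" for n unfolding K_def by (intro closure_mono) (use nest in auto)
  have K_anti: "K n \<subseteq> K m" if "m \<le> n" for m n by (rule lift_Suc_antimono_le[where f = K]) (rule K_sub, rule that)
  have K01: "K n \<subseteq> {0..1}" for n
    unfolding K_def using u(1)[of n] by (intro closure_minimal) (auto simp: bump01_def)
  have aeK: "AE x in \<nu> n. x \<in> K n" for n
  proof -
    have "x \<in> K n" if "0 < ennreal (u n x)" for x
      using that closure_subset[of "{x. u n x \<noteq> 0}"] by (auto simp: K_def)
    then show ?thesis unfolding \<nu>_def by (subst AE_density) auto
  qed
  have ae01: "AE x in \<nu> n. x \<in> {0..1}" for n
    using aeK[of n] by (rule eventually_mono) (rule subsetD[OF K01])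
  have K_ne: "K n \<noteq> {}" for n
  proof
    assume "K n = {}"
    then have "AE x in \<nu> n. False" using aeK[of n] by simp
    then show False using prob_space.AE_False[OF pr] by simp
  qed
  have tight: "tight \<nu>"
    unfolding tight_def
  proof (intro conjI allI impI rd)
    fix e :: real assume e: "0 < e"
    \<comment> \<open>Tightness is formulated with intervals open on the left, so the left end must
      lie strictly below 0.\<close>
    have "measure (\<nu> n) {-1<..1} = 1" for n
    proof -
      interpret real_distribution "\<nu> n" by (rule rd)
      show ?thesis by (subst prob_eq_1) (simp, rule eventually_mono[OF ae01[of n]], auto)
    qed
    then show "\<exists>a b. a < b \<and> (\<forall>n. 1 - e < measure (\<nu> n) {a<..b})"
      using e by (intro exI[of _ "-1"] exI[of _ 1]) simp
  qed
  obtain r \<nu>' where r: "strict_mono (r :: nat \<Rightarrow> nat)" and rd': "real_distribution \<nu>'"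
    and weak: "weak_conv_m (\<nu> \<circ> id \<circ> r) \<nu>'"
    using tight_imp_convergent_subsubsequence[OF tight strict_mono_id] by blast
  have rdr: "real_distribution ((\<nu> \<circ> id \<circ> r) n)" for n by (simp add: rd)
  \<comment> \<open>For fixed m all later measures live on the closed set \<open>K m\<close>, and so
    does the limit; only countably many m then have to be combined.\<close>
  have ae': "AE x in \<nu>'. x \<in> K m" for m
  proof (rule weak_limit_null_outside[OF rdr rd' weak])
    show "closed (K m)" "K m \<noteq> {}" using K_ne by (auto simp: K_def)
    have "AE x in (\<nu> \<circ> id \<circ> r) n. x \<in> K m" if "m \<le> n" for n
    proof -
      have "m \<le> r n" using that seq_suble[OF r, of n] by linarith
      then have "K (r n) \<subseteq> K m" by (rule K_anti)
      then have "AE x in \<nu> (r n). x \<in> K m" by (intro eventually_mono[OF aeK]) (rule subsetD)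
      then show ?thesis by (simp only: comp_apply id_apply)
    qed
    then show "\<forall>\<^sub>F n in sequentially. AE x in (\<nu> \<circ> id \<circ> r) n. x \<in> K m"
      unfolding eventually_sequentially by blast
  qed
  define K' where "K' = (\<Inter>n. K n)"
  show thesis
  proof (rule that[of \<nu>' K'])
    show "sets \<nu>' = sets borel" "prob_space \<nu>'"
      using rd' by (simp_all add: real_distribution_def real_distribution_axioms_def)
    show K'01: "K' \<subseteq> {0..1}" using K01[of 0] unfolding K'_def by blast
    have "closed K'" unfolding K'_def by (intro closed_INT) (simp add: K_def)
    from compact_Int_closed[OF compact_Icc[of 0 1] this] show "compact K'"
      unfolding Int_absorb1[OF K'01] .
    show "AE x in \<nu>'. x \<in> K'" using ae' by (simp add: K'_def AE_all_countable)
    show "K' \<subseteq> S"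
    proof
      fix x assume x: "x \<in> K'"
      have "\<exists>k\<ge>m. x \<in> {c k - l k / 2 <..< c k + l k / 2}" if "1 \<le> m" for m
      proof -
        have "x \<in> K (Suc m)" using x by (simp add: K'_def)
        \<comment> \<open>Finitely many closed balls have a closed union, so the closure adds no
          point outside them; the radius \<open>l k / 4\<close> keeps each ball inside the open
          interval of half-length \<open>l k / 2\<close>.\<close>
        also have "K (Suc m) \<subseteq> (\<Union>k\<in>A m. cball (c k) (l k / 4))"
          unfolding K_def
        proof (rule closure_minimal)
          show "{x. u (Suc m) x \<noteq> 0} \<subseteq> (\<Union>k\<in>A m. cball (c k) (l k / 4))"
            using A(3) by (force simp: dist_real_def abs_minus_commute)
          show "closed (\<Union>k\<in>A m. cball (c k) (l k / 4))" by (intro closed_UN A(1)) auto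
        qed
        finally obtain k where k: "k \<in> A m" "\<bar>c k - x\<bar> \<le> l k / 4" by (auto simp: dist_real_def)
        have "m \<le> k" using A(2)[of m] k(1) by auto
        moreover have "c k - l k / 2 < x" "x < c k + l k / 2"
          using k(2) l_pos[of k] by linarith+
        ultimately show ?thesis by (intro exI[of _ k]) simp
      qed
      then show "x \<in> S" unfolding S by auto
    qed
    show "log_energy \<nu>' \<le> ennreal (X + \<epsilon>)"
    proof (rule log_energy_weak_limit_le[OF rdr rd' weak])
      show "AE x in (\<nu> \<circ> id \<circ> r) n. x \<in> {0..1}" for n unfolding comp_apply id_apply by (rule ae01)
      show "AE x in \<nu>'. x \<in> {0..1}" using ae'[of 0] by (rule eventually_mono) (rule subsetD[OF K01])
      show "log_energy ((\<nu> \<circ> id \<circ> r) n) \<le> ennreal (X + \<epsilon>)" for n using u(3) by (simp add: \<nu>_def)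
    qed (use X \<epsilon> in simp)
  qed
qed

text \<open>Single intervals may stick out of the unit interval, but by less than their length,
  which tends to 0; points of S lie in intervals of arbitrarily large index.\<close>

lemma limsup_set_subset:
  assumes S: "S = (\<Inter>m\<in>{1..}. \<Union>k\<in>{m..}. {c k - l k / 2 <..< c k + l k / 2})"
  shows "S \<subseteq> {0..1}"
proof
  fix x assume x: "x \<in> S"
  have near: "- e \<le> x \<and> x \<le> 1 + e" if e: "0 < e" for e :: real
  proof -
    obtain N where N: "\<And>n. n \<ge> N \<Longrightarrow> l n < e"
      using order_tendstoD(2)[OF l_tendsto_0 e] unfolding eventually_sequentially by blast
    have "x \<in> (\<Union>k\<in>{max 1 N..}. {c k - l k / 2 <..< c k + l k / 2})" using x unfolding S by auto
    then obtain k where k: "max 1 N \<le> k" "c k - l k / 2 < x" "x < c k + l k / 2" by auto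
    then show ?thesis using c01[of k] N[of k] l_pos[of k] by auto
  qed
  have "x \<le> 1" by (rule field_le_epsilon) (use near in auto)
  moreover have "0 \<le> x" by (rule field_le_epsilon) (use near in force)
  ultimately show "x \<in> {0..1}" by simp
qed

text \<open>Monotonicity gives one inequality between the infima. For the other, each competitor of
  finite energy on the unit interval is matched on S up to e: half for the passage to a continuous
  density, half for the infinite refinement.\<close>

lemma capacity_limsup_set:
  assumes S: "S = (\<Inter>m\<in>{1..}. \<Union>k\<in>{m..}. {c k - l k / 2 <..< c k + l k / 2})"
  shows "capacity (complex_of_real ` S) = capacity (complex_of_real ` {0..1})"
    and "0 < capacity (complex_of_real ` {0..1})"
proof -
  let ?I = "complex_of_real ` {0..1}" and ?S = "complex_of_real ` S"
  have S01: "S \<subseteq> {0..1}" by (rule limsup_set_subset[OF S])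
  have "admissible ?S \<subseteq> admissible ?I"
    unfolding admissible_def using S01 by (force dest: image_mono[of S "{0..1}" complex_of_real])
  then have 1: "(INF \<mu>\<in>admissible ?I. energy \<mu>) \<le> (INF \<mu>\<in>admissible ?S. energy \<mu>)"
    by (rule INF_superset_mono) simp
  have 2: "(INF \<mu>\<in>admissible ?S. energy \<mu>) \<le> energy \<mu>" if \<mu>: "\<mu> \<in> admissible ?I" for \<mu>
  proof -
    define \<nu> where "\<nu> = distr \<mu> borel Re"
    note adm = admissible_unit_interval_real[OF \<mu>, folded \<nu>_def]
    show ?thesis
    proof (cases "log_energy \<nu>")
      case top
      then show ?thesis by (simp add: adm(3))
    next
      case (real X)
      have "(INF \<mu>\<in>admissible ?S. energy \<mu>) \<le> ereal X + ereal e" if e: "0 < e" for e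
      proof -
        have e2: "0 < e/2" using e by simp
        obtain g where g: "g \<in> bump01" "(\<integral>\<^sup>+ x. ennreal (g x) \<partial>\<Phi>) = 1"
          "log_energy (density \<Phi> (\<lambda>x. ennreal (g x))) \<le> ennreal (X + e/2)"
          using initial_density[OF _ adm(1,2) _ real(1) e2] real by (auto simp: \<nu>_def)
        have Xe: "0 \<le> X + e/2" using real(1) e by simp
        obtain \<nu>' K where \<nu>': "sets \<nu>' = sets borel" "prob_space \<nu>'" "compact K" "K \<subseteq> S" "K \<subseteq> {0..1}" "AE x in \<nu>'. x \<in> K"
          "log_energy \<nu>' \<le> ennreal (X + e/2 + e/2)"
          by (rule measure_on_limsup_set[OF g Xe e2 S]) (rule that)
        note adm' = admissible_of_real[OF \<nu>'(1,2,3,4,6) S01]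
        have "(INF \<mu>\<in>admissible ?S. energy \<mu>) \<le> energy (distr \<nu>' borel complex_of_real)"
          by (rule INF_lower[OF adm'(1)])
        also have "\<dots> \<le> enn2ereal (ennreal (X + e/2 + e/2))"
          unfolding adm'(2) using \<nu>'(7) by (simp only: less_eq_ennreal.rep_eq)
        also have "\<dots> = ereal X + ereal e" using Xe e by (subst enn2ereal_ennreal) auto
        finally show ?thesis .
      qed
      then have "(INF \<mu>\<in>admissible ?S. energy \<mu>) \<le> ereal X"
        by (rule ereal_le_epsilon2)
      then show ?thesis using real by (simp add: adm(3) enn2ereal_ennreal)
    qed
  qed
  then have "(INF \<mu>\<in>admissible ?S. energy \<mu>) \<le> (INF \<mu>\<in>admissible ?I. energy \<mu>)"
    by (intro INF_greatest)
  with 1 have "(INF \<mu>\<in>admissible ?S. energy \<mu>) = (INF \<mu>\<in>admissible ?I. energy \<mu>)" by (rule antisym[rotated])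
  then show "capacity ?S = capacity ?I" unfolding capacity_def by (simp only:)
  \<comment> \<open>Positivity of the capacity is witnessed by \<open>\<Phi>\<close> itself, whose
    energy is finite.\<close>
  have "distr \<Phi> borel complex_of_real \<in> admissible ?I"
    "energy (distr \<Phi> borel complex_of_real) = enn2ereal (log_energy \<Phi>)"
    using admissible_of_real[OF sets_\<Phi> prob_\<Phi> _ _ AE_\<Phi>, of "{0..1}"] by auto
  then have "(INF \<mu>\<in>admissible ?I. energy \<mu>) \<le> enn2ereal (log_energy \<Phi>)"
    by (auto dest: INF_lower[where f = energy])
  also have "\<dots> < \<infinity>" using log_energy_\<Phi>_finite by (cases "log_energy \<Phi>") (auto simp: enn2ereal_ennreal)
  finally have "(INF \<mu>\<in>admissible ?I. energy \<mu>) \<noteq> \<infinity>" by simp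
  then show "0 < capacity ?I"
    unfolding capacity_def by (cases "INF \<mu>\<in>admissible ?I. energy \<mu>") auto
qed

end

section \<open>Verification of the abstract assumptions\<close>

theorem theorem1p7:
  fixes lam :: real and c :: "nat \<Rightarrow> real" and l :: "nat \<Rightarrow> real"
    and S :: "real set" and q :: "nat \<Rightarrow> nat"
  assumes lam_pos: "lam > 0"
    and c_range: "\<And>k. k \<ge> 1 \<Longrightarrow> c k \<in> {0<..<1}"
    and l_def: "\<And>k. l k = exp (- lam * real k)"
    and S_def: "S = (\<Inter>m\<in>{1..}. \<Union>k\<in>{m..}. {c k - l k / 2 <..< c k + l k / 2})"
    and A1: "\<exists>\<phi> :: real \<Rightarrow> real. set_integrable lborel {0..1} \<phi>
               \<and> (AE x in lborel. x \<in> {0..1} \<longrightarrow> \<phi> x > 0)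
               \<and> (\<forall>f :: real \<Rightarrow> real. continuous_on {0..1} f \<longrightarrow>
                    (\<lambda>n. (1 / real (card (blockA n))) * (\<Sum>k\<in>blockA n. f (c k)))
                      \<longlonglongrightarrow> (LINT x:{0..1}|lborel. f x * \<phi> x))"
    and q_lim: "filterlim q at_top sequentially"
    and A2: "\<forall>\<epsilon>>0. \<exists>\<delta>>0. \<forall>\<^sub>F n in sequentially.
               \<forall>n' \<in> {2^j * n | j. j \<le> q n}. \<forall>n'' \<in> {2^j * n | j. j \<le> q n}.
                 ereal (1 / real (card (blockA n' \<times> blockA n''))) *
                   (\<Sum>(i,j) \<in> {(i,j). i \<in> blockA n' \<and> j \<in> blockA n'' \<and> i \<noteq> j
                                    \<and> \<bar>c i - c j\<bar> < \<delta>}. neglog \<bar>c i - c j\<bar>)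
                 < ereal \<epsilon>"
    and A3: "\<forall>\<epsilon>>0. \<forall>\<^sub>F n in sequentially.
               \<forall>i \<in> blockAq n (q n). \<forall>j \<in> blockAq n (q n). i \<noteq> j \<longrightarrow>
                 l i + l j < \<epsilon> * (2 * \<bar>c i - c j\<bar>)"
  shows "capacity (complex_of_real ` S) = capacity (complex_of_real ` {0..1})
         \<and> capacity (complex_of_real ` {0..1}) > 0"
proof -
  obtain \<phi> :: "real \<Rightarrow> real" where \<phi>_int: "set_integrable lborel {0..1} \<phi>"
    and \<phi>_pos: "AE x in lborel. x \<in> {0..1} \<longrightarrow> 0 < \<phi> x"
    and \<phi>_lim: "\<forall>f :: real \<Rightarrow> real. continuous_on {0..1} f \<longrightarrow>
      (\<lambda>n. (1 / real (card (blockA n))) * (\<Sum>k\<in>blockA n. f (c k))) \<longlonglongrightarrow> (LINT x:{0..1}|lborel. f x * \<phi> x)"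
    using A1 by blast
  \<comment> \<open>\<open>\<phi>\<close> may be negative on a null set; the maximum repairs this
    without changing any integral over the unit interval.\<close>
  define w where "w x = max 0 (indicator {0..1} x * \<phi> x)" for x :: real
  have \<phi>m: "(\<lambda>x. indicator {0..1} x * \<phi> x) \<in> borel_measurable borel"
    using \<phi>_int unfolding set_integrable_def by (auto dest: borel_measurable_integrable)
  have wm[measurable]: "w \<in> borel_measurable borel" unfolding w_def[abs_def] using \<phi>m by measurable
  have w0: "0 \<le> w x" for x by (simp add: w_def)
  have w_eq: "AE x in lborel. w x = indicator {0..1} x * \<phi> x"
    using \<phi>_pos by (rule eventually_mono) (auto simp: w_def indicator_def)
  have lim: "(\<lambda>n. (\<Sum>k\<in>blockA n. f (c k)) / real n) \<longlonglongrightarrow>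
      (\<integral>x. f (clamp01 x) \<partial>density lborel (\<lambda>x. ennreal (w x)))" if f: "continuous_on {0..1} f" for f
  proof -
    have [measurable]: "(\<lambda>x. f (clamp01 x)) \<in> borel_measurable borel"
      by (intro borel_measurable_continuous_onI continuous_on_compose_clamp01 f)
    have "(\<integral>x. f (clamp01 x) \<partial>density lborel (\<lambda>x. ennreal (w x))) = (\<integral>x. w x * f (clamp01 x) \<partial>lborel)"
      by (subst integral_density) (auto simp: w0)
    also have "\<dots> = (\<integral>x. (indicator {0..1} x * \<phi> x) * f (clamp01 x) \<partial>lborel)"
    proof (rule integral_cong_AE)
      show "AE x in lborel. w x * f (clamp01 x) = indicator {0..1} x * \<phi> x * f (clamp01 x)"
        using w_eq by (rule eventually_mono) simp
    qed (use \<phi>m in measurable)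
    also have "\<dots> = (LINT x:{0..1}|lborel. f x * \<phi> x)"
      unfolding set_lebesgue_integral_def
      by (rule Bochner_Integration.integral_cong) (auto simp: indicator_def clamp01_id)
    finally show ?thesis using \<phi>_lim f by simp
  qed
  have w_int: "(\<integral>\<^sup>+ x. ennreal (w x) \<partial>lborel) = 1"
  proof -
    \<comment> \<open>The total mass is found by testing (A1) with the constant function 1. The
      average equals 1 only for \<open>n > 0\<close>, since for the empty block the quotient is
      0.\<close>
    have "(LINT x:{0..1}|lborel. 1 * \<phi> x) = 1"
    proof (rule LIMSEQ_unique)
      show "(\<lambda>n. (1 / real (card (blockA n))) * (\<Sum>k\<in>blockA n. 1)) \<longlonglongrightarrow> (LINT x:{0..1}|lborel. 1 * \<phi> x)"
        using \<phi>_lim continuous_on_const by blast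
      have "\<forall>\<^sub>F n in sequentially. (1 / real (card (blockA n))) * (\<Sum>k\<in>blockA n. 1) = 1"
        using eventually_gt_at_top[of 0] by (rule eventually_mono) simp
      then show "(\<lambda>n. (1 / real (card (blockA n))) * (\<Sum>k\<in>blockA n. 1)) \<longlonglongrightarrow> 1"
        by (rule tendsto_eventually)
    qed
    then have 1: "(\<integral>x. indicator {0..1} x * \<phi> x \<partial>lborel) = 1"
      by (simp add: set_lebesgue_integral_def)
    have \<phi>i: "integrable lborel (\<lambda>x. indicator {0..1} x * \<phi> x)"
      using \<phi>_int by (simp add: set_integrable_def)
    have "(\<integral>\<^sup>+ x. ennreal (w x) \<partial>lborel) = (\<integral>\<^sup>+ x. ennreal (indicator {0..1} x * \<phi> x) \<partial>lborel)"
      by (intro nn_integral_cong_AE eventually_mono[OF w_eq]) simp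
    also have "\<dots> = ennreal (\<integral>x. indicator {0..1} x * \<phi> x \<partial>lborel)"
    proof (rule nn_integral_eq_integral[OF \<phi>i])
      show "AE x in lborel. 0 \<le> indicator {0..1} x * \<phi> x"
        using w_eq w0 by (auto elim!: eventually_mono) (metis w0)
    qed
    finally show ?thesis using 1 by simp
  qed
  \<comment> \<open>The value 1 matches the radii \<open>l k / 4\<close>: it gives
    \<open>2 * (l i / 4 + l j / 4) < \<bar>c i - c j\<bar>\<close>, the separation under which two
    bumps keep at least half of the distance of their centres.\<close>
  have separated: "\<forall>\<^sub>F n in sequentially. \<forall>i\<in>blockAq n (q n). \<forall>j\<in>blockAq n (q n). i \<noteq> j \<longrightarrow>
      l i + l j < 2 * \<bar>c i - c j\<bar>"
    using A3[rule_format, of 1] by simp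
  have close: "\<exists>\<delta>>0. \<forall>\<^sub>F n in sequentially. \<forall>a\<le>q n. \<forall>b\<le>q n.
      (\<Sum>i\<in>blockA (2^a * n). \<Sum>j\<in>blockA (2^b * n).
         if i \<noteq> j \<and> \<bar>c i - c j\<bar> < \<delta> then - ln \<bar>c i - c j\<bar> else 0) \<le> \<epsilon> * real (2^a * n) * real (2^b * n)"
    if \<epsilon>: "0 < \<epsilon>" for \<epsilon>
  proof -
    obtain \<delta> where \<delta>: "0 < \<delta>" and ev: "\<forall>\<^sub>F n in sequentially.
        \<forall>n' \<in> {2^j * n | j. j \<le> q n}. \<forall>n'' \<in> {2^j * n | j. j \<le> q n}.
          ereal (1 / real (card (blockA n' \<times> blockA n''))) *
            (\<Sum>(i,j) \<in> {(i,j). i \<in> blockA n' \<and> j \<in> blockA n'' \<and> i \<noteq> j \<and> \<bar>c i - c j\<bar> < \<delta>}. neglog \<bar>c i - c j\<bar>)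
          < ereal \<epsilon>"
      using A2 \<epsilon> by blast
    show ?thesis
    proof (intro exI[of _ \<delta>] conjI \<delta>)
      show "\<forall>\<^sub>F n in sequentially. \<forall>a\<le>q n. \<forall>b\<le>q n.
        (\<Sum>i\<in>blockA (2^a * n). \<Sum>j\<in>blockA (2^b * n).
         if i \<noteq> j \<and> \<bar>c i - c j\<bar> < \<delta> then - ln \<bar>c i - c j\<bar> else 0) \<le> \<epsilon> * real (2^a * n) * real (2^b * n)"
        using ev separated eventually_gt_at_top[of 0]
      proof eventually_elim
        case (elim n)
        show ?case
        proof (intro allI impI)
          fix a b assume ab: "a \<le> q n" "b \<le> q n"
          let ?A = "blockA (2^a * n)" and ?B = "blockA (2^b * n)"
          let ?P = "{(i,j). i \<in> ?A \<and> j \<in> ?B \<and> i \<noteq> j \<and> \<bar>c i - c j\<bar> < \<delta>}"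
          let ?S = "\<Sum>i\<in>?A. \<Sum>j\<in>?B. if i \<noteq> j \<and> \<bar>c i - c j\<bar> < \<delta> then - ln \<bar>c i - c j\<bar> else 0"
          have P: "?P = {z \<in> ?A \<times> ?B. fst z \<noteq> snd z \<and> \<bar>c (fst z) - c (snd z)\<bar> < \<delta>}" by auto
          \<comment> \<open>By (A3) distinct indices have distinct centres, so no term is infinite
            and the extended sum is a sum of reals.\<close>
          have "(\<Sum>(i,j)\<in>?P. neglog \<bar>c i - c j\<bar>) = (\<Sum>(i,j)\<in>?P. ereal (- ln \<bar>c i - c j\<bar>))"
          proof (intro sum.cong refl, clarify)
            fix i j assume ij: "i \<in> ?A" "j \<in> ?B" "i \<noteq> j"
            then have "l i + l j < 2 * \<bar>c i - c j\<bar>"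
              using elim(2) ab by (auto simp: blockAq_def)
            moreover have "0 < l i" "0 < l j" by (simp_all add: l_def)
            ultimately have "0 < \<bar>c i - c j\<bar>" by argo
            then show "neglog \<bar>c i - c j\<bar> = ereal (- ln \<bar>c i - c j\<bar>)" by (simp add: neglog_def)
          qed
          also have "\<dots> = ereal (\<Sum>(i,j)\<in>?P. - ln \<bar>c i - c j\<bar>)"
            by (simp add: case_prod_beta')
          also have "(\<Sum>(i,j)\<in>?P. - ln \<bar>c i - c j\<bar>) = ?S"
            unfolding P unfolding case_prod_beta'
            by (subst sum.inter_filter) (auto simp: sum.cartesian_product case_prod_beta')
          finally have eq: "(\<Sum>(i,j)\<in>?P. neglog \<bar>c i - c j\<bar>) = ereal ?S" .
          have "2^a * n \<in> {2^j * n | j. j \<le> q n}" "2^b * n \<in> {2^j * n | j. j \<le> q n}" using ab by auto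
          from bspec[OF bspec[OF elim(1) this(1)] this(2)]
          have "ereal (1 / real (card (?A \<times> ?B))) * ereal ?S < ereal \<epsilon>" unfolding eq .
          then have "1 / real (card (?A \<times> ?B)) * ?S < \<epsilon>" by simp
          then have "?S / (real (2^a * n) * real (2^b * n)) < \<epsilon>"
            by (simp add: card_cartesian_product)
          then show "?S \<le> \<epsilon> * real (2^a * n) * real (2^b * n)"
            using elim(3) by (subst (asm) divide_less_eq) (simp add: mult.assoc)
        qed
      qed
    qed
  qed
  have "log_point_system lam c l w q"
  proof
    show "0 < c k \<and> c k < 1" if "1 \<le> k" for k using c_range[OF that] by simp
    show "w x = 0" if "x \<notin> {0..1}" for x using that by (simp add: w_def)
    show "AE x in lborel. x \<in> {0..1} \<longrightarrow> 0 < w x"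
      using \<phi>_pos by (rule eventually_mono) (auto simp: w_def)
  qed (fact lam_pos l_def wm w0 w_int lim q_lim close separated)+
  from log_point_system.capacity_limsup_set[OF this S_def] show ?thesis by blast
qed

end
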